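(* For every integer $\ell\ge 1$, every finite set of points $P\subset\mathbb{R}^2$, equipped with the Euclidean metric, admits a spanning tree cover consisting of two trees, each of maximum degree at most $1+3(\ell+1)$, with stretch $\dfrac{4\sqrt{26}}{1-2^{-\ell}}$. In particular (for $\ell=1$) there is a spanning tree cover with two trees, each of maximum degree at most $7$, with stretch $8\sqrt{26}$.
   Context: A $t$-tree cover (tree cover with stretch $t\ge 1$) of a metric space $(X,\|\cdot\|_X)$ is a set $\mathcal{T}$ of edge-weighted trees such that $X\subseteq V(T')$ for every $T'\in\mathcal{T}$, and for every two points $x,y\in X$ there exists a tree $T\in\mathcal{T}$ with $\|xy\|_X\le d_T(x,y)\le t\cdot\|xy\|_X$, where $d_T$ is the (weighted) shortest-path distance in $T$. The tree cover is spanning if every tree in $\mathcal{T}$ is a spanning tree of the metric, i.e., its vertex set is exactly $X$ (no additional Steiner points) and each edge $\{x,y\}$ has weight $\|xy\|_X$. For $P\subset\mathbb{R}^2$ the metric is the Euclidean distance restricted to $P$. *)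

theory Defs
  imports "HOL-Analysis.Analysis"
begin

section \<open>Edge-weighted trees\<close>

record 'a wgraph =
  verts :: "'a set"
  edges :: "'a set set"
  weight :: "'a set \<Rightarrow> real"  \<comment> \<open>only the values on \<open>edges\<close> matter\<close>

definition wf_wgraph :: "'a wgraph \<Rightarrow> bool" where
  "wf_wgraph G \<longleftrightarrow>
     (\<forall>e\<in>edges G. \<exists>u\<in>verts G. \<exists>v\<in>verts G. u \<noteq> v \<and> e = {u, v}) \<and>
     (\<forall>e\<in>edges G. 0 \<le> weight G e)"

definition wgraph_path :: "'a wgraph \<Rightarrow> 'a \<Rightarrow> 'a list \<Rightarrow> 'a \<Rightarrow> bool" where
  "wgraph_path G u p v \<longleftrightarrow>
     p \<noteq> [] \<and> hd p = u \<and> last p = v \<and> set p \<subseteq> verts G \<and> distinct p \<and>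
     (\<forall>i. Suc i < length p \<longrightarrow> {p ! i, p ! Suc i} \<in> edges G)"

definition wgraph_cycle :: "'a wgraph \<Rightarrow> 'a list \<Rightarrow> bool" where
  "wgraph_cycle G p \<longleftrightarrow>
     3 \<le> length p \<and> wgraph_path G (hd p) p (last p) \<and> {last p, hd p} \<in> edges G"

(* The graph without vertices counts as a tree, so that the empty metric space
   has a spanning tree. *)
definition wtree :: "'a wgraph \<Rightarrow> bool" where
  "wtree G \<longleftrightarrow> wf_wgraph G \<and>
     (\<forall>u\<in>verts G. \<forall>v\<in>verts G. \<exists>p. wgraph_path G u p v) \<and>
     (\<nexists>p. wgraph_cycle G p)"

definition path_weight :: "'a wgraph \<Rightarrow> 'a list \<Rightarrow> real" where
  "path_weight G p = (\<Sum>i<length p - 1. weight G {p ! i, p ! Suc i})"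

definition wgraph_dist :: "'a wgraph \<Rightarrow> 'a \<Rightarrow> 'a \<Rightarrow> real" where
  "wgraph_dist G u v = (INF p\<in>{p. wgraph_path G u p v}. path_weight G p)"

(* Finiteness is explicit because card is 0 on infinite sets. *)
definition max_degree_le :: "'a wgraph \<Rightarrow> nat \<Rightarrow> bool" where
  "max_degree_le G k \<longleftrightarrow>
     (\<forall>v\<in>verts G. finite {e \<in> edges G. v \<in> e} \<and> card {e \<in> edges G. v \<in> e} \<le> k)"


section \<open>Tree covers\<close>

definition tree_cover :: "real \<Rightarrow> 'a::metric_space set \<Rightarrow> 'a wgraph set \<Rightarrow> bool" where
  "tree_cover t X \<T> \<longleftrightarrow> 1 \<le> t \<and>
     (\<forall>T\<in>\<T>. wtree T \<and> X \<subseteq> verts T) \<and>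
     (\<forall>x\<in>X. \<forall>y\<in>X. \<exists>T\<in>\<T>. dist x y \<le> wgraph_dist T x y \<and> wgraph_dist T x y \<le> t * dist x y)"

definition spanning_tree_of :: "'a::metric_space set \<Rightarrow> 'a wgraph \<Rightarrow> bool" where
  "spanning_tree_of X T \<longleftrightarrow> wtree T \<and> verts T = X \<and>
     (\<forall>x y. {x, y} \<in> edges T \<longrightarrow> weight T {x, y} = dist x y)"

definition spanning_tree_cover :: "real \<Rightarrow> 'a::metric_space set \<Rightarrow> 'a wgraph set \<Rightarrow> bool" where
  "spanning_tree_cover t X \<T> \<longleftrightarrow> tree_cover t X \<T> \<and> (\<forall>T\<in>\<T>. spanning_tree_of X T)"

end

(* A quadtree in which every cell of side type hangs at a corner of its parent, so that the paths between
   points run along diagonals of cells, is a Steiner tree whose path between x and y is a sum of two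
   monotone descents. For the quadtree of squares the path is at most sqrt 26 times the distance, unless
   x and y are separated by an axis and both lie in a triangle spanned by the centre of the separating
   square and one of its sides. Such a triangle is half of a cell of a second quadtree, which consists of
   diamonds and is the same construction rotated by 45 degrees, and there the path is at most
   5 |dx| + |dy|. So two Steiner trees of unbounded degree suffice for stretch sqrt 26.

   Steiner points are removed by a representative r for each subtree, chosen such that the excess over the
   Steiner distance is paid by moving towards the corner A at which the subtree hangs: the walk from x to
   r has length at most kappa h(x) - 3 |rA|, where h(x) is the Steiner distance from x to A. To bound the
   degree, r is replaced by another point as soon as it has taken K light subtrees. The points attached
   to it form a queue; the oldest of them was attached at a cell smaller by a factor 2^K, and the walk to
   it costs theta R with theta (2^K - 1) = 4, which yields kappa = 4 + theta = 4 / (1 - 2^(-K)). *)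
theory Submission
  imports Defs
begin

text \<open>A representative may lie anywhere in its cell, so the excess of a walk cannot be charged
  to one level; the term \<open>- 3 * dist r A\<close> is a credit carried upwards. At a merge at
  \<open>c\<close> a light subtree spends its credit \<open>3 * dist i c\<close> on the edge from
  its representative \<open>i\<close> to the hub \<open>r\<close>. This edge and the new credit
  \<open>3 * dist r A\<close> may exceed the old one by \<open>4 * R\<close>; the other
  \<open>\<theta> * R\<close> of \<open>\<kappa> * R\<close> pays for the walk between
  \<open>r\<close> and its stand-in. The geometry has to show that some representative is always
  affordable as hub. The obstacle is the quarter at the root corner: its own points gain no length
  \<open>R\<close> on this level, so there is no budget for merging it with the others. These are
  joined into a tail that enters the root quarter at \<open>c\<close>, its corner opposite to
  \<open>A\<close>, and this quarter comes last; a tail has the whole diagonal as budget. Both kinds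
  of estimate for the Steiner distance lead to one constant because 26 = 5^2 + 1^2 = 2 * (3^2 +
  2^2): weights 5 and 1 belong to axis-parallel coordinates, weights 3 and 2 to diagonal
  ones.\<close>

section \<open>Trees built by joining, walks of bounded length, degrees\<close>

inductive is_tree :: "'a set \<Rightarrow> 'a set set \<Rightarrow> bool" where
  single: "is_tree {x} {}"
| join: "is_tree X E \<Longrightarrow> is_tree Y F \<Longrightarrow> X \<inter> Y = {} \<Longrightarrow> x \<in> X \<Longrightarrow> y \<in> Y \<Longrightarrow>
    is_tree (X \<union> Y) (insert {x, y} (E \<union> F))"

lemma is_tree_finite: "is_tree X E \<Longrightarrow> finite X \<and> finite E \<and> X \<noteq> {}"
  by (induction rule: is_tree.induct) auto

lemma is_tree_edge: "is_tree X E \<Longrightarrow> e \<in> E \<Longrightarrow> \<exists>u\<in>X. \<exists>v\<in>X. u \<noteq> v \<and> e = {u, v}"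
proof (induction rule: is_tree.induct)
  case (join X E Y F x y)
  from join.prems consider "e = {x, y}" | "e \<in> E" | "e \<in> F" by blast
  then show ?case
  proof cases
    case 1
    have "x \<noteq> y" using join.hyps(3-5) by blast
    then show ?thesis using 1 join.hyps(4,5) by (intro bexI[of _ x] bexI[of _ y]) auto
  next
    case 2
    from join.IH(1)[OF this] obtain u v where "u \<in> X" "v \<in> X" "u \<noteq> v \<and> e = {u, v}" by auto
    then show ?thesis by (intro bexI[of _ u] bexI[of _ v]) auto
  next
    case 3
    from join.IH(2)[OF this] obtain u v where "u \<in> Y" "v \<in> Y" "u \<noteq> v \<and> e = {u, v}" by auto
    then show ?thesis by (intro bexI[of _ u] bexI[of _ v]) auto
  qed
qed simp

lemma is_tree_edge_subset: "is_tree X E \<Longrightarrow> e \<in> E \<Longrightarrow> e \<subseteq> X"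
  using is_tree_edge by fastforce

text \<open>Walks are recorded by an upper bound on their length instead of a vertex list: all later
  estimates are upper bounds, and these simply add up under concatenation. Simple paths appear only
  when \<open>wgraph_dist\<close> is computed.\<close>

inductive walk_le :: "'a::metric_space set set \<Rightarrow> 'a \<Rightarrow> 'a \<Rightarrow> real \<Rightarrow> bool" for E where
  refl: "0 \<le> L \<Longrightarrow> walk_le E x x L"
| step: "{x, y} \<in> E \<Longrightarrow> walk_le E y z M \<Longrightarrow> dist x y + M \<le> L \<Longrightarrow> walk_le E x z L"

lemma walk_le_le: "walk_le E x y L \<Longrightarrow> L \<le> L' \<Longrightarrow> walk_le E x y L'"
proof (induction arbitrary: L' rule: walk_le.induct)
  case (step x y z M L)
  show ?case by (rule walk_le.step[OF step(1,2)]) (use step in simp)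
qed (simp add: walk_le.refl)

lemma walk_le_mono: "walk_le E x y L \<Longrightarrow> E \<subseteq> F \<Longrightarrow> walk_le F x y L"
proof (induction rule: walk_le.induct)
  case (step x y z M L)
  show ?case by (rule walk_le.step[of x y F z M]) (use step in auto)
qed (simp add: walk_le.refl)

lemma walk_le_trans: "walk_le E x y L \<Longrightarrow> walk_le E y z M \<Longrightarrow> walk_le E x z (L + M)"
proof (induction arbitrary: M rule: walk_le.induct)
  case (refl L x)
  then show ?case by (auto elim: walk_le_le)
next
  case (step x y w M' L)
  show ?case by (rule walk_le.step[OF step(1) step(4)[OF step(5)]]) (use step(3) in simp)
qed

lemma walk_le_edge: "{x, y} \<in> E \<Longrightarrow> walk_le E x y (dist x y)"
  using walk_le.step[of x y E y 0 "dist x y"] walk_le.refl[of 0 E y] by simp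

lemma walk_le_sym: "walk_le E x y L \<Longrightarrow> walk_le E y x L"
proof (induction rule: walk_le.induct)
  case (step x y z M L)
  have "walk_le E y x (dist x y)" using walk_le_edge[of y x E] step(1) by (simp add: insert_commute dist_commute)
  then have "walk_le E z x (M + dist x y)" using step(4) walk_le_trans by blast
  then show ?case using step(3) by (elim walk_le_le) simp
qed (simp add: walk_le.refl)

definition deg :: "'a set set \<Rightarrow> 'a \<Rightarrow> nat" where
  "deg E v = card {e \<in> E. v \<in> e}"

lemma deg_empty [simp]: "deg {} v = 0"
  by (simp add: deg_def)

text \<open>Edges stay within their own vertex set, so the joining edge is new and no edge of one
  tree is incident with a vertex of the other.\<close>

lemma deg_join:
  assumes "is_tree X E" "is_tree Y F" "X \<inter> Y = {}" "x \<in> X" "y \<in> Y"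
  shows "v \<in> X \<Longrightarrow> deg (insert {x, y} (E \<union> F)) v = deg E v + (if v = x then 1 else 0)"
    and "v \<in> Y \<Longrightarrow> deg (insert {x, y} (E \<union> F)) v = deg F v + (if v = y then 1 else 0)"
proof -
  note E = is_tree_edge_subset[OF assms(1)] and F = is_tree_edge_subset[OF assms(2)]
  have fin: "finite E" "finite F" using is_tree_finite[OF assms(1)] is_tree_finite[OF assms(2)] by auto
  have new: "{x, y} \<notin> E" "{x, y} \<notin> F" using E[of "{x, y}"] F[of "{x, y}"] assms by auto
  { assume v: "v \<in> X"
    then have "{e \<in> F. v \<in> e} = {}" "v \<noteq> y" using F assms(3,5) by blast+
    then have "{e \<in> insert {x, y} (E \<union> F). v \<in> e} =
        (if v = x then insert {x, y} {e \<in> E. v \<in> e} else {e \<in> E. v \<in> e})"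
      by auto
    then show "deg (insert {x, y} (E \<union> F)) v = deg E v + (if v = x then 1 else 0)"
      using fin new by (simp add: deg_def) }
  { assume v: "v \<in> Y"
    then have "{e \<in> E. v \<in> e} = {}" "v \<noteq> x" using E assms(3,4) by blast+
    then have "{e \<in> insert {x, y} (E \<union> F). v \<in> e} =
        (if v = y then insert {x, y} {e \<in> F. v \<in> e} else {e \<in> F. v \<in> e})"
      by auto
    then show "deg (insert {x, y} (E \<union> F)) v = deg F v + (if v = y then 1 else 0)"
      using fin new by (simp add: deg_def) }
qed

lemma is_tree_connected: "is_tree X E \<Longrightarrow> x \<in> X \<Longrightarrow> y \<in> X \<Longrightarrow> \<exists>L. walk_le (E::'a::metric_space set set) x y L"
proof (induction arbitrary: x y rule: is_tree.induct)
  case (single z)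
  then show ?case by (auto intro!: exI[of _ 0] walk_le.refl)
next
  case (join X E Y F a b)
  let ?G = "insert {a, b} (E \<union> F)"
  have "\<exists>L. walk_le ?G u a L" if u: "u \<in> X \<union> Y" for u
  proof (cases "u \<in> X")
    case True
    then obtain L where "walk_le E u a L" using join.IH(1)[OF True \<open>a \<in> X\<close>] by blast
    then have "walk_le ?G u a L" by (rule walk_le_mono) auto
    then show ?thesis by blast
  next
    case False
    then have "u \<in> Y" using u by blast
    then obtain L where "walk_le F u b L" using join.IH(2)[OF _ \<open>b \<in> Y\<close>] by blast
    then have "walk_le ?G u b L" by (rule walk_le_mono) auto
    moreover have "walk_le ?G b a (dist b a)" by (rule walk_le_edge) (simp add: insert_commute)
    ultimately show ?thesis using walk_le_trans[of ?G u b L a] by blast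
  qed
  then obtain L M where "walk_le ?G x a L" "walk_le ?G y a M" using join.prems by meson
  then show ?case using walk_le_trans[of ?G x a L y M] walk_le_sym[of ?G y a M] by blast
qed

lemma is_tree_image:
  assumes "is_tree X E" "inj_on g X"
  shows "is_tree (g ` X) ((`) g ` E)"
  using assms
proof (induction rule: is_tree.induct)
  case (single x)
  then show ?case by (simp add: is_tree.single)
next
  case (join X E Y F x y)
  have "is_tree (g ` X \<union> g ` Y) (insert {g x, g y} ((`) g ` E \<union> (`) g ` F))"
  proof (rule is_tree.join)
    show "g ` X \<inter> g ` Y = {}" using join by (auto simp: inj_on_def)
    show "is_tree (g ` X) ((`) g ` E)" "is_tree (g ` Y) ((`) g ` F)"
      using join by (auto simp: inj_on_def)
  qed (use join in auto)
  then show ?case by (simp add: image_Un)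
qed

lemma walk_le_image:
  assumes "is_tree X E" "walk_le E x y L" "x \<in> X" "\<And>u v. u \<in> X \<Longrightarrow> v \<in> X \<Longrightarrow> dist (g u) (g v) = dist u v"
  shows "walk_le ((`) g ` E) (g x) (g y) L"
  using assms(2,3)
proof (induction rule: walk_le.induct)
  case (step x y z M L)
  have "y \<in> X" using is_tree_edge_subset[OF assms(1) step(1)] by simp
  moreover have "{g x, g y} \<in> (`) g ` E" using imageI[OF step(1), of "(`) g"] by simp
  ultimately show ?case using step assms(4)[of x y] by (intro walk_le.step[of "g x" "g y" _ "g z" M]) simp_all
qed (simp add: walk_le.refl)

lemma deg_image:
  assumes "is_tree X E" "inj_on g X" "x \<in> X"
  shows "deg ((`) g ` E) (g x) = deg E x"
proof -
  note sub = is_tree_edge_subset[OF assms(1)]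
  have "g x \<in> g ` e \<longleftrightarrow> x \<in> e" if "e \<in> E" for e
    using inj_on_image_mem_iff[OF assms(2,3) sub[OF that]] .
  then have "{e \<in> (`) g ` E. g x \<in> e} = (`) g ` {e \<in> E. x \<in> e}" by auto
  moreover have "inj_on ((`) g) {e \<in> E. x \<in> e}"
    by (rule inj_onI) (use sub inj_on_image_eq_iff[OF assms(2)] in simp)
  ultimately show ?thesis by (simp add: deg_def card_image)
qed

section \<open>From built trees to weighted graphs and their distance\<close>

text \<open>The weight has to be a function of the edge as a set; the diameter of a two-point set is
  the distance of its points, whichever comes first.\<close>

definition metric_graph :: "'a::metric_space set \<Rightarrow> 'a set set \<Rightarrow> 'a wgraph" where
  "metric_graph X E = \<lparr>verts = X, edges = E, weight = diameter\<rparr>"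

lemma diameter_pair [simp]: "diameter {x, y} = dist x (y::'a::metric_space)"
proof -
  have "{x, y} \<times> {x, y} = {(x, x), (x, y), (y, x), (y, y)}" by auto
  then show ?thesis by (auto simp: diameter_def dist_commute cSup_eq_Max)
qed

lemma metric_graph_sel [simp]:
  "verts (metric_graph X E) = X" "edges (metric_graph X E) = E" "weight (metric_graph X E) = diameter"
  by (simp_all add: metric_graph_def)

lemma path_weight_Cons:
  "path_weight (metric_graph X E) (x # y # p) = dist x y + path_weight (metric_graph X E) (y # p)"
  by (simp add: path_weight_def sum.lessThan_Suc_shift del: sum.lessThan_Suc)

lemma path_weight_single [simp]: "path_weight G [x] = 0"
  by (simp add: path_weight_def)

lemma path_weight_nonneg: "0 \<le> path_weight (metric_graph X E) p"
  by (auto simp: path_weight_def intro: sum_nonneg)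

lemma dist_le_path_weight: "p \<noteq> [] \<Longrightarrow> dist (hd p) (last p) \<le> path_weight (metric_graph X E) p"
proof (induction p rule: induct_list012)
  case (3 x y zs)
  then show ?case
    using dist_triangle[of x "last (y # zs)" y] by (simp add: path_weight_Cons)
qed auto

lemma wgraph_path_Cons:
  assumes "wgraph_path G y p z" "x \<in> verts G" "x \<notin> set p" "{x, y} \<in> edges G"
  shows "wgraph_path G x (x # p) z"
  using assms unfolding wgraph_path_def
  by (auto simp: nth_Cons hd_conv_nth split: nat.split)

lemma wgraph_path_drop:
  assumes "wgraph_path G y (q @ x # p) z"
  shows "wgraph_path G x (x # p) z"
proof -
  have "{(x # p) ! i, (x # p) ! Suc i} \<in> edges G" if "Suc i < length (x # p)" for i
  proof -
    have "\<forall>i. Suc i < length (q @ x # p) \<longrightarrow> {(q @ x # p) ! i, (q @ x # p) ! Suc i} \<in> edges G"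
      using assms unfolding wgraph_path_def by blast
    from this[rule_format, of "length q + i"] that
    show ?thesis
      using nth_append_length_plus[of q "x # p" i] nth_append_length_plus[of q "x # p" "Suc i"] by simp
  qed
  then show ?thesis using assms unfolding wgraph_path_def by auto
qed

lemma path_weight_drop:
  "path_weight (metric_graph X E) (x # p) \<le> path_weight (metric_graph X E) (q @ x # p)"
proof (induction q)
  case (Cons a q)
  obtain b r where "q @ x # p = b # r" by (cases q) auto
  then show ?case using Cons by (simp add: path_weight_Cons) (smt (verit) zero_le_dist)
qed simp

text \<open>By induction on the walk: if the simple path from the next vertex already visits
  \<open>x\<close>, its suffix from \<open>x\<close> on is taken, which is no longer than the path
  itself.\<close>

lemma walk_le_path:
  assumes "walk_le E x y L" "x \<in> X" "\<And>e. e \<in> E \<Longrightarrow> e \<subseteq> X"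
  shows "\<exists>p. wgraph_path (metric_graph X E) x p y \<and> path_weight (metric_graph X E) p \<le> L"
  using assms(1,2)
proof (induction rule: walk_le.induct)
  case (refl L x)
  then show ?case by (intro exI[of _ "[x]"]) (auto simp: wgraph_path_def)
next
  case (step x y z M L)
  have "y \<in> X" using step(1) assms(3) by blast
  then obtain p where p: "wgraph_path (metric_graph X E) y p z" "path_weight (metric_graph X E) p \<le> M"
    using step by blast
  show ?case
  proof (cases "x \<in> set p")
    case True
    then obtain q r where "p = q @ x # r" by (meson split_list)
    then show ?thesis using p wgraph_path_drop path_weight_drop[of X E x r q] step(3)
      by (smt (verit) zero_le_dist)
  next
    case False
    have "p = y # tl p" using p by (metis list.collapse wgraph_path_def)
    then have "path_weight (metric_graph X E) (x # p) \<le> L"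
      using p step(3) path_weight_Cons[of X E x y "tl p"] by simp
    moreover have "wgraph_path (metric_graph X E) x (x # p) z"
      using p False step by (intro wgraph_path_Cons[of _ y]) auto
    ultimately show ?thesis by blast
  qed
qed

lemma wgraph_cycle_edge:
  assumes "wgraph_cycle G p" "k < length p"
  shows "{p ! k, p ! (Suc k mod length p)} \<in> edges G"
proof (cases "Suc k < length p")
  case True
  then show ?thesis using assms by (auto simp: wgraph_cycle_def wgraph_path_def)
next
  case False
  then have "Suc k = length p" using assms by simp
  moreover have "p \<noteq> []" using assms by auto
  moreover have "length p - Suc 0 = k" using \<open>Suc k = length p\<close> by simp
  ultimately show ?thesis using assms
    by (simp add: wgraph_cycle_def hd_conv_nth last_conv_nth)
qed

lemma wgraph_cycleI:
  assumes "3 \<le> length p" "set p \<subseteq> verts G" "distinct p"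
    "\<And>k. k < length p \<Longrightarrow> {p ! k, p ! (Suc k mod length p)} \<in> edges G"
  shows "wgraph_cycle G p"
proof -
  have "p \<noteq> []" using assms by auto
  moreover have "{p ! i, p ! Suc i} \<in> edges G" if "Suc i < length p" for i
    using assms(4)[of i] that by simp
  moreover have "{last p, hd p} \<in> edges G"
    using assms(4)[of "length p - 1"] assms(1) \<open>p \<noteq> []\<close>
    by (simp add: last_conv_nth hd_conv_nth)
  ultimately show ?thesis using assms by (auto simp: wgraph_cycle_def wgraph_path_def)
qed

text \<open>Finds a place where a cyclic sequence leaves a set: indices are read modulo the length,
  and the end index is shifted by one turn so that it comes after the start.\<close>

lemma switch_ex:
  fixes a b :: nat
  assumes "a \<le> b" "P a" "\<not> P b"
  shows "\<exists>i. P i \<and> \<not> P (Suc i)"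
  using assms by (induction rule: dec_induct) blast+

text \<open>A cycle inside one side is excluded by induction. Any other cycle leaves
  \<open>X\<close> and returns to it, both times through the only edge between the sides; by
  distinctness two steps lead back to the same index, so the length divides 2.\<close>

lemma is_tree_acyclic: "is_tree X E \<Longrightarrow> \<not> wgraph_cycle (metric_graph X E) p"
proof (induction arbitrary: p rule: is_tree.induct)
  case (single x)
  show ?case
  proof
    assume "wgraph_cycle (metric_graph {x} {}) p"
    then show False by (auto simp: wgraph_cycle_def)
  qed
next
  case (join X E Y F x y)
  let ?G = "metric_graph (X \<union> Y) (insert {x, y} (E \<union> F))"
  let ?n = "length p"
  note E = is_tree_edge_subset[OF join(1)] and F = is_tree_edge_subset[OF join(2)]
  show ?case
  proof
    assume c: "wgraph_cycle ?G p"
    then have n: "3 \<le> ?n" and V: "set p \<subseteq> X \<union> Y" and d: "distinct p"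
      by (auto simp: wgraph_cycle_def wgraph_path_def)
    have ed: "{p ! k, p ! (Suc k mod ?n)} \<in> insert {x, y} (E \<union> F)" if "k < ?n" for k
      using wgraph_cycle_edge[OF c that] by simp
    have mem: "p ! (k mod ?n) \<in> X \<union> Y" for k
    proof -
      have "0 < ?n" using n by linarith
      then have "k mod ?n < ?n" by simp
      then show ?thesis using V nth_mem by blast
    qed
    show False
    proof (cases "set p \<subseteq> X \<or> set p \<subseteq> Y")
      case True
      then show False
      proof
        assume a: "set p \<subseteq> X"
        have "wgraph_cycle (metric_graph X E) p"
        proof (rule wgraph_cycleI)
          fix k assume k: "k < ?n"
          have "p ! k \<in> X" "p ! (Suc k mod ?n) \<in> X"
            using a k n by (meson nth_mem subsetD mod_less_divisor less_le_trans zero_less_numeral)+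
          then show "{p ! k, p ! (Suc k mod ?n)} \<in> edges (metric_graph X E)"
            using ed[OF k] F join by (auto simp: doubleton_eq_iff)
        qed (use n a d in auto)
        then show False using join.IH by blast
      next
        assume a: "set p \<subseteq> Y"
        have "wgraph_cycle (metric_graph Y F) p"
        proof (rule wgraph_cycleI)
          fix k assume k: "k < ?n"
          have "p ! k \<in> Y" "p ! (Suc k mod ?n) \<in> Y"
            using a k n by (meson nth_mem subsetD mod_less_divisor less_le_trans zero_less_numeral)+
          then show "{p ! k, p ! (Suc k mod ?n)} \<in> edges (metric_graph Y F)"
            using ed[OF k] E join by (auto simp: doubleton_eq_iff)
        qed (use n a d in auto)
        then show False using join.IH by blast
      qed
    next
      case False
      let ?P = "\<lambda>k. p ! (k mod ?n) \<in> X"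
      obtain a where a: "a < ?n" "p ! a \<in> X" using False V
        by (metis UnE in_set_conv_nth subsetD subsetI)
      obtain b where b: "b < ?n" "p ! b \<notin> X" using False V
        by (metis in_set_conv_nth subsetI)
      have "\<exists>i. ?P i \<and> \<not> ?P (Suc i)"
        by (rule switch_ex[of a "b + ?n"]) (use a b in auto)
      then obtain i where i: "?P i" "\<not> ?P (Suc i)" by blast
      have "\<exists>j. \<not> ?P j \<and> \<not> \<not> ?P (Suc j)"
        by (rule switch_ex[of b "a + ?n"]) (use a b in auto)
      then obtain j where j: "\<not> ?P j" "?P (Suc j)" by blast
      have n0: "0 < ?n" using n by linarith
      have "{p ! (i mod ?n), p ! (Suc i mod ?n)} \<in> insert {x, y} (E \<union> F)"
        using ed[of "i mod ?n"] n0 by (simp add: mod_Suc_eq)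
      then have 1: "p ! (i mod ?n) = x" "p ! (Suc i mod ?n) = y"
        using i mem[of "Suc i"] E F join by (auto simp: doubleton_eq_iff)
      have "{p ! (j mod ?n), p ! (Suc j mod ?n)} \<in> insert {x, y} (E \<union> F)"
        using ed[of "j mod ?n"] n0 by (simp add: mod_Suc_eq)
      then have 2: "p ! (j mod ?n) = y" "p ! (Suc j mod ?n) = x"
        using j mem[of "j"] E F join by (auto simp: doubleton_eq_iff)
      have e1: "j mod ?n = Suc i mod ?n" using 1 2 d n0 nth_eq_iff_index_eq
        by (metis mod_less_divisor)
      have e2: "i mod ?n = Suc j mod ?n" using 1 2 d n0 nth_eq_iff_index_eq
        by (metis mod_less_divisor)
      have "i mod ?n = Suc (Suc i) mod ?n" using e1 e2 by (metis mod_Suc_eq)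
      then have "?n dvd 2" by (metis add_2_eq_Suc' mod_eq_dvd_iff_nat diff_add_inverse le_add1)
      then show False using n by (auto dest: dvd_imp_le)
    qed
  qed
qed

theorem is_tree_metric_graph:
  assumes "is_tree X E"
  shows "spanning_tree_of X (metric_graph X E)"
    and "\<And>x y L. x \<in> X \<Longrightarrow> walk_le E x y L \<Longrightarrow> wgraph_dist (metric_graph X E) x y \<le> L"
    and "\<And>x y. x \<in> X \<Longrightarrow> y \<in> X \<Longrightarrow> dist x y \<le> wgraph_dist (metric_graph X E) x y"
    and "\<And>k. (\<And>x. x \<in> X \<Longrightarrow> deg E x \<le> k) \<Longrightarrow> max_degree_le (metric_graph X E) k"
proof -
  let ?G = "metric_graph X E"
  note sub = is_tree_edge_subset[OF assms(1)]
  have p: "\<exists>p. wgraph_path ?G x p y \<and> path_weight ?G p \<le> L" if "walk_le E x y L" "x \<in> X" for x y L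
    by (rule walk_le_path[OF that]) (rule sub)
  have path: "\<exists>p. wgraph_path ?G x p y" if xy: "x \<in> X" "y \<in> X" for x y
  proof -
    obtain L where L: "walk_le E x y L" using is_tree_connected[OF assms xy] by (elim exE)
    show ?thesis using p[OF L xy(1)] by (elim exE conjE) (rule exI)
  qed
  have "0 \<le> diameter e" if "e \<in> E" for e
    using is_tree_edge[OF assms that] by (elim bexE conjE) simp
  then have wf: "wf_wgraph ?G"
    using is_tree_edge[OF assms] by (simp add: wf_wgraph_def)
  show "spanning_tree_of X ?G"
    using wf path is_tree_acyclic[OF assms] by (simp add: spanning_tree_of_def wtree_def)
  show "wgraph_dist ?G x y \<le> L" if xy: "x \<in> X" "walk_le E x y L" for x y L
  proof -
    obtain p where "wgraph_path ?G x p y" "path_weight ?G p \<le> L"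
      using p[OF xy(2,1)] by (elim exE conjE)
    moreover have "bdd_below (path_weight ?G ` {p. wgraph_path ?G x p y})"
      by (rule bdd_belowI2[of _ 0]) (simp add: path_weight_nonneg)
    ultimately show ?thesis unfolding wgraph_dist_def
      by (intro cINF_lower2[where x = p]) simp_all
  qed
  show "dist x y \<le> wgraph_dist ?G x y" if "x \<in> X" "y \<in> X" for x y
    unfolding wgraph_dist_def
  proof (rule cINF_greatest)
    show "{p. wgraph_path ?G x p y} \<noteq> {}" using path[OF that] by blast
    show "dist x y \<le> path_weight ?G p" if "p \<in> {p. wgraph_path ?G x p y}" for p
      using that dist_le_path_weight[of p X E] by (auto simp: wgraph_path_def)
  qed
  show "max_degree_le ?G k" if "\<And>x. x \<in> X \<Longrightarrow> deg E x \<le> k" for k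
    using that is_tree_finite[OF assms] by (simp add: max_degree_le_def deg_def)
qed

section \<open>Plane norms and convex functions composed of them\<close>

text \<open>A norm on pairs of reals, so that the inequalities below turn into polynomial arithmetic
  in the coordinates.\<close>

definition N :: "real \<Rightarrow> real \<Rightarrow> real" where "N a b = cmod (Complex a b)"

lemma N_sq: "(N a b)\<^sup>2 = a\<^sup>2 + b\<^sup>2"
  by (simp add: N_def cmod_def)

lemma N_ge0 [simp]: "0 \<le> N a b"
  by (simp add: N_def)

lemma N_le: "0 \<le> r \<Longrightarrow> a\<^sup>2 + b\<^sup>2 \<le> r\<^sup>2 \<Longrightarrow> N a b \<le> r"
  by (metis N_sq N_ge0 power2_le_imp_le)

lemma N_ge: "r\<^sup>2 \<le> a\<^sup>2 + b\<^sup>2 \<Longrightarrow> r \<le> N a b"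
  by (metis N_sq N_ge0 power2_le_imp_le)

lemma N_tri: "N (a + c) (b + d) \<le> N a b + N c d"
  unfolding N_def by (metis complex_add norm_triangle_ineq)

lemma N_tri2: "N (a - c) (b - d) \<le> N (a - x) (b - y) + N (c - x) (d - y)"
proof -
  have "Complex (a - c) (b - d) = Complex (a - x) (b - y) - Complex (c - x) (d - y)"
    by (simp add: complex_eq_iff)
  then show ?thesis unfolding N_def by (metis norm_triangle_ineq4)
qed

lemma N_tri0: "N (a - c) (b - d) \<le> N a b + N c d"
  using N_tri2[of a c b d 0 0] by simp

lemma N_minus: "N (a - c) (b - d) = N (c - a) (d - b)"
  unfolding N_def cmod_def by (simp add: power2_commute)

lemma N_conj [simp]: "N a (- b) = N a b" "N (- a) b = N a b"
  by (simp_all add: N_def cmod_def)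

lemma N_0 [simp]: "N 0 0 = 0" "N a 0 = \<bar>a\<bar>" "N 0 a = \<bar>a\<bar>"
  by (simp_all add: N_def cmod_def)

lemma N_scale: "0 \<le> l \<Longrightarrow> N (l * a) (l * b) = l * N a b"
  by (simp add: N_def cmod_def power_mult_distrib flip: distrib_left) (simp add: real_sqrt_mult)

text \<open>Cauchy-Schwarz by Lagrange's identity, the defect being the square of
  \<open>p * b - q * a\<close>. It replaces a negative multiple of a norm by a linear form.\<close>

lemma N_lin: "p\<^sup>2 + q\<^sup>2 \<le> 1 \<Longrightarrow> p * a + q * b \<le> N a b"
proof (rule N_ge)
  assume pq: "p\<^sup>2 + q\<^sup>2 \<le> 1"
  have "(p * a + q * b)\<^sup>2 + (p * b - q * a)\<^sup>2 = (p\<^sup>2 + q\<^sup>2) * (a\<^sup>2 + b\<^sup>2)" by algebra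
  then have "(p * a + q * b)\<^sup>2 \<le> (p\<^sup>2 + q\<^sup>2) * (a\<^sup>2 + b\<^sup>2)"
    using zero_le_power2[of "p * b - q * a"] by linarith
  also have "\<dots> \<le> a\<^sup>2 + b\<^sup>2"
    using mult_right_mono[OF pq, of "a\<^sup>2 + b\<^sup>2"] by simp
  finally show "(p * a + q * b)\<^sup>2 \<le> a\<^sup>2 + b\<^sup>2" .
qed

lemma N_conv:
  assumes "0 \<le> l" "0 \<le> m" "0 \<le> n" "l + m + n = 1"
  shows "N (l * x1 + m * x2 + n * x3 - a) (l * y1 + m * y2 + n * y3 - b) \<le>
    l * N (x1 - a) (y1 - b) + m * N (x2 - a) (y2 - b) + n * N (x3 - a) (y3 - b)"
proof -
  have l: "l = 1 - m - n" using assms by simp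
  have "l * x1 + m * x2 + n * x3 - a = l * (x1 - a) + m * (x2 - a) + n * (x3 - a)"
    "l * y1 + m * y2 + n * y3 - b = l * (y1 - b) + m * (y2 - b) + n * (y3 - b)"
    unfolding l by algebra+
  then show ?thesis
    using N_tri[of "l * (x1 - a) + m * (x2 - a)" "n * (x3 - a)" "l * (y1 - b) + m * (y2 - b)" "n * (y3 - b)"]
      N_tri[of "l * (x1 - a)" "m * (x2 - a)" "l * (y1 - b)" "m * (y2 - b)"]
    by (simp add: N_scale assms)
qed

text \<open>The common shape of the functions to be maximised: multiples of the distances to three
  fixed points plus a linear form. With nonnegative multiples it is convex, so its maximum over a
  polygon is attained at a corner.\<close>

definition F4 :: "real \<Rightarrow> real \<Rightarrow> real \<Rightarrow> real \<Rightarrow> real \<Rightarrow> real \<Rightarrow> real \<Rightarrow> real \<Rightarrow> real \<Rightarrow> real \<Rightarrow> real \<Rightarrow> real \<Rightarrow> real \<Rightarrow> real" where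
  "F4 \<alpha> a a' \<beta> b b' \<gamma> c c' p q x y =
    \<alpha> * N (x - a) (y - a') + \<beta> * N (x - b) (y - b') + \<gamma> * N (x - c) (y - c') + p * x + q * y"

lemma F4_conv:
  assumes "0 \<le> l" "0 \<le> m" "0 \<le> n" "l + m + n = 1" "0 \<le> \<alpha>" "0 \<le> \<beta>" "0 \<le> \<gamma>"
    "F4 \<alpha> a a' \<beta> b b' \<gamma> c c' p q x1 y1 \<le> B" "F4 \<alpha> a a' \<beta> b b' \<gamma> c c' p q x2 y2 \<le> B"
    "F4 \<alpha> a a' \<beta> b b' \<gamma> c c' p q x3 y3 \<le> B"
  shows "F4 \<alpha> a a' \<beta> b b' \<gamma> c c' p q (l * x1 + m * x2 + n * x3) (l * y1 + m * y2 + n * y3) \<le> B"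
proof -
  note C = N_conv[OF assms(1-4)]
  have "F4 \<alpha> a a' \<beta> b b' \<gamma> c c' p q (l * x1 + m * x2 + n * x3) (l * y1 + m * y2 + n * y3) \<le>
     l * F4 \<alpha> a a' \<beta> b b' \<gamma> c c' p q x1 y1 + m * F4 \<alpha> a a' \<beta> b b' \<gamma> c c' p q x2 y2 +
     n * F4 \<alpha> a a' \<beta> b b' \<gamma> c c' p q x3 y3"
    using mult_left_mono[OF C[of x1 x2 x3 a y1 y2 y3 a'] assms(5)]
      mult_left_mono[OF C[of x1 x2 x3 b y1 y2 y3 b'] assms(6)]
      mult_left_mono[OF C[of x1 x2 x3 c y1 y2 y3 c'] assms(7)]
    unfolding F4_def by (simp add: algebra_simps)
  also have "\<dots> \<le> l * B + m * B + n * B"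
    using assms by (intro add_mono mult_left_mono)
  also have "\<dots> = B" using assms(4) by (metis distrib_right mult_1)
  finally show ?thesis .
qed

text \<open>Half squares are triangles, so a convex function is bounded by its values at three corners.\<close>

lemma F4_up:
  assumes "\<bar>x\<bar> \<le> y" "\<bar>x\<bar> + y \<le> 1" "0 \<le> \<alpha>" "0 \<le> \<beta>" "0 \<le> \<gamma>"
    "F4 \<alpha> a a' \<beta> b b' \<gamma> c c' p q 0 0 \<le> B" "F4 \<alpha> a a' \<beta> b b' \<gamma> c c' p q 0 1 \<le> B"
    "0 \<le> x \<Longrightarrow> F4 \<alpha> a a' \<beta> b b' \<gamma> c c' p q (1/2) (1/2) \<le> B"
    "x \<le> 0 \<Longrightarrow> F4 \<alpha> a a' \<beta> b b' \<gamma> c c' p q (-1/2) (1/2) \<le> B"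
  shows "F4 \<alpha> a a' \<beta> b b' \<gamma> c c' p q x y \<le> B"
proof (cases "0 \<le> x")
  case True
  \<comment> \<open>The coefficients are the barycentric coordinates of \<open>(x, y)\<close> in the
    triangle with corners \<open>(0, 0)\<close>, \<open>(0, 1)\<close> and
    \<open>(1/2, 1/2)\<close>.\<close>
  have "F4 \<alpha> a a' \<beta> b b' \<gamma> c c' p q ((1 - x - y) * 0 + (y - x) * 0 + 2 * x * (1/2))
      ((1 - x - y) * 0 + (y - x) * 1 + 2 * x * (1/2)) \<le> B"
    by (rule F4_conv) (use assms True in auto)
  then show ?thesis by simp
next
  case False
  have "F4 \<alpha> a a' \<beta> b b' \<gamma> c c' p q ((1 + x - y) * 0 + (y + x) * 0 + (- 2 * x) * (-1/2))
      ((1 + x - y) * 0 + (y + x) * 1 + (- 2 * x) * (1/2)) \<le> B"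
    by (rule F4_conv) (use assms False in auto)
  then show ?thesis by simp
qed

text \<open>The split at \<open>y\<close> is strict on one side, so that a coefficient defined by
  cases on \<open>0 \<le> y\<close> can be resolved in each half.\<close>

lemma F4_left:
  assumes "\<bar>y\<bar> \<le> - x" "\<bar>y\<bar> - x \<le> 1" "0 \<le> \<alpha>" "0 \<le> \<beta>" "0 \<le> \<gamma>"
    "F4 \<alpha> a a' \<beta> b b' \<gamma> c c' p q 0 0 \<le> B" "F4 \<alpha> a a' \<beta> b b' \<gamma> c c' p q (-1) 0 \<le> B"
    "0 \<le> y \<Longrightarrow> F4 \<alpha> a a' \<beta> b b' \<gamma> c c' p q (-1/2) (1/2) \<le> B"
    "y < 0 \<Longrightarrow> F4 \<alpha> a a' \<beta> b b' \<gamma> c c' p q (-1/2) (-1/2) \<le> B"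
  shows "F4 \<alpha> a a' \<beta> b b' \<gamma> c c' p q x y \<le> B"
proof (cases "0 \<le> y")
  case True
  have "F4 \<alpha> a a' \<beta> b b' \<gamma> c c' p q ((1 + x - y) * 0 + (- x - y) * (-1) + 2 * y * (-1/2))
      ((1 + x - y) * 0 + (- x - y) * 0 + 2 * y * (1/2)) \<le> B"
    by (rule F4_conv) (use assms True in auto)
  then show ?thesis by simp
next
  case False
  have "F4 \<alpha> a a' \<beta> b b' \<gamma> c c' p q ((1 + x + y) * 0 + (- x + y) * (-1) + (- 2 * y) * (-1/2))
      ((1 + x + y) * 0 + (- x + y) * 0 + (- 2 * y) * (-1/2)) \<le> B"
    by (rule F4_conv) (use assms False in auto)
  then show ?thesis by simp
qed

lemma F4_down:
  assumes "\<bar>x\<bar> \<le> - y" "\<bar>x\<bar> - y \<le> 1" "0 \<le> \<alpha>" "0 \<le> \<beta>" "0 \<le> \<gamma>"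
    "F4 \<alpha> a a' \<beta> b b' \<gamma> c c' p q 0 0 \<le> B" "F4 \<alpha> a a' \<beta> b b' \<gamma> c c' p q 0 (-1) \<le> B"
    "0 \<le> x \<Longrightarrow> F4 \<alpha> a a' \<beta> b b' \<gamma> c c' p q (1/2) (-1/2) \<le> B"
    "x \<le> 0 \<Longrightarrow> F4 \<alpha> a a' \<beta> b b' \<gamma> c c' p q (-1/2) (-1/2) \<le> B"
  shows "F4 \<alpha> a a' \<beta> b b' \<gamma> c c' p q x y \<le> B"
proof -
  have r: "F4 \<alpha> a (-a') \<beta> b (-b') \<gamma> c (-c') p (-q) u (-v) = F4 \<alpha> a a' \<beta> b b' \<gamma> c c' p q u v" for u v
  proof -
    have "N (u - z) (- v - (- z')) = N (u - z) (v - z')" for z z'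
      using N_conj(1)[of "u - z" "v - z'"] by simp
    then show ?thesis unfolding F4_def by simp
  qed
  have "F4 \<alpha> a (-a') \<beta> b (-b') \<gamma> c (-c') p (-q) x (-y) \<le> B"
    by (rule F4_up) (use assms r[of 0 0] r[of 0 "-1"] r[of "1/2" "-1/2"] r[of "-1/2" "-1/2"] in auto)
  then show ?thesis by (simp add: r)
qed


section \<open>Numerical inequalities for points in different sectors\<close>

lemma N_numerals:
  "N (1/2) (1/2) \<le> 7072/10000" "N 1 1 \<le> 14143/10000" "N (3/2) (1/2) \<le> 15812/10000"
  "N (1/2) (3/2) \<le> 15812/10000" "N 1 (1/2) \<le> 11181/10000" "N (1/2) 1 \<le> 11181/10000"
  "N 1 2 \<le> 22361/10000" "N 2 1 \<le> 22361/10000" "N (3/2) (3/2) \<le> 21214/10000"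
  "N (3/2) 1 \<le> 18028/10000" "N 1 (3/2) \<le> 18028/10000"
  by (rule N_le; simp add: power2_eq_square)+

text \<open>The mean of the two costs of a pair of side points, with each negative norm replaced by
  its linear bound in the direction \<open>(-5/13, 12/13)\<close> or its mirror image. The result is
  convex in either point, so pairs of corners decide.\<close>

lemma side_pair_weighted:
  assumes "\<bar>x\<bar> \<le> y" "\<bar>x\<bar> + y \<le> 1" "\<bar>u\<bar> \<le> - v" "\<bar>u\<bar> - v \<le> 1"
  shows "N (x - u) (y - v) + 3/2 * N (x - 1) y + 3/2 * N (u - 1) v
     + 15/26 * x - 18/13 * y + 15/26 * u + 18/13 * v \<le> 4"
proof -
  \<comment> \<open>The upper point is fixed at each of its four corners in turn while the lower one
    varies; the terms of the fixed corner are moved to the right.\<close>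
  have V: "F4 1 0 0 (3/2) 1 0 0 0 0 (15/26) (18/13) u v \<le> 4 - 3/2"
    "F4 1 0 1 (3/2) 1 0 0 0 0 (15/26) (18/13) u v \<le> 4 - 3/2 * N 1 1 + 18/13"
    "F4 1 (1/2) (1/2) (3/2) 1 0 0 0 0 (15/26) (18/13) u v \<le> 4 - 3/2 * N (1/2) (1/2) + 21/52"
    "F4 1 (-1/2) (1/2) (3/2) 1 0 0 0 0 (15/26) (18/13) u v \<le> 4 - 3/2 * N (3/2) (1/2) + 51/52"
    by (rule F4_down[OF assms(3,4)]; use N_numerals in \<open>simp add: F4_def\<close>)+
  have m: "N (a - u) (b - v) = N (u - a) (v - b)" for a b
    by (rule N_minus)
  have "F4 1 u v (3/2) 1 0 0 0 0 (15/26) (-18/13) x y \<le> 4 - 3/2 * N (u - 1) v - 15/26 * u - 18/13 * v"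
    by (rule F4_up[OF assms(1,2)]) (use V m[of 0] m[of "1/2"] m[of "-1/2"] in \<open>simp_all add: F4_def\<close>)
  then show ?thesis by (simp add: F4_def)
qed

text \<open>The mean of the two costs of a left and an upper point with weights 3/5 and 2/5,
  linearised in the directions \<open>(-12/13, 5/13)\<close> or \<open>(-12/13, -5/13)\<close> and
  \<open>(-5/13, 12/13)\<close>. The term in \<open>\<bar>y\<bar>\<close> is concave but linear on
  each half of the left sector, and the halves are treated separately.\<close>

lemma left_up_weighted:
  assumes "\<bar>y\<bar> \<le> - x" "\<bar>y\<bar> - x \<le> 1" "\<bar>u\<bar> \<le> v" "\<bar>u\<bar> + v \<le> 1"
  shows "N (x - u) (y - v) + 6/5 * N (x - 1) y + 9/5 * N (u - 1) v
     + 108/65 * x - 9/13 * \<bar>y\<bar> + 6/13 * u - 72/65 * v \<le> 4"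
proof -
  have V: "F4 1 0 0 (9/5) 1 0 0 0 0 (6/13) (-72/65) u v \<le> 4 - 6/5"
    "F4 1 (-1) 0 (9/5) 1 0 0 0 0 (6/13) (-72/65) u v \<le> 4 - 12/5 + 108/65"
    "F4 1 (-1/2) (1/2) (9/5) 1 0 0 0 0 (6/13) (-72/65) u v \<le> 4 - 6/5 * N (3/2) (1/2) + 153/130"
    "F4 1 (-1/2) (-1/2) (9/5) 1 0 0 0 0 (6/13) (-72/65) u v \<le> 4 - 6/5 * N (3/2) (1/2) + 153/130"
    by (rule F4_up[OF assms(3,4)]; use N_numerals in \<open>simp add: F4_def\<close>)+
  have m: "N (a - u) (b - v) = N (u - a) (v - b)" for a b
    by (rule N_minus)
  have "F4 1 u v (6/5) 1 0 0 0 0 (108/65) (if 0 \<le> y then - 9/13 else 9/13) x y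
      \<le> 4 - 9/5 * N (u - 1) v - 6/13 * u + 72/65 * v"
    by (rule F4_left[OF assms(1,2)])
      (use V m[of 0 0] m[of "-1" 0] m[of "-1/2" "1/2"] m[of "-1/2" "-1/2"] in \<open>simp_all add: F4_def\<close>)
  then show ?thesis by (simp add: F4_def split: if_splits)
qed

lemma N_shift_sq: "(N (x - a) (y - b))\<^sup>2 = (N x y)\<^sup>2 + (a\<^sup>2 + b\<^sup>2) - 2 * (a * x + b * y)"
  unfolding N_sq by algebra

text \<open>The factor is a rational number just above \<open>sqrt 2\<close>.\<close>

lemma sector_sum_le: "\<bar>a\<bar> + \<bar>b\<bar> \<le> 141422/100000 * N a b"
proof (rule power2_le_imp_le)
  have "(\<bar>a\<bar> + \<bar>b\<bar>)\<^sup>2 \<le> 2 * (N a b)\<^sup>2"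
    using zero_le_power2[of "\<bar>a\<bar> - \<bar>b\<bar>"] unfolding N_sq by (simp add: power2_eq_square algebra_simps)
  also have "\<dots> \<le> (141422/100000 * N a b)\<^sup>2"
    by (simp add: power_mult_distrib power2_eq_square)
  finally show "(\<bar>a\<bar> + \<bar>b\<bar>)\<^sup>2 \<le> (141422/100000 * N a b)\<^sup>2" .
qed simp

text \<open>By the triangle inequality a hub at \<open>(x, y)\<close> costs a light subtree at most
  \<open>N x y + 3 * N (x - 1) y\<close>, wherever the light point lies. Bad points are those for
  which this crude price exceeds the budget 4.\<close>

definition bad :: "real \<Rightarrow> real \<Rightarrow> bool" where
  "bad x y \<longleftrightarrow> 4 < N x y + 3 * N (x - 1) y"

text \<open>The inequality \<open>4 - N x y < 3 * N (x - 1) y\<close> is squared and the second norm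
  eliminated. In particular a bad point within 51/100 of the centre has negative first
  coordinate.\<close>

lemma bad_re:
  assumes "bad x y" "N x y \<le> 4"
  shows "18 * x < 8 * (N x y)\<^sup>2 + 8 * N x y - 7"
proof -
  have "(4 - N x y)\<^sup>2 < (3 * N (x - 1) y)\<^sup>2"
    using assms by (intro power_strict_mono) (auto simp: bad_def)
  then show ?thesis
    using N_shift_sq[of x 1 y 0] by (simp add: power2_eq_square algebra_simps)
qed

lemma bad_gt:
  assumes "bad x y"
  shows "1/4 < N x y"
  using assms N_tri0[of x 1 y 0] by (simp add: bad_def)

text \<open>For norm at most 3/10, \<open>bad_re\<close> pushes the first coordinate below
  -215/1000, whereas in a side sector its square is at most half of the squared norm.\<close>

lemma bad_side_gt:
  assumes "bad x y" "\<bar>x\<bar> \<le> \<bar>y\<bar>"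
  shows "3/10 < N x y"
proof (rule ccontr)
  assume "\<not> 3/10 < N x y"
  then have e: "N x y \<le> 3/10" by simp
  then have sq: "(N x y)\<^sup>2 \<le> 9/100"
    using power_mono[OF e, of 2] by (simp add: power2_eq_square)
  have "2 * x\<^sup>2 \<le> 9/100"
    using sq abs_le_square_iff[of x y] assms(2) unfolding N_sq by simp
  moreover have "x \<le> - 215/1000" using bad_re[OF assms(1)] e sq by simp
  then have "(215/1000)\<^sup>2 \<le> (- x)\<^sup>2" by (intro power_mono) auto
  ultimately show False by (simp add: power2_eq_square)
qed

text \<open>By convexity the corners of the left sector decide. After \<open>p\<close> is eliminated
  by \<open>bad_re\<close>, the comparisons at the outer corners reduce to quadratics in
  \<open>a\<close> that vanish at 1/4; they are supplied in factored form.\<close>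

lemma bad_dist_left:
  assumes "bad p h" "N p h \<le> 1" "\<bar>y\<bar> \<le> - x" "\<bar>y\<bar> - x \<le> 1"
  shows "N (x - p) (y - h) \<le> 3 * N p h"
proof -
  define a where "a = N p h"
  have a: "1/4 < a" "18 * p < 8 * a\<^sup>2 + 8 * a - 7"
    using bad_gt[OF assms(1)] bad_re[OF assms(1)] assms(2) by (auto simp: a_def)
  have aa: "p\<^sup>2 + h\<^sup>2 = a\<^sup>2" by (simp add: a_def N_sq)
  have h: "\<bar>h\<bar> \<le> a" unfolding a_def N_def using abs_Im_le_cmod[of "Complex p h"] by simp
  have 1: "0 \<le> (4 * a - 1) * (16 * a + 2)" "0 \<le> (4 * a - 1) * (34 * a + 2)"
    using a by auto
  have "F4 1 p h 0 0 0 0 0 0 0 0 x y \<le> 3 * a"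
  proof (rule F4_left[OF assms(3,4)])
    show "F4 1 p h 0 0 0 0 0 0 0 0 0 0 \<le> 3 * a" using a by (simp add: F4_def flip: a_def)
    show "F4 1 p h 0 0 0 0 0 0 0 0 (-1) 0 \<le> 3 * a"
      unfolding F4_def using a aa 1(1)
      by (simp, intro N_le) (simp_all add: power2_eq_square algebra_simps)
    show "F4 1 p h 0 0 0 0 0 0 0 0 (-1/2) (1/2) \<le> 3 * a"
      unfolding F4_def using a aa 1(2) h
      by (simp, intro N_le) (simp_all add: power2_eq_square algebra_simps)
    show "F4 1 p h 0 0 0 0 0 0 0 0 (-1/2) (-1/2) \<le> 3 * a"
      unfolding F4_def using a aa 1(2) h
      by (simp, intro N_le) (simp_all add: power2_eq_square algebra_simps)
  qed simp_all
  then show ?thesis by (simp add: F4_def a_def)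
qed

text \<open>One interval \<open>[a1, a2]\<close> of norms in the proof of \<open>far_center\<close>.
  The part depending on \<open>a\<close> decreases there and is taken at \<open>a1\<close>; the form
  linear in \<open>X\<close> and \<open>Y\<close> is bounded by Cauchy-Schwarz, \<open>M\<close>
  being at least the length of its coefficient vector.\<close>

lemma far_piece:
  assumes "a1 \<le> a" "a \<le> a2" "0 \<le> X" "0 \<le> Y" "N X Y \<le> 49/100" "P0 \<le> P" "H \<le> h0" "0 < M"
    "(204082/100000 - 212765/100000 * P0)\<^sup>2 + (212767/100000 * h0)\<^sup>2 \<le> M\<^sup>2"
    "a1 \<le> 1" "a2 \<le> 1" "0 \<le> a1"
    "39609/10000 + 106384/100000 * a1\<^sup>2 - 3 * a1 + 49/100 * M \<le> 4"
  shows "39609/10000 + 106384/100000 * a\<^sup>2 - 3 * a + 204082/100000 * X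
    - 212765/100000 * (P * X) + 212767/100000 * (H * Y) \<le> 4"
proof -
  define A where "A = 204082/100000 - 212765/100000 * P0"
  define B where "B = 212767/100000 * h0"
  have "(A / M)\<^sup>2 + (B / M)\<^sup>2 \<le> 1"
    using assms(8,9)[folded A_def B_def] by (simp add: power_divide flip: add_divide_distrib)
  from N_lin[OF this, of X Y] have "A * X + B * Y \<le> M * N X Y"
    using assms(8) by (simp add: field_simps)
  also have "\<dots> \<le> M * (49/100)" using assms(5,8) by (intro mult_left_mono) auto
  finally have 1: "A * X + B * Y \<le> 49/100 * M" by simp
  have 2: "P0 * X \<le> P * X" "H * Y \<le> h0 * Y"
    using assms by (auto intro: mult_right_mono)
  have "0 \<le> (a - a1) * (2 - a - a1)" using assms by (intro mult_nonneg_nonneg) auto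
  then have "106384/100000 * a\<^sup>2 - 3 * a \<le> 106384/100000 * a1\<^sup>2 - 3 * a1"
    using assms(1) by (simp add: power2_eq_square algebra_simps)
  moreover have "A * X = 204082/100000 * X - 212765/100000 * (P0 * X)"
    "B * Y = 212767/100000 * (h0 * Y)" by (simp_all add: A_def B_def algebra_simps)
  ultimately show ?thesis using 1 2 assms(13) by linarith
qed

text \<open>The bounds on the two norms are tangent to the true values near the extremal
  configuration \<open>x = -0.487\<close>, \<open>p = -0.225\<close>.\<close>

lemma far_center:
  assumes "bad p h" "\<bar>p\<bar> \<le> \<bar>h\<bar>" "\<bar>y\<bar> \<le> - x"
    and f: "4 < N (p - x) (h - y) - 3 * N p h + 3 * N (x - 1) y"
  shows "49/100 \<le> N x y"
proof (rule ccontr)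
  assume "\<not> 49/100 \<le> N x y"
  then have c: "N x y \<le> 49/100" by simp
  define a where "a = N p h"
  define c where "c = N x y"
  have a3: "3/10 < a" using bad_side_gt[OF assms(1,2)] by (simp add: a_def)
  have a4: "a < 48/100"
    using f N_tri0[of p x h y] N_tri0[of x 1 y 0] c by (simp add: a_def)
  have P: "18 * p < 8 * a\<^sup>2 + 8 * a - 7" using bad_re[OF assms(1)] a4 by (simp add: a_def)
  have "p < 0" using P a4 a3 power_mono[of a "48/100" 2] by (simp add: power2_eq_square)
  have H: "\<bar>h\<bar> - p \<le> 141422/100000 * a" "\<bar>h\<bar> \<le> a"
    using sector_sum_le[of p h] \<open>p < 0\<close> abs_Im_le_cmod[of "Complex p h"]
    by (simp_all add: a_def N_def)
  define d where "d = N (p - x) (h - y)"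
  define g where "g = N (x - 1) y"
  have X: "0 \<le> - x" using assms(3) by simp
  have "c\<^sup>2 \<le> (49/100)\<^sup>2" unfolding c_def using c by (intro power_mono) auto
  moreover have "g\<^sup>2 = 1 - 2 * x + c\<^sup>2" unfolding g_def c_def N_sq by algebra
  moreover have "d\<^sup>2 = a\<^sup>2 + c\<^sup>2 - 2 * (p * x) - 2 * (h * y)"
    unfolding d_def c_def a_def N_sq by algebra
  moreover have "- (h * y) \<le> \<bar>h\<bar> * \<bar>y\<bar>" by (metis abs_ge_minus_self abs_mult)
  \<comment> \<open>These bound both norms by their squares. The coefficients of the next estimate
    are 2/0.98, 2/0.94 and 1/0.94, rounded so that the inequality is preserved.\<close>
  moreover have "294/100 * g \<le> g\<^sup>2 + (147/100)\<^sup>2" "94/100 * d \<le> d\<^sup>2 + (47/100)\<^sup>2"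
    using zero_le_power2[of "g - 147/100"] zero_le_power2[of "d - 47/100"]
    by (simp_all add: power2_eq_square algebra_simps)
  moreover have "0 \<le> (- p) * (- x)" "0 \<le> \<bar>h\<bar> * \<bar>y\<bar>"
    using X \<open>p < 0\<close> by (simp_all add: mult_nonpos_nonpos)
  moreover have "0 \<le> a * a" by simp
  ultimately have "d + 3 * g - 3 * a \<le> 39609/10000 + 106384/100000 * a\<^sup>2 - 3 * a
      + 204082/100000 * (- x) - 212765/100000 * ((- p) * (- x)) + 212767/100000 * (\<bar>h\<bar> * \<bar>y\<bar>)"
    using X unfolding power2_eq_square minus_mult_minus by linarith
  also have "\<dots> \<le> 4"
  proof -
    have N: "N (- x) \<bar>y\<bar> \<le> 49/100" using c by (simp add: N_def cmod_def)
    have q: "0 \<le> (a - a1) * (a2 - a) \<Longrightarrow> a\<^sup>2 \<le> (a1 + a2) * a - a1 * a2" for a1 a2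
      by (simp add: power2_eq_square algebra_simps)
    \<comment> \<open>\<open>bad_re\<close> with the square of \<open>a\<close> replaced by its
      chord over \<open>[a1, a2]\<close>: the bound becomes linear and decreasing in
      \<open>a\<close>. Its value at \<open>a2\<close>, rounded down, is the constant used for
      \<open>- p\<close> in each case below.\<close>
    have R: "(7 - 8 * ((a1 + a2) * a - a1 * a2) - 8 * a) / 18 \<le> - p" if "a1 \<le> a" "a \<le> a2" for a1 a2
      using q[of a1 a2] P that by simp
    consider "a \<le> 32/100" | "32/100 \<le> a" "a \<le> 34/100" | "34/100 \<le> a" "a \<le> 37/100"
      | "37/100 \<le> a" "a \<le> 41/100" | "41/100 \<le> a" by linarith
    then show ?thesis
    proof cases
      case 1
      show ?thesis
        by (rule far_piece[of "3/10" a "32/100" _ _ "2011/10000" _ _ "2514/10000" "16994/10000"])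
          (use 1 a3 N X R[of "3/10" "32/100"] H in \<open>simp_all add: power2_eq_square\<close>)
    next
      case 2
      show ?thesis
        by (rule far_piece[of "32/100" a "34/100" _ _ "1863/10000" _ _ "2945/10000" "17598/10000"])
          (use 2 N X R[of "32/100" "34/100"] H in \<open>simp_all add: power2_eq_square\<close>)
    next
      case 3
      show ?thesis
        by (rule far_piece[of "34/100" a "37/100" _ _ "1636/10000" _ _ "3597/10000" "18578/10000"])
          (use 3 N X R[of "34/100" "37/100"] H in \<open>simp_all add: power2_eq_square\<close>)
    next
      case 4
      show ?thesis
        by (rule far_piece[of "37/100" a "41/100" _ _ "1319/10000" _ _ "41/100" "19645/10000"])
          (use 4 N X R[of "37/100" "41/100"] H in \<open>simp_all add: power2_eq_square\<close>)
    next
      case 5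
      show ?thesis
        by (rule far_piece[of "41/100" a "48/100" _ _ "731/10000" _ _ "48/100" "21442/10000"])
          (use 5 a4 N X R[of "41/100" "48/100"] H in \<open>simp_all add: power2_eq_square\<close>)
    qed
  qed
  finally show False using f by (simp add: d_def g_def a_def)
qed

text \<open>This permits a star although its lower point is near the centre. The corners of the
  upper sector decide: at \<open>(0, 1)\<close> the excess 35/100 of one distance is the slack of
  the other, and at the outer corners the lower point leaves \<open>2 * t > 6/10\<close>.\<close>

lemma far_star:
  assumes "49/100 \<le> N x y" "0 \<le> y" "y \<le> - x"
    and "bad u v" "\<bar>u\<bar> \<le> - v" "N u v \<le> 51/100"
    and "\<bar>q\<bar> \<le> r" "\<bar>q\<bar> + r \<le> 1"
  shows "N (x - q) (y - r) + N (u - q) (v - r) \<le> 3 * N x y + 3 * N u v"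
proof -
  define c where "c = N x y"
  define t where "t = N u v"
  have c: "49/100 \<le> c" "x\<^sup>2 + y\<^sup>2 = c\<^sup>2" "- x \<le> c"
    using assms(1) abs_Re_le_cmod[of "Complex x y"] N_sq[of x y] by (simp_all add: c_def flip: N_def)
  have t: "3/10 < t" using bad_side_gt[OF assms(4)] assms(5) by (simp add: t_def)
  have P: "18 * u < 8 * t\<^sup>2 + 8 * t - 7" using bad_re[OF assms(4)] assms(6) by (simp add: t_def)
  have uv: "u - v \<le> 141422/100000 * t" "- u - v \<le> 141422/100000 * t" "u\<^sup>2 + v\<^sup>2 = t\<^sup>2" "0 \<le> t\<^sup>2"
    using sector_sum_le[of u v] assms(5) by (auto simp: t_def N_sq)
  have cc: "0 \<le> (c - 49/100) * (8 * c + 182/100)" "0 \<le> (c - 49/100) * (8 * c + 76/100)"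
    using c by auto
  have tt: "3/10 * t \<le> t * t" using t by (intro mult_right_mono) auto
  have 1: "N x (y - 1) \<le> 3 * c - 35/100" "N u (v - 1) \<le> 3 * t + 35/100"
    by (rule N_le; use c t assms(2,3,5) cc(1) tt P uv in \<open>simp add: power2_eq_square algebra_simps; linarith?\<close>)+
  have 2: "N (x - 1/2) (y - 1/2) \<le> 3 * c - 36/100" "N (x + 1/2) (y - 1/2) \<le> 3 * c - 36/100"
    by (rule N_le; use c assms(2,3) cc(2) in \<open>simp add: power2_eq_square algebra_simps\<close>)+
  have 3: "N (u - 1/2) (v - 1/2) \<le> t + 7072/10000" "N (u + 1/2) (v - 1/2) \<le> t + 7072/10000"
    by (rule N_le; use t assms(5) uv in \<open>simp add: power2_eq_square algebra_simps\<close>)+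
  note m = N_minus[of 0 x 1 y] N_minus[of "1/2" x "1/2" y] N_minus[of "-1/2" x "1/2" y]
    N_minus[of 0 u 1 v] N_minus[of "1/2" u "1/2" v] N_minus[of "-1/2" u "1/2" v]
  have "F4 1 x y 1 u v 0 0 0 0 0 q r \<le> 3 * c + 3 * t"
    by (rule F4_up[OF assms(7,8)]; use 1 2 3 c t m in \<open>simp add: F4_def flip: c_def t_def\<close>)
  then show ?thesis using N_minus[of q x r y] N_minus[of q u r v] by (simp add: F4_def c_def t_def)
qed

text \<open>The bad upper point has \<open>p < 0\<close> and therefore lies in the triangle with
  corners \<open>(0, 0)\<close>, \<open>(-36065/100000, 36065/100000)\<close> and
  \<open>(0, 7213/10000)\<close>, where 7213/10000 is 51/100 times \<open>sqrt 2\<close> rounded up.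
  The expression is convex in that point.\<close>

lemma near_sides:
  assumes "bad u v" "\<bar>u\<bar> \<le> - v" "N u v \<le> 51/100"
    and "bad p h" "\<bar>p\<bar> \<le> h" "N p h \<le> 51/100"
  shows "N (u - p) (v - h) - 3 * N u v + 3 * N (p - 1) h \<le> 4"
proof -
  define t where "t = N u v"
  define s where "s = N p h"
  have t: "3/10 < t" using bad_side_gt[OF assms(1)] assms(2) by (simp add: t_def)
  have P: "18 * u < 8 * t\<^sup>2 + 8 * t - 7" using bad_re[OF assms(1)] assms(3) by (simp add: t_def)
  have uv: "- v \<le> t" "u\<^sup>2 + v\<^sup>2 = t\<^sup>2"
    using assms(2) abs_Im_le_cmod[of "Complex u v"] N_sq[of u v] by (simp_all add: t_def flip: N_def)
  have "s\<^sup>2 \<le> (51/100)\<^sup>2" unfolding s_def using assms(6) by (intro power_mono) auto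
  then have "p < 0" using bad_re[OF assms(4)] assms(6) by (simp add: s_def power2_eq_square)
  have hp: "h - p \<le> 7213/10000" using sector_sum_le[of p h] \<open>p < 0\<close> assms(5,6) by simp
  have tt: "0 \<le> (t - 3/10) * (7 * t - 7/100)" "0 \<le> (t - 3/10) * (t - 3/10)" using t by auto
  have 1: "N (u + 36065/100000) (v - 36065/100000) \<le> 3 * t - 2232/10000"
    by (rule N_le; use t P uv tt in \<open>simp add: power2_eq_square algebra_simps; linarith?\<close>)
  have 2: "N (- 136065/100000) (36065/100000) \<le> 14077/10000" "N (- 1) (7213/10000) \<le> 124/100"
    by (rule N_le; simp add: power2_eq_square)+
  have 3: "N u (v - 7213/10000) \<le> t + 7213/10000"
    using N_tri0[of u 0 v "7213/10000"] by (simp add: t_def)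
  have m: "N (a - u) (b - v) = N (u - a) (v - b)" for a b by (rule N_minus)
  let ?l = "1 + (p - h) / (7213/10000)" and ?m = "- p / (36065/100000)" and ?n = "(h + p) / (7213/10000)"
  have e: "?l * 0 + ?m * (- 36065/100000) + ?n * 0 = p"
    "?l * 0 + ?m * (36065/100000) + ?n * (7213/10000) = h"
    by (simp_all add: field_simps)
  have "F4 1 u v 3 1 0 0 0 0 0 0 (?l * 0 + ?m * (- 36065/100000) + ?n * 0)
     (?l * 0 + ?m * (36065/100000) + ?n * (7213/10000)) \<le> 4 + 3 * t"
  proof (rule F4_conv)
    show "F4 1 u v 3 1 0 0 0 0 0 0 0 0 \<le> 4 + 3 * t" using t by (simp add: F4_def flip: t_def)
    show "F4 1 u v 3 1 0 0 0 0 0 0 (- 36065/100000) (36065/100000) \<le> 4 + 3 * t"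
      using 1 2 m[of "- 36065/100000" "36065/100000"] by (simp add: F4_def)
    show "F4 1 u v 3 1 0 0 0 0 0 0 0 (7213/10000) \<le> 4 + 3 * t"
      using t 3 2 m[of 0 "7213/10000"] by (simp add: F4_def)
  qed (use \<open>p < 0\<close> hp assms(5) in \<open>simp_all add: field_simps\<close>)
  then show ?thesis unfolding e using N_minus[of p u h v] by (simp add: F4_def t_def)
qed

section \<open>Choice of a hub among the representatives of a cell\<close>

text \<open>The sectors of the unit square around the centre \<open>0\<close> that do not contain the root corner \<open>1\<close>.\<close>

definition secL :: "complex set" where "secL = {z. \<bar>Im z\<bar> \<le> - Re z \<and> \<bar>Im z\<bar> - Re z \<le> 1}"
definition secU :: "complex set" where "secU = {z. \<bar>Re z\<bar> \<le> Im z \<and> \<bar>Re z\<bar> + Im z \<le> 1}"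
definition secD :: "complex set" where "secD = {z. \<bar>Re z\<bar> \<le> - Im z \<and> \<bar>Re z\<bar> - Im z \<le> 1}"

lemma cnj_sec: "z \<in> secU \<Longrightarrow> cnj z \<in> secD" "z \<in> secD \<Longrightarrow> cnj z \<in> secU" "z \<in> secL \<Longrightarrow> cnj z \<in> secL"
  by (auto simp: secU_def secD_def secL_def)

lemma sec_cmod: "z \<in> secL \<union> secU \<union> secD \<Longrightarrow> cmod z \<le> 1"
  using cmod_le[of z] by (auto simp: secU_def secD_def secL_def)

lemma cmod_N: "cmod z = N (Re z) (Im z)" "cmod (z - w) = N (Re z - Re w) (Im z - Im w)"
  "cmod (z - 1) = N (Re z - 1) (Im z)"
  by (simp_all add: N_def cmod_def)

text \<open>The balance of a merge in a cell normalised to centre 0, radius 1 and root corner 1. The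
  light subtree at \<open>k\<close> brings the credit \<open>3 * cmod k\<close>, pays for the edge
  to the hub \<open>z\<close>, and must leave the credit \<open>3 * cmod (z - 1)\<close> with
  respect to the corner; a balance up to 4 is affordable.\<close>

definition cost :: "complex \<Rightarrow> complex \<Rightarrow> real" where
  "cost k z = cmod (k - z) - 3 * cmod k + 3 * cmod (z - 1)"

lemma cost_cnj: "cost (cnj k) (cnj z) = cost k z"
proof -
  have "cmod (cnj k - cnj z) = cmod (k - z)" "cmod (cnj z - 1) = cmod (z - 1)"
    by (metis complex_cnj_diff complex_cnj_one complex_mod_cnj)+
  then show ?thesis by (simp add: cost_def)
qed

lemma cost_left_up:
  assumes "z \<in> secL" "w \<in> secU"
  shows "cost z w \<le> 4 \<or> cost w z \<le> 4"
proof -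
  have "- cmod z \<le> 12/13 * Re z - 5/13 * \<bar>Im z\<bar>" "- cmod w \<le> 5/13 * Re w - 12/13 * Im w"
    using N_lin[of "-12/13" "5/13" "Re z" "Im z"] N_lin[of "-12/13" "-5/13" "Re z" "Im z"]
      N_lin[of "-5/13" "12/13" "Re w" "Im w"]
    by (auto simp: cmod_N(1) power2_eq_square abs_if)
  moreover have "cmod (z - w) + 6/5 * cmod (z - 1) + 9/5 * cmod (w - 1)
     + 108/65 * Re z - 9/13 * \<bar>Im z\<bar> + 6/13 * Re w - 72/65 * Im w \<le> 4"
    using left_up_weighted[of "Im z" "Re z" "Re w" "Im w"] assms by (simp add: cmod_N(2,3) secL_def secU_def)
  ultimately have "3/5 * cost z w + 2/5 * cost w z \<le> 4"
    unfolding cost_def using norm_minus_commute[of w z] by argo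
  then show ?thesis by linarith
qed

lemma cost_up_down:
  assumes "z \<in> secU" "w \<in> secD"
  shows "cost z w \<le> 4 \<or> cost w z \<le> 4"
proof -
  have "- cmod z \<le> 5/13 * Re z - 12/13 * Im z" "- cmod w \<le> 5/13 * Re w + 12/13 * Im w"
    using N_lin[of "-5/13" "12/13" "Re z" "Im z"] N_lin[of "-5/13" "-12/13" "Re w" "Im w"]
    by (auto simp: cmod_N(1) power2_eq_square)
  moreover have "cmod (z - w) + 3/2 * cmod (z - 1) + 3/2 * cmod (w - 1)
     + 15/26 * Re z - 18/13 * Im z + 15/26 * Re w + 18/13 * Im w \<le> 4"
    using side_pair_weighted[of "Re z" "Im z" "Re w" "Im w"] assms by (simp add: cmod_N(2,3) secD_def secU_def)
  ultimately have "1/2 * cost z w + 1/2 * cost w z \<le> 4"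
    unfolding cost_def using norm_minus_commute[of w z] by argo
  then show ?thesis by linarith
qed

lemma cost_pair:
  assumes "z \<in> secL \<and> w \<in> secU \<union> secD \<or> z \<in> secU \<and> w \<in> secL \<union> secD \<or> z \<in> secD \<and> w \<in> secL \<union> secU"
  shows "cost z w \<le> 4 \<or> cost w z \<le> 4"
proof -
  have L: "cost z w \<le> 4 \<or> cost w z \<le> 4" if "z \<in> secL" "w \<in> secD" for z w
    using cost_left_up[of "cnj z" "cnj w"] that by (simp add: cost_cnj cnj_sec)
  show ?thesis
    using assms L[of z w] L[of w z] cost_left_up[of z w] cost_left_up[of w z]
      cost_up_down[of z w] cost_up_down[of w z] by blast
qed

text \<open>The difference separates into one term per point. So the cheaper hub of a pair is the
  point with the smaller sum of distances to 0 and 1, a criterion that also ranks three points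
  consistently.\<close>

lemma cost_swap: "cost z w - cost w z = 3 * (cmod w + cmod (w - 1)) - 3 * (cmod z + cmod (z - 1))"
  by (simp add: cost_def norm_minus_commute)

lemma cost_pair_min:
  assumes "z \<in> secL \<and> w \<in> secU \<union> secD \<or> z \<in> secU \<and> w \<in> secL \<union> secD \<or> z \<in> secD \<and> w \<in> secL \<union> secU"
    and "cmod w + cmod (w - 1) \<le> cmod z + cmod (z - 1)"
  shows "cost z w \<le> 4"
proof (rule ccontr)
  assume "\<not> cost z w \<le> 4"
  then show False using cost_pair[OF assms(1)] cost_swap[of z w] assms(2) by simp
qed

text \<open>\<open>r\<close> becomes the hub; either both lights are attached to the same point \<open>q\<close> near \<open>r\<close>,
  or \<open>i\<close> is attached to \<open>q\<close> and \<open>k\<close> to \<open>i\<close>.\<close>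

definition star_ok :: "complex set \<Rightarrow> complex \<Rightarrow> complex \<Rightarrow> complex \<Rightarrow> bool" where
  "star_ok Z r i k \<longleftrightarrow> cost i r \<le> 4 \<and> cost k r \<le> 4 \<and> cmod i \<le> cmod k \<and>
     (\<forall>q\<in>Z. cmod (i - q) + cmod (k - q) \<le> 3 * cmod i + 3 * cmod k)"

definition chain_ok :: "complex \<Rightarrow> complex \<Rightarrow> complex \<Rightarrow> bool" where
  "chain_ok r i k \<longleftrightarrow> cost i r \<le> 4 \<and> cmod (k - i) + cmod i \<le> 3 * cmod k \<and>
     cmod (k - i) + cmod (i - r) - 3 * cmod k + 3 * cmod (r - 1) \<le> 4"

definition hub_ok :: "complex set \<Rightarrow> complex \<Rightarrow> complex \<Rightarrow> complex \<Rightarrow> bool" where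
  "hub_ok Z r i k \<longleftrightarrow> star_ok Z r i k \<or> star_ok Z r k i \<or> chain_ok r i k \<or> chain_ok r k i"

lemma hub_ok_star:
  assumes "cost i r \<le> 4" "cost k r \<le> 4"
    "\<And>q. q \<in> Z \<Longrightarrow> cmod (i - q) + cmod (k - q) \<le> 3 * cmod i + 3 * cmod k"
  shows "hub_ok Z r i k"
  using assms by (cases "cmod i \<le> cmod k") (auto simp: hub_ok_def star_ok_def add.commute)

text \<open>The sectors lie in the unit disc, so the star costs at most
  \<open>cmod i + cmod k + 2\<close>, and twice the assumed sum covers the 2.\<close>

lemma hub_ok_far:
  assumes "cost i r \<le> 4" "cost k r \<le> 4" "Z \<subseteq> secL \<union> secU \<union> secD" "1 \<le> cmod i + cmod k"
  shows "hub_ok Z r i k"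
proof (rule hub_ok_star[OF assms(1,2)])
  fix q assume "q \<in> Z"
  then show "cmod (i - q) + cmod (k - q) \<le> 3 * cmod i + 3 * cmod k"
    using sec_cmod[of q] assms norm_triangle_ineq4[of i q] norm_triangle_ineq4[of k q] by auto
qed

text \<open>A hub that is not bad affords any light at the crude price, and then the farther of the
  two others can be chained to the nearer one.\<close>

lemma hub_ok_good:
  assumes "cmod r + 3 * cmod (r - 1) \<le> 4"
  shows "hub_ok Z r i k"
proof -
  have "chain_ok r i k" if "cmod i \<le> cmod k" for i k
    unfolding chain_ok_def cost_def
    using assms that norm_triangle_ineq4[of i r] norm_triangle_ineq4[of k i] norm_ge_zero[of i]
    by linarith
  then show ?thesis by (cases "cmod i \<le> cmod k") (auto simp: hub_ok_def)
qed

text \<open>\<open>cmod (k - s) - 3 * cmod k\<close> is at most \<open>cmod s - 2 * cmod k\<close>,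
  hence negative here, and a side point this close to 0 is not far from 1 either.\<close>

lemma cost_near_hub:
  assumes "cmod s \<le> 51/100" "s \<in> secU \<union> secD" "49/100 \<le> cmod k"
  shows "cost k s \<le> 4"
proof -
  have "- Re s \<le> 70711/100000 * cmod s"
    using sector_sum_le[of "Re s" "Im s"] assms(2) by (auto simp: secU_def secD_def cmod_N(1))
  then have "(cmod (s - 1))\<^sup>2 \<le> (14077/10000)\<^sup>2"
    using assms(1) N_shift_sq[of "Re s" 1 "Im s" 0] power_mono[OF assms(1), of 2]
    unfolding cmod_N(3) by (simp add: cmod_N(1) power2_eq_square)
  then have "cmod (s - 1) \<le> 14077/10000" by (rule power2_le_imp_le) simp
  then show ?thesis
    using norm_triangle_ineq4[of k s] assms by (simp add: cost_def)
qed

lemma bad_cmod: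
  "bad (Re z) (Im z) \<longleftrightarrow> 4 < cmod z + 3 * cmod (z - 1)"
  by (simp add: bad_def cmod_N(1,3))

text \<open>If the left point is no good hub although both sides are far from \<open>1\<close>, then it is itself far
  from \<open>0\<close>, and a side can take over.\<close>

lemma hub_far_left:
  assumes C: "C \<in> secL" "b \<in> secU" "d \<in> secD"
    and bad: "4 < cmod b + 3 * cmod (b - 1)" "4 < cmod d + 3 * cmod (d - 1)"
    and c: "49/100 \<le> cmod C" and Im: "0 \<le> Im C"
    and no: "4 < cost b C \<or> 4 < cost d C"
  shows "hub_ok secU b C d \<or> hub_ok secD d C b"
proof -
  let ?p = "\<lambda>z. cmod z + cmod (z - 1)"
  consider "51/100 < cmod b" "51/100 < cmod d" | "cmod b \<le> 51/100" "51/100 < cmod d"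
    | "51/100 < cmod b" "cmod d \<le> 51/100" | "cmod b \<le> 51/100" "cmod d \<le> 51/100" by linarith
  then show ?thesis
  proof cases
    case 1
    \<comment> \<open>Otherwise \<open>C\<close> would be an affordable hub for both sides, against
      \<open>no\<close>. So the smallest \<open>?p\<close> among the three occurs at a side point,
      and that point is affordable for the two others.\<close>
    have "?p b < ?p C \<or> ?p d < ?p C"
      using no cost_pair_min[of b C] cost_pair_min[of d C] C by force
    moreover have "secU \<subseteq> secL \<union> secU \<union> secD" "secD \<subseteq> secL \<union> secU \<union> secD" by auto
    ultimately show ?thesis
      using 1 c C hub_ok_far[of C b d secU] hub_ok_far[of C d b secD] cost_pair_min[of C b]
        cost_pair_min[of C d] cost_pair_min[of b d] cost_pair_min[of d b]
      by (cases "?p b \<le> ?p d") auto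
  next
    case 2
    then have "hub_ok secU b C d"
      using c C by (intro hub_ok_far cost_near_hub) auto
    then show ?thesis ..
  next
    case 3
    then have "hub_ok secD d C b"
      using c C by (intro hub_ok_far cost_near_hub) auto
    then show ?thesis ..
  next
    case 4
    have "hub_ok secU b C d"
    proof (rule hub_ok_star)
      show "cost C b \<le> 4" using c 4 C by (intro cost_near_hub) auto
      show "cost d b \<le> 4" unfolding cost_def cmod_N
        using near_sides[of "Re d" "Im d" "Re b" "Im b"] C bad 4
        by (simp add: bad_cmod secU_def secD_def flip: cmod_N(1))
      fix q assume "q \<in> secU"
      then show "cmod (C - q) + cmod (d - q) \<le> 3 * cmod C + 3 * cmod d"
        using far_star[of "Re C" "Im C" "Re d" "Im d" "Re q" "Im q"] C bad c Im 4
        unfolding cmod_N(2) bad_cmod by (simp add: secU_def secD_def secL_def flip: cmod_N(1))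
    qed
    then show ?thesis ..
  qed
qed

lemma hub_cnj:
  assumes "hub_ok Z (cnj r) (cnj i) (cnj k)"
  shows "hub_ok (cnj ` Z) r i k"
proof -
  have c: "cmod (cnj x - y) = cmod (x - cnj y)" "cmod (cnj x - 1) = cmod (x - 1)" for x y
    by (metis complex_cnj_cnj complex_cnj_diff complex_mod_cnj)
      (metis complex_cnj_diff complex_cnj_one complex_mod_cnj)
  show ?thesis
    using assms by (simp add: hub_ok_def star_ok_def chain_ok_def cost_cnj c flip: complex_cnj_diff)
qed

lemma cnj_image_sec: "cnj ` secU = secD" "cnj ` secD = secU" "cnj ` secL = secL"
proof -
  have "z \<in> cnj ` Z \<longleftrightarrow> cnj z \<in> Z" for z Z by (metis complex_cnj_cnj imageE imageI)
  then show "cnj ` secU = secD" "cnj ` secD = secU" "cnj ` secL = secL"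
    by (auto simp: secU_def secD_def secL_def)
qed

text \<open>One point that is not bad settles the matter. If all are bad and the left point is
  affordable for both sides, \<open>bad_dist_left\<close> gives it a star; if it is not,
  \<open>far_center\<close> places it far from 0 and a side point takes over, after a reflection if
  the left point lies below the real axis.\<close>

lemma hub_three:
  assumes C: "C \<in> secL" "b \<in> secU" "d \<in> secD"
  shows "hub_ok secL C b d \<or> hub_ok secU b C d \<or> hub_ok secD d C b"
proof (cases "4 < cmod C + 3 * cmod (C - 1) \<and> 4 < cmod b + 3 * cmod (b - 1) \<and> 4 < cmod d + 3 * cmod (d - 1)")
  case False
  then show ?thesis using hub_ok_good by (meson not_less)
next
  case bad: True
  show ?thesis
  proof (cases "cost b C \<le> 4 \<and> cost d C \<le> 4")
    case True
    have "cmod (q - z) \<le> 3 * cmod z" if "z \<in> {b, d}" "q \<in> secL" for q z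
      using bad_dist_left[of "Re z" "Im z" "Im q" "Re q"] that bad C sec_cmod[of z] cmod_N(2)[of q z]
      by (auto simp: bad_cmod secL_def simp flip: cmod_N(1))
    then have "hub_ok secL C b d"
      using True norm_minus_commute[of b] norm_minus_commute[of d] by (intro hub_ok_star add_mono) auto
    then show ?thesis ..
  next
    case False
    then have "4 < cost b C \<or> 4 < cost d C" by auto
    then obtain w where w: "w \<in> {b, d}" "4 < cost w C" by blast
    have c: "49/100 \<le> cmod C"
      using far_center[of "Re w" "Im w" "Im C" "Re C"] w bad C unfolding cost_def cmod_N
      by (auto simp: bad_cmod secL_def secU_def secD_def simp flip: cmod_N)
    show ?thesis
    proof (cases "0 \<le> Im C")
      case True
      then show ?thesis using hub_far_left[OF C _ _ c] bad w by auto
    next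
      case False
      have c: "cmod (cnj x - 1) = cmod (x - 1)" for x
        by (metis complex_cnj_diff complex_cnj_one complex_mod_cnj)
      have "hub_ok secU (cnj d) (cnj C) (cnj b) \<or> hub_ok secD (cnj b) (cnj C) (cnj d)"
        using hub_far_left[of "cnj C" "cnj d" "cnj b"] C \<open>49/100 \<le> cmod C\<close> False bad w
        by (auto simp: cnj_sec cost_cnj c)
      then show ?thesis using hub_cnj[of secU d C b] hub_cnj[of secD b C d] by (auto simp: cnj_image_sec)
    qed
  qed
qed

section \<open>Path bounds for older queue entries and for tails\<close>

text \<open>10/3 is what remains of the budget 4 after 2/3 is set aside: either
  \<open>\<theta> / 2\<close> for the walk to an older queue entry, or the extra length of the walk
  to the previous tail. The sum is convex in each point, so pairs of corners decide.\<close>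

lemma up_path:
  assumes "z \<in> secU" "q \<in> secU"
  shows "cmod z + cmod (z - q) + cmod (q - 1) \<le> 10/3"
proof -
  have z: "\<bar>Re z\<bar> \<le> Im z" "\<bar>Re z\<bar> + Im z \<le> 1" and q: "\<bar>Re q\<bar> \<le> Im q" "\<bar>Re q\<bar> + Im q \<le> 1"
    using assms by (auto simp: secU_def)
  have V: "F4 1 0 0 1 0 0 0 0 0 0 0 (Re z) (Im z) \<le> 10/3 - 1"
    "F4 1 0 1 1 0 0 0 0 0 0 0 (Re z) (Im z) \<le> 10/3 - N 1 1"
    "F4 1 (1/2) (1/2) 1 0 0 0 0 0 0 0 (Re z) (Im z) \<le> 10/3 - N (1/2) (1/2)"
    "F4 1 (-1/2) (1/2) 1 0 0 0 0 0 0 0 (Re z) (Im z) \<le> 10/3 - N (3/2) (1/2)"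
    by (rule F4_up[OF z]; use N_numerals in \<open>simp add: F4_def\<close>)+
  note m = N_minus[of 0 "Re z" 0 "Im z"] N_minus[of 0 "Re z" 1 "Im z"]
    N_minus[of "1/2" "Re z" "1/2" "Im z"] N_minus[of "-1/2" "Re z" "1/2" "Im z"]
  have "F4 1 (Re z) (Im z) 1 1 0 0 0 0 0 0 (Re q) (Im q) \<le> 10/3 - N (Re z) (Im z)"
    by (rule F4_up[OF q]) (use V m in \<open>simp_all add: F4_def\<close>)
  then show ?thesis using N_minus[of "Re z" "Re q" "Im z" "Im q"]
    by (simp add: F4_def cmod_N)
qed

lemma down_path:
  assumes "z \<in> secD" "q \<in> secD"
  shows "cmod z + cmod (z - q) + cmod (q - 1) \<le> 10/3"
proof -
  have "cmod (cnj z - cnj q) = cmod (z - q)" "cmod (cnj q - 1) = cmod (q - 1)"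
    by (metis complex_cnj_diff complex_cnj_one complex_mod_cnj)+
  then show ?thesis using up_path[of "cnj z" "cnj q"] assms by (simp add: cnj_sec)
qed

text \<open>In the left sector \<open>cmod z\<close> alone may reach 1, which is too much next to
  \<open>1 + 2\<close> for the other two terms. The minimum stays below 1/3: the first member for
  \<open>- Re z < 2/9\<close>, the second one beyond.\<close>

lemma left_path:
  assumes "z \<in> secL" "q \<in> secL"
  shows "min (cmod z) (4 - 3 * cmod (z - 1)) + cmod (z - q) + cmod (q - 1) \<le> 10/3"
proof -
  define a where "a = - Re z"
  have z: "\<bar>Im z\<bar> \<le> a" "\<bar>Im z\<bar> + a \<le> 1" using assms by (auto simp: secL_def a_def)
  have "cmod (q - 1) \<le> 2" using sec_cmod[of q] assms norm_triangle_ineq4[of q 1] by auto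
  moreover have "cmod (z - q) \<le> 1"
  proof -
    have h: "cmod (w + 1/2) \<le> 1/2" if "w \<in> secL" for w
    proof -
      have "cmod (w + 1/2) \<le> \<bar>Re (w + 1/2)\<bar> + \<bar>Im (w + 1/2)\<bar>" by (rule cmod_le)
      then show ?thesis using that by (auto simp: secL_def)
    qed
    show ?thesis
      using h[OF assms(1)] h[OF assms(2)] norm_triangle_ineq4[of "z + 1/2" "q + 1/2"] by simp
  qed
  moreover have "min (cmod z) (4 - 3 * cmod (z - 1)) \<le> 1/3"
  proof (cases "2/9 \<le> a")
    case True
    have "1 + a \<le> cmod (z - 1)" using abs_Re_le_cmod[of "z - 1"] by (simp add: a_def)
    then show ?thesis using True by linarith
  next
    case False
    then have "a\<^sup>2 \<le> (2/9)\<^sup>2" using z by (intro power_mono) auto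
    moreover have "(Im z)\<^sup>2 \<le> a\<^sup>2" using z(1) abs_le_square_iff[of "Im z" a] z by simp
    ultimately have "cmod z \<le> 1/3" unfolding cmod_N(1)
      by (intro N_le) (simp_all add: a_def power2_eq_square)
    then show ?thesis by linarith
  qed
  ultimately show ?thesis by linarith
qed

text \<open>The number is \<open>sqrt (5/2)\<close> rounded up, the distance from 1 or -1 to the
  opposite outer corner of a side sector.\<close>

lemma side_cmod:
  assumes "z \<in> secU \<union> secD"
  shows "cmod (z - 1) \<le> 1582/1000" "cmod (z + 1) \<le> 1582/1000"
proof -
  have "\<bar>Re z\<bar> \<le> 1/2" "\<bar>Re z\<bar> + \<bar>Im z\<bar> \<le> 1" using assms by (auto simp: secU_def secD_def)
  then have "\<bar>Re z\<bar>\<^sup>2 \<le> (1/2)\<^sup>2" "\<bar>Im z\<bar>\<^sup>2 \<le> (1 - \<bar>Re z\<bar>)\<^sup>2"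
    by (intro power_mono; simp)+
  then have 1: "(Re z)\<^sup>2 \<le> 1/4" "(Im z)\<^sup>2 \<le> 1 - 2 * \<bar>Re z\<bar> + (Re z)\<^sup>2"
    by (simp_all add: power2_diff power_one_over)
  show "cmod (z - 1) \<le> 1582/1000"
    unfolding cmod_N(3) by (rule N_le) (use 1 abs_ge_minus_self[of "Re z"] in \<open>simp_all add: power2_eq_square algebra_simps\<close>)
  have "cmod (z + 1) = N (Re z + 1) (Im z)" by (simp add: N_def cmod_def)
  also have "\<dots> \<le> 1582/1000"
    by (rule N_le) (use 1 abs_ge_self[of "Re z"] in \<open>simp_all add: power2_eq_square algebra_simps\<close>)
  finally show "cmod (z + 1) \<le> 1582/1000" .
qed

section \<open>Quadtree cells\<close>

text \<open>A cell is the square with centre \<open>c\<close>, corners \<open>c + R w\<close> for the four units \<open>w\<close>. Ties are broken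
  in favour of the vertical direction.\<close>

definition units :: "complex set" where "units = {1, \<i>, -1, -\<i>}"

definition dir :: "complex \<Rightarrow> complex" where
  "dir z = (if \<bar>Re z\<bar> \<le> \<bar>Im z\<bar> then (if 0 \<le> Im z then \<i> else - \<i>) else (if 0 < Re z then 1 else - 1))"

definition cell :: "complex \<Rightarrow> real \<Rightarrow> complex set" where
  "cell c R = {x. \<bar>Re (x - c)\<bar> + \<bar>Im (x - c)\<bar> \<le> R}"

lemma dir_units [simp]: "dir z \<in> units"
  by (simp add: dir_def units_def)

lemma uminus_units [simp]: "- w \<in> units \<longleftrightarrow> w \<in> units"
  by (auto simp: units_def complex_eq_iff)

lemma unit_simps: "w \<in> units \<Longrightarrow> cmod w = 1" "w \<in> units \<Longrightarrow> w \<noteq> 0" "w \<in> units \<Longrightarrow> - w \<noteq> w"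
  by (auto simp: units_def)

definition sub_centre :: "complex \<Rightarrow> real \<Rightarrow> complex \<Rightarrow> complex" where
  "sub_centre c R x = c + complex_of_real (R/2) * dir (x - c)"

lemma dir_half:
  assumes "\<bar>p\<bar> + \<bar>q\<bar> \<le> R"
  shows "\<bar>p - R/2 * Re (dir (Complex p q))\<bar> + \<bar>q - R/2 * Im (dir (Complex p q))\<bar> \<le> R/2"
proof -
  have h: "\<bar>a\<bar> + \<bar>b - R/2\<bar> \<le> R/2"
    if "\<bar>a\<bar> \<le> b" "\<bar>a\<bar> + b \<le> R" for a b
    using that by linarith
  consider "\<bar>p\<bar> \<le> \<bar>q\<bar>" "0 \<le> q" | "\<bar>p\<bar> \<le> \<bar>q\<bar>" "q < 0" | "\<bar>q\<bar> < \<bar>p\<bar>" "0 < p"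
    | "\<bar>q\<bar> < \<bar>p\<bar>" "p \<le> 0" by linarith
  then show ?thesis
  proof cases
    case 1
    then show ?thesis using h[of p q] assms by (simp add: dir_def)
  next
    case 2
    then show ?thesis using h[of p "- q"] assms abs_minus_cancel[of "q + R/2"] by (simp add: dir_def)
  next
    case 3
    then show ?thesis using h[of q p] assms by (simp add: dir_def)
  next
    case 4
    then show ?thesis using h[of q "- p"] assms abs_minus_cancel[of "p + R/2"] by (simp add: dir_def)
  qed
qed

lemma sub_cell:
  assumes "x \<in> cell c R"
  shows "x \<in> cell (sub_centre c R x) (R/2)"
proof -
  have "x - c = Complex (Re (x - c)) (Im (x - c))" by (simp add: complex_eq_iff)
  then show ?thesis
    using dir_half[of "Re (x - c)" "Im (x - c)" R] assms
    by (simp add: cell_def sub_centre_def flip: diff_diff_eq)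
qed

text \<open>The similarity that puts the centre at 0 and the corner \<open>c + R w\<close> at 1, the
  position in which the inequalities above are stated.\<close>

definition nrm :: "complex \<Rightarrow> real \<Rightarrow> complex \<Rightarrow> complex \<Rightarrow> complex" where
  "nrm c R w x = (x - c) / (complex_of_real R * w)"

lemma nrm_dist:
  assumes "0 < R" "w \<in> units"
  shows "dist x y = R * cmod (nrm c R w x - nrm c R w y)"
    and "dist x c = R * cmod (nrm c R w x)"
    and "dist x (c + complex_of_real R * w) = R * cmod (nrm c R w x - 1)"
    and "dist x (c - complex_of_real R * w) = R * cmod (nrm c R w x + 1)"
proof -
  have *: "cmod u = R * cmod (u / (complex_of_real R * w))" for u
    using assms by (simp add: norm_divide norm_mult unit_simps)
  have w: "complex_of_real R * w \<noteq> 0" using assms unit_simps by auto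
  show "dist x y = R * cmod (nrm c R w x - nrm c R w y)" "dist x c = R * cmod (nrm c R w x)"
    unfolding dist_norm nrm_def diff_divide_distrib[symmetric] using *[of "x - y"] *[of "x - c"]
    by (simp_all only: diff_diff_eq2 diff_add_cancel add_diff_cancel)
  have e: "(x - (c + u)) / u = (x - c) / u - 1" "(x - (c - u)) / u = (x - c) / u + 1" if "u \<noteq> 0" for u
    using that by (simp_all add: divide_simps)
  show "dist x (c + complex_of_real R * w) = R * cmod (nrm c R w x - 1)"
    "dist x (c - complex_of_real R * w) = R * cmod (nrm c R w x + 1)"
    using *[of "x - (c + complex_of_real R * w)"] *[of "x - (c - complex_of_real R * w)"]
    unfolding e[OF w] by (simp_all only: dist_norm nrm_def)
qed

lemma dir_scale: "0 < R \<Longrightarrow> dir (z / complex_of_real R) = dir z"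
  by (simp add: dir_def Re_divide_of_real Im_divide_of_real divide_le_cancel zero_le_divide_iff
      zero_less_divide_iff)

lemma dirD:
  "dir z = 1 \<Longrightarrow> \<bar>Im z\<bar> \<le> Re z" "dir z = - 1 \<Longrightarrow> \<bar>Im z\<bar> \<le> - Re z"
  "dir z = \<i> \<Longrightarrow> \<bar>Re z\<bar> \<le> Im z" "dir z = - \<i> \<Longrightarrow> \<bar>Re z\<bar> \<le> - Im z"
  by (auto simp: dir_def complex_eq_iff split: if_splits)

lemma nrm_sec:
  assumes "0 < R" "w \<in> units" "x \<in> cell c R"
  shows "dir (x - c) = - w \<Longrightarrow> nrm c R w x \<in> secL"
    and "dir (x - c) = \<i> * w \<Longrightarrow> nrm c R w x \<in> secU"
    and "dir (x - c) = - \<i> * w \<Longrightarrow> nrm c R w x \<in> secD"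
proof -
  define z where "z = (x - c) / complex_of_real R"
  have zr: "Re z = Re (x - c) / R" "Im z = Im (x - c) / R" by (simp_all add: z_def)
  have "\<bar>Re z\<bar> + \<bar>Im z\<bar> \<le> 1"
    using assms(1,3) by (simp add: zr cell_def abs_divide flip: add_divide_distrib)
  moreover have "dir (x - c) = dir z" using assms(1) by (simp add: z_def dir_scale)
  moreover have "nrm c R w x = z / w" by (simp add: nrm_def z_def)
  moreover have "dir z = - w \<Longrightarrow> z / w \<in> secL" "dir z = \<i> * w \<Longrightarrow> z / w \<in> secU"
    "dir z = - \<i> * w \<Longrightarrow> z / w \<in> secD" if "\<bar>Re z\<bar> + \<bar>Im z\<bar> \<le> 1"
  proof -
    consider "w = 1" | "w = \<i>" | "w = -1" | "w = -\<i>" using assms(2) by (auto simp: units_def)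
    then show "dir z = - w \<Longrightarrow> z / w \<in> secL" "dir z = \<i> * w \<Longrightarrow> z / w \<in> secU"
      "dir z = - \<i> * w \<Longrightarrow> z / w \<in> secD"
      by (cases; use that in \<open>auto simp: secL_def secU_def secD_def dest!: dirD\<close>)+
  qed
  ultimately show "dir (x - c) = - w \<Longrightarrow> nrm c R w x \<in> secL"
    "dir (x - c) = \<i> * w \<Longrightarrow> nrm c R w x \<in> secU" "dir (x - c) = - \<i> * w \<Longrightarrow> nrm c R w x \<in> secD" by auto
qed

lemma units_cases:
  assumes "v \<in> units" "w \<in> units" "v \<noteq> w"
  obtains "v = - w" | "v = \<i> * w" | "v = - \<i> * w"
  using assms by (auto simp: units_def complex_eq_iff)

lemma dist_centre: "x \<in> cell c R \<Longrightarrow> dist x c \<le> R"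
  using cmod_le[of "x - c"] by (simp add: cell_def dist_norm)

lemma dist_sub_cell:
  assumes "x \<in> cell c R" "y \<in> cell c R" "dir (x - c) = dir (y - c)"
  shows "dist x y \<le> R"
  using dist_centre[OF sub_cell[OF assms(1)]] dist_centre[OF sub_cell[OF assms(2)]]
    dist_triangle2[of x y "sub_centre c R x"] assms(3) by (simp add: sub_centre_def)

lemma side_bounds:
  assumes "0 < R" "w \<in> units" "x \<in> cell c R" "dir (x - c) \<noteq> w" "dir (x - c) \<noteq> - w"
  shows "dist x (c + complex_of_real R * w) \<le> 1582/1000 * R"
    and "dist x (c - complex_of_real R * w) \<le> 1582/1000 * R"
proof -
  have "nrm c R w x \<in> secU \<union> secD"
    using units_cases[of "dir (x - c)" w] nrm_sec[OF assms(1-3)] assms(2,4,5) by (metis UnI1 UnI2 dir_units)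
  from mult_left_mono[OF side_cmod(1)[OF this], of R] mult_left_mono[OF side_cmod(2)[OF this], of R]
  show "dist x (c + complex_of_real R * w) \<le> 1582/1000 * R"
    "dist x (c - complex_of_real R * w) \<le> 1582/1000 * R"
    unfolding nrm_dist(3,4)[OF assms(1,2), of _ c] using assms(1) by simp_all
qed

text \<open>Applied with \<open>x\<close> the hub and \<open>y\<close> an older queue entry. The
  minimum collects the two bounds for what a light subtree still owes on arrival at the hub: the
  triangle inequality and the cost inequality.\<close>

lemma queue_path:
  assumes "0 < R" "w \<in> units" "x \<in> cell c R" "y \<in> cell c R" "dir (x - c) = dir (y - c)" "dir (x - c) \<noteq> w"
  shows "min (dist x c) (4 * R - 3 * dist x (c + complex_of_real R * w)) + dist x y
    + dist y (c + complex_of_real R * w) \<le> 10/3 * R"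
proof -
  let ?x = "nrm c R w x" and ?y = "nrm c R w y"
  have "min (cmod ?x) (4 - 3 * cmod (?x - 1)) + cmod (?x - ?y) + cmod (?y - 1) \<le> 10/3"
  proof (rule units_cases[OF dir_units assms(2,6)])
    assume "dir (x - c) = - w"
    then show ?thesis
      using nrm_sec(1)[OF assms(1-3)] nrm_sec(1)[OF assms(1,2,4)] assms(5) left_path[of ?x ?y] by simp
  next
    assume "dir (x - c) = \<i> * w"
    then have "cmod ?x + cmod (?x - ?y) + cmod (?y - 1) \<le> 10/3"
      using nrm_sec(2)[OF assms(1-3)] nrm_sec(2)[OF assms(1,2,4)] assms(5) up_path[of ?x ?y] by simp
    then show ?thesis by linarith
  next
    assume "dir (x - c) = - \<i> * w"
    then have "cmod ?x + cmod (?x - ?y) + cmod (?y - 1) \<le> 10/3"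
      using nrm_sec(3)[OF assms(1-3)] nrm_sec(3)[OF assms(1,2,4)] assms(5) down_path[of ?x ?y] by simp
    then show ?thesis by linarith
  qed
  then have "R * (min (cmod ?x) (4 - 3 * cmod (?x - 1)) + cmod (?x - ?y) + cmod (?y - 1)) \<le> R * (10/3)"
    using assms(1) by (intro mult_left_mono) simp_all
  moreover have "R * (min a (4 - 3 * b) + u + v) = min (R * a) (4 * R - 3 * (R * b)) + R * u + R * v"
    for a b u v :: real
    using assms(1) by (simp add: distrib_left min_mult_distrib_left right_diff_distrib)
  ultimately show ?thesis
    unfolding nrm_dist(1)[OF assms(1,2), of x y c] nrm_dist(2,3)[OF assms(1,2), of _ c] by simp
qed

text \<open>The walk leads to the corner opposite to \<open>w\<close>, so the cell is normalised by
  \<open>- w\<close>; this exchanges the upper and the lower sector.\<close>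

lemma tail_path:
  assumes "0 < R" "w \<in> units" "x \<in> cell c R" "y \<in> cell c R" "dir (x - c) = dir (y - c)"
    "dir (x - c) \<noteq> w" "dir (x - c) \<noteq> - w"
  shows "dist x c + dist x y + dist y (c - complex_of_real R * w) \<le> 10/3 * R"
proof -
  let ?x = "nrm c R (-w) x" and ?y = "nrm c R (-w) y"
  have w: "- w \<in> units" using assms(2) by simp
  have "cmod ?x + cmod (?x - ?y) + cmod (?y - 1) \<le> 10/3"
  proof (rule units_cases[OF dir_units assms(2,6)])
    assume "dir (x - c) = - w"
    then show ?thesis using assms(7) by simp
  next
    assume "dir (x - c) = \<i> * w"
    then show ?thesis
      using nrm_sec(3)[OF assms(1) w assms(3)] nrm_sec(3)[OF assms(1) w assms(4)] assms(5)
        down_path[of ?x ?y] by simp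
  next
    assume "dir (x - c) = - \<i> * w"
    then show ?thesis
      using nrm_sec(2)[OF assms(1) w assms(3)] nrm_sec(2)[OF assms(1) w assms(4)] assms(5)
        up_path[of ?x ?y] by simp
  qed
  from mult_left_mono[OF this, of R] show ?thesis
    using nrm_dist(1)[OF assms(1), of "-w" x y c] nrm_dist(2)[OF assms(1), of "-w" x c]
      nrm_dist(3)[OF assms(1), of "-w" y c] assms(1,2) by (simp add: algebra_simps)
qed

lemma pair_cost:
  assumes "0 < R" "w \<in> units" "x \<in> cell c R" "y \<in> cell c R" "dir (x - c) \<noteq> dir (y - c)"
    "dir (x - c) \<noteq> w" "dir (y - c) \<noteq> w"
  shows "dist x y - 3 * dist x c + 3 * dist y (c + complex_of_real R * w) \<le> 4 * R \<or>
    dist y x - 3 * dist y c + 3 * dist x (c + complex_of_real R * w) \<le> 4 * R"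
proof -
  let ?x = "nrm c R w x" and ?y = "nrm c R w y"
  have "?x \<in> secL \<and> ?y \<in> secU \<union> secD \<or> ?x \<in> secU \<and> ?y \<in> secL \<union> secD \<or> ?x \<in> secD \<and> ?y \<in> secL \<union> secU"
    by (rule units_cases[OF dir_units assms(2,6)]; rule units_cases[OF dir_units assms(2,7)])
      (use nrm_sec[OF assms(1-3)] nrm_sec[OF assms(1,2,4)] assms(5) in auto)
  then have "cost ?x ?y \<le> 4 \<or> cost ?y ?x \<le> 4" by (rule cost_pair)
  then show ?thesis
  proof
    assume "cost ?x ?y \<le> 4"
    from mult_left_mono[OF this, of R] show ?thesis
      unfolding nrm_dist(1)[OF assms(1,2), of x y c] nrm_dist(2,3)[OF assms(1,2), of _ c] cost_def
      using assms(1) by (simp add: algebra_simps)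
  next
    assume "cost ?y ?x \<le> 4"
    from mult_left_mono[OF this, of R] show ?thesis
      unfolding nrm_dist(1)[OF assms(1,2), of y x c] nrm_dist(2,3)[OF assms(1,2), of _ c] cost_def
      using assms(1) by (simp add: algebra_simps)
  qed
qed

text \<open>\<open>hub_ok\<close> at true scale with the roles fixed: hub \<open>r\<close>, first
  light \<open>i\<close>, second light \<open>k\<close>. The star condition ranges over all
  \<open>q\<close> in the quarter of \<open>r\<close>, because the point that takes the edges may be
  a stand-in for \<open>r\<close>.\<close>

definition merge_ok :: "complex \<Rightarrow> real \<Rightarrow> complex \<Rightarrow> complex \<Rightarrow> complex \<Rightarrow> complex \<Rightarrow> bool" where
  "merge_ok c R w r i k \<longleftrightarrow>
     dist i r - 3 * dist i c + 3 * dist r (c + complex_of_real R * w) \<le> 4 * R \<and>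
     (dist i c \<le> dist k c \<and> dist k r - 3 * dist k c + 3 * dist r (c + complex_of_real R * w) \<le> 4 * R \<and>
       (\<forall>q\<in>cell c R. dir (q - c) = dir (r - c) \<longrightarrow> dist i q + dist k q \<le> 3 * dist i c + 3 * dist k c) \<or>
      dist k i + dist i c \<le> 3 * dist k c \<and>
       dist k i + dist i r - 3 * dist k c + 3 * dist r (c + complex_of_real R * w) \<le> 4 * R)"

lemma merge_ok_star:
  assumes "0 < R" "w \<in> units" "star_ok Z (nrm c R w r) (nrm c R w i) (nrm c R w k)"
    "\<And>q. q \<in> cell c R \<Longrightarrow> dir (q - c) = dir (r - c) \<Longrightarrow> nrm c R w q \<in> Z"
  shows "merge_ok c R w r i k"
proof -
  let ?N = "nrm c R w"
  have s: "cost (?N i) (?N r) \<le> 4" "cost (?N k) (?N r) \<le> 4" "cmod (?N i) \<le> cmod (?N k)"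
    "\<forall>q\<in>Z. cmod (?N i - q) + cmod (?N k - q) \<le> 3 * cmod (?N i) + 3 * cmod (?N k)"
    using assms(3) by (auto simp: star_ok_def)
  have 1: "dist x r - 3 * dist x c + 3 * dist r (c + complex_of_real R * w) \<le> 4 * R"
    if "cost (?N x) (?N r) \<le> 4" for x
    using mult_left_mono[OF that, of R] assms(1)
    unfolding nrm_dist(1)[OF assms(1,2), of x r c] nrm_dist(2,3)[OF assms(1,2), of _ c] cost_def
    by (simp add: algebra_simps)
  have 2: "dist i q + dist k q \<le> 3 * dist i c + 3 * dist k c"
    if "q \<in> cell c R" "dir (q - c) = dir (r - c)" for q
    using mult_left_mono[OF s(4)[rule_format, OF assms(4)[OF that]], of R] assms(1)
    unfolding nrm_dist(1)[OF assms(1,2), of _ q c] nrm_dist(2)[OF assms(1,2), of _ c]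
    by (simp add: algebra_simps)
  have 3: "dist i c \<le> dist k c"
    using mult_left_mono[OF s(3), of R] assms(1) unfolding nrm_dist(2)[OF assms(1,2), of _ c] by simp
  show ?thesis unfolding merge_ok_def using 1[OF s(1)] 1[OF s(2)] 2 3 by blast
qed

lemma merge_ok_chain:
  assumes "0 < R" "w \<in> units" "chain_ok (nrm c R w r) (nrm c R w i) (nrm c R w k)"
  shows "merge_ok c R w r i k"
proof -
  let ?N = "nrm c R w"
  have s: "cost (?N i) (?N r) \<le> 4" "cmod (?N k - ?N i) + cmod (?N i) \<le> 3 * cmod (?N k)"
    "cmod (?N k - ?N i) + cmod (?N i - ?N r) - 3 * cmod (?N k) + 3 * cmod (?N r - 1) \<le> 4"
    using assms(3) by (auto simp: chain_ok_def)
  show ?thesis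
    unfolding merge_ok_def nrm_dist(1)[OF assms(1,2), of i r c] nrm_dist(1)[OF assms(1,2), of k i c]
      nrm_dist(2,3)[OF assms(1,2), of _ c]
    using mult_left_mono[OF s(1), of R] mult_left_mono[OF s(2), of R] mult_left_mono[OF s(3), of R] assms(1)
    by (simp add: algebra_simps cost_def)
qed

lemma merge_ok_hub:
  assumes "0 < R" "w \<in> units" "hub_ok Z (nrm c R w r) (nrm c R w i) (nrm c R w k)"
    "\<And>q. q \<in> cell c R \<Longrightarrow> dir (q - c) = dir (r - c) \<Longrightarrow> nrm c R w q \<in> Z"
  shows "merge_ok c R w r i k \<or> merge_ok c R w r k i"
  using assms(3) merge_ok_star[OF assms(1,2) _ assms(4)] merge_ok_chain[OF assms(1,2)]
  unfolding hub_ok_def by blast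

lemma hub_exists:
  assumes "0 < R" "w \<in> units" "x \<in> cell c R" "y \<in> cell c R" "z \<in> cell c R"
    "dir (x - c) = - w" "dir (y - c) = \<i> * w" "dir (z - c) = - \<i> * w"
  shows "merge_ok c R w x y z \<or> merge_ok c R w x z y \<or> merge_ok c R w y x z \<or> merge_ok c R w y z x \<or>
    merge_ok c R w z x y \<or> merge_ok c R w z y x"
proof -
  have "hub_ok secL (nrm c R w x) (nrm c R w y) (nrm c R w z) \<or>
      hub_ok secU (nrm c R w y) (nrm c R w x) (nrm c R w z) \<or>
      hub_ok secD (nrm c R w z) (nrm c R w x) (nrm c R w y)"
    by (rule hub_three) (use nrm_sec[OF assms(1,2)] assms in auto)
  then show ?thesis
  proof (elim disjE)
    assume "hub_ok secL (nrm c R w x) (nrm c R w y) (nrm c R w z)"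
    from merge_ok_hub[OF assms(1,2) this] show ?thesis using nrm_sec(1)[OF assms(1,2)] assms(6) by auto
  next
    assume "hub_ok secU (nrm c R w y) (nrm c R w x) (nrm c R w z)"
    from merge_ok_hub[OF assms(1,2) this] show ?thesis using nrm_sec(2)[OF assms(1,2)] assms(7) by auto
  next
    assume "hub_ok secD (nrm c R w z) (nrm c R w x) (nrm c R w y)"
    from merge_ok_hub[OF assms(1,2) this] show ?thesis using nrm_sec(3)[OF assms(1,2)] assms(8) by auto
  qed
qed

text \<open>Distances in the Steiner tree: it contains all diagonals between opposite corners that lead
  from a side cell to the centre of its parent. \<open>corner_dist n c R w x\<close> is the distance from \<open>x\<close> to the corner
  \<open>c + R w\<close>, \<open>centre_dist\<close> the distance to the centre \<open>c\<close>, \<open>tree_dist\<close> the distance between two points.\<close>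

fun corner_dist :: "nat \<Rightarrow> complex \<Rightarrow> real \<Rightarrow> complex \<Rightarrow> complex \<Rightarrow> real" where
  "corner_dist 0 c R w x = dist x (c + complex_of_real R * w)"
| "corner_dist (Suc n) c R w x = (if dir (x - c) = w then corner_dist n (sub_centre c R x) (R/2) w x
     else R + corner_dist n (sub_centre c R x) (R/2) (- dir (x - c)) x)"

definition centre_dist :: "nat \<Rightarrow> complex \<Rightarrow> real \<Rightarrow> complex \<Rightarrow> real" where
  "centre_dist n c R x = corner_dist n (sub_centre c R x) (R/2) (- dir (x - c)) x"

fun tree_dist :: "nat \<Rightarrow> complex \<Rightarrow> real \<Rightarrow> complex \<Rightarrow> complex \<Rightarrow> real" where
  "tree_dist 0 c R x y = 0"
| "tree_dist (Suc n) c R x y = (if dir (x - c) = dir (y - c) then tree_dist n (sub_centre c R x) (R/2) x y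
     else centre_dist n c R x + centre_dist n c R y)"

lemma sub_centre_corner: "sub_centre c R x + complex_of_real (R/2) * - dir (x - c) = c"
  "dir (x - c) = w \<Longrightarrow> sub_centre c R x + complex_of_real (R/2) * w = c + complex_of_real R * w"
  by (simp_all add: sub_centre_def flip: distrib_right)

abbreviation joined :: "'a set set \<Rightarrow> 'a set set \<Rightarrow> 'a \<Rightarrow> 'a \<Rightarrow> 'a set set" where
  "joined E F p k \<equiv> insert {p, k} (E \<union> F)"

lemma walk_le_jn: "walk_le E x y L \<Longrightarrow> walk_le (joined E F p k) x y L" "walk_le F x y L \<Longrightarrow> walk_le (joined E F p k) x y L"
  by (erule walk_le_mono; blast)+

lemma walk_le_cross:
  assumes "walk_le E x p a" "walk_le F y k b" "a + b + dist p k \<le> L"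
  shows "walk_le (joined E F p k) x y L" "walk_le (joined E F p k) y x L"
proof -
  have "walk_le (joined E F p k) p k (dist p k)" by (rule walk_le_edge) simp
  from walk_le_trans[OF walk_le_jn(1)[OF assms(1)] walk_le_trans[OF this walk_le_jn(2)[OF walk_le_sym[OF assms(2)]]]]
  show "walk_le (joined E F p k) x y L" by (rule walk_le_le) (use assms(3) in simp)
  then show "walk_le (joined E F p k) y x L" by (rule walk_le_sym)
qed

lemma walk_le_refl0: "0 \<le> L \<Longrightarrow> x = y \<Longrightarrow> walk_le E x y L"
  by (simp add: walk_le.refl)

section \<open>Invariant of a subtree, degree budget and attachment of light subtrees\<close>

locale scheme =
  fixes K :: nat and \<theta> \<kappa> :: real
  assumes K1: "1 \<le> K" and theta: "\<theta> * (2 ^ K - 1) = 4" and kappa: "\<kappa> = 4 + \<theta>"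
begin

lemma theta_pos: "0 < \<theta>"
proof (rule ccontr)
  have "(1::real) \<le> 2 ^ K" by simp
  moreover assume "\<not> 0 < \<theta>"
  ultimately have "\<theta> * (2 ^ K - 1) \<le> 0" by (intro mult_nonpos_nonneg) auto
  then show False using theta by simp
qed

text \<open>The fixed point behind \<open>\<theta>\<close>: a detour over the oldest entry costs at
  most \<open>4 + \<theta>\<close> times a radius smaller than \<open>R\<close> by the factor
  \<open>2 ^ K\<close>, and this is to be \<open>\<theta> * R\<close> again.\<close>

lemma theta_pow: "(4 + \<theta>) / 2 ^ K = \<theta>"
  using theta by (simp add: field_simps)

lemma theta_le: "2 \<le> K \<Longrightarrow> \<theta> \<le> 4/3"
proof -
  assume "2 \<le> K"
  then have "(2::real) ^ 2 \<le> 2 ^ K" by (intro power_increasing) auto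
  then have "\<theta> * 3 \<le> \<theta> * (2 ^ K - 1)" using theta_pos by (intro mult_left_mono) auto
  then show ?thesis using theta by simp
qed

text \<open>A merge at which \<open>r\<close> itself takes up to two edges lengthens the queue, and
  the first tail costs one more edge, so \<open>r\<close> has degree at most
  \<open>2 * K + 1\<close>. Entering the queue takes one edge and a chained light possibly another;
  two out of \<open>2 * K + 5\<close> are left for the time as stand-in. A tail arrives with at most
  \<open>2 * K + 3\<close>, is attached by one edge and can take one more for its successor.\<close>

definition cap :: "complex \<Rightarrow> complex list \<Rightarrow> complex list \<Rightarrow> complex \<Rightarrow> nat" where
  "cap r Q T x = (if x = r then 2 * length Q + length T else if x \<in> set Q then 2 * K + 3
     else if x \<in> set T then 2 * K + 4 else 2 * K + 5)"

text \<open>The invariant of a subtree with representative \<open>r\<close> that hangs at the corner \<open>A\<close> of its cell.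
  The points in the queue \<open>Q\<close> were attached to \<open>r\<close> at earlier merges and can still take two edges
  each; the oldest, at the head, is closest to \<open>r\<close> in relation to the size of the cell, and replaces
  \<open>r\<close> as a centre when the queue is full. \<open>T\<close> plays the same role for tails, that is, subtrees that
  enter the cell through the corner opposite to \<open>A\<close>.\<close>

definition fresh :: "complex set \<Rightarrow> complex set \<Rightarrow> complex set set \<Rightarrow> (complex \<Rightarrow> real) \<Rightarrow> complex \<Rightarrow> real
    \<Rightarrow> bool \<Rightarrow> complex \<Rightarrow> complex list \<Rightarrow> complex list \<Rightarrow> bool" where
  "fresh S X E h A R b r Q T \<longleftrightarrow>
     (is_tree X E \<and> S \<subseteq> X \<and> r \<in> S \<and> set Q \<subseteq> S \<and> set T \<subseteq> X \<and> distinct (r # Q @ T) \<and>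
      length Q \<le> K \<and> length T \<le> 1) \<and>
     (\<forall>x\<in>X. deg E x \<le> cap r Q T x) \<and>
     (\<exists>s. 0 \<le> s \<and> s \<le> R \<and> (\<forall>j<length Q. dist r (Q ! j) \<le> 2 * s / 2 ^ (length Q - 1 - j) \<and>
       walk_le E r (Q ! j) (dist r (Q ! j) + \<theta> * s / 2 ^ (length Q - 1 - j)))) \<and>
     (\<forall>x\<in>X. \<forall>q\<in>set Q. walk_le E x q (\<kappa> * h x - dist q A)) \<and>
     (\<forall>t\<in>set T. walk_le E r t (dist r t + 8/3 * (if b then R else R/2))) \<and>
     (b \<or> X = S) \<and>
     (\<forall>x\<in>X. walk_le E x r (\<kappa> * h x - 3 * dist r A))"

lemma freshD:
  assumes "fresh S X E h A R b r Q T"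
  shows "is_tree X E" "S \<subseteq> X" "r \<in> S" "set Q \<subseteq> S" "set T \<subseteq> X" "distinct (r # Q @ T)"
    "length Q \<le> K" "length T \<le> 1"
    "\<And>x. x \<in> X \<Longrightarrow> deg E x \<le> cap r Q T x"
    "\<exists>s. 0 \<le> s \<and> s \<le> R \<and> (\<forall>j<length Q. dist r (Q ! j) \<le> 2 * s / 2 ^ (length Q - 1 - j) \<and>
       walk_le E r (Q ! j) (dist r (Q ! j) + \<theta> * s / 2 ^ (length Q - 1 - j)))"
    "\<And>x q. x \<in> X \<Longrightarrow> q \<in> set Q \<Longrightarrow> walk_le E x q (\<kappa> * h x - dist q A)"
    "\<And>t. t \<in> set T \<Longrightarrow> walk_le E r t (dist r t + 8/3 * (if b then R else R/2))"
    "b \<or> X = S" "\<And>x. x \<in> X \<Longrightarrow> walk_le E x r (\<kappa> * h x - 3 * dist r A)" "r \<in> X" "set Q \<subseteq> X"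
  using assms unfolding fresh_def by blast+

lemma freshI:
  assumes "is_tree X E" "S \<subseteq> X" "r \<in> S" "set Q \<subseteq> S" "set T \<subseteq> X" "distinct (r # Q @ T)"
    "length Q \<le> K" "length T \<le> 1"
    "\<And>x. x \<in> X \<Longrightarrow> deg E x \<le> cap r Q T x"
    "\<exists>s. 0 \<le> s \<and> s \<le> R \<and> (\<forall>j<length Q. dist r (Q ! j) \<le> 2 * s / 2 ^ (length Q - 1 - j) \<and>
       walk_le E r (Q ! j) (dist r (Q ! j) + \<theta> * s / 2 ^ (length Q - 1 - j)))"
    "\<And>x q. x \<in> X \<Longrightarrow> q \<in> set Q \<Longrightarrow> walk_le E x q (\<kappa> * h x - dist q A)"
    "\<And>t. t \<in> set T \<Longrightarrow> walk_le E r t (dist r t + 8/3 * (if b then R else R/2))"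
    "b \<or> X = S" "\<And>x. x \<in> X \<Longrightarrow> walk_le E x r (\<kappa> * h x - 3 * dist r A)"
  shows "fresh S X E h A R b r Q T"
  using assms unfolding fresh_def by blast

lemma fresh_cong:
  assumes "fresh S X E h A R b r Q T" "\<And>x. x \<in> X \<Longrightarrow> h' x = h x"
  shows "fresh S X E h' A R b r Q T"
  using assms unfolding fresh_def by auto

lemma cap_le: "length Q \<le> K \<Longrightarrow> length T \<le> 1 \<Longrightarrow> cap r Q T x \<le> 2 * K + 5"
  by (simp add: cap_def)

lemma fresh_rep_deg: "fresh S X E h A R b r Q T \<Longrightarrow> deg E r \<le> 2 * K + 1"
  using freshD(7-9)[of S X E h A R b r Q T] freshD(15)[of S X E h A R b r Q T] by (fastforce simp: cap_def)

lemma fresh_deg: "fresh S X E h A R b r Q T \<Longrightarrow> x \<in> X \<Longrightarrow> deg E x \<le> 2 * K + 5"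
  using freshD(7-9)[of S X E h A R b r Q T] cap_le[of Q T r x] by (meson order_trans)

text \<open>For a subtree that meets no other at \<open>c\<close>: the additional Steiner length
  yields \<open>\<kappa> * R \<ge> 4 * R\<close>, while \<open>3 * dist r A\<close> exceeds
  \<open>3 * dist r c\<close> by at most \<open>3 * R\<close>.\<close>

lemma fresh_lift:
  assumes f: "fresh S X E h c (R/2) b r Q T" and "0 < R" "dist c A = R" "b \<longrightarrow> b'"
  shows "fresh S X E (\<lambda>x. h x + R) A R b' r Q T"
proof (rule freshI)
  have tri: "dist q A \<le> dist q c + R" for q using dist_triangle[of q A c] assms(3) by simp
  have kap: "4 * R \<le> \<kappa> * R" using assms(2) theta_pos by (simp add: kappa)
  obtain s where s: "0 \<le> s" "s \<le> R/2" "\<forall>j<length Q. dist r (Q ! j) \<le> 2 * s / 2 ^ (length Q - 1 - j) \<and>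
       walk_le E r (Q ! j) (dist r (Q ! j) + \<theta> * s / 2 ^ (length Q - 1 - j))"
    using freshD(10)[OF f] by blast
  show "\<exists>s. 0 \<le> s \<and> s \<le> R \<and> (\<forall>j<length Q. dist r (Q ! j) \<le> 2 * s / 2 ^ (length Q - 1 - j) \<and>
       walk_le E r (Q ! j) (dist r (Q ! j) + \<theta> * s / 2 ^ (length Q - 1 - j)))"
    using s assms(2) by (intro exI[of _ s]) auto
  show "walk_le E x q (\<kappa> * (h x + R) - dist q A)" if "x \<in> X" "q \<in> set Q" for x q
    by (rule walk_le_le[OF freshD(11)[OF f that]]) (use tri[of q] kap assms(2) distrib_left[of \<kappa> "h x" R] in linarith)
  show "walk_le E r t (dist r t + 8/3 * (if b' then R else R/2))" if "t \<in> set T" for t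
    by (rule walk_le_le[OF freshD(12)[OF f that]]) (use assms in auto)
  show "walk_le E x r (\<kappa> * (h x + R) - 3 * dist r A)" if "x \<in> X" for x
    by (rule walk_le_le[OF freshD(14)[OF f that]]) (use tri[of r] kap assms(2) distrib_left[of \<kappa> "h x" R] in linarith)
qed (use freshD[OF f] assms in auto)

text \<open>Here \<open>h\<close> already counts up to \<open>A\<close>, so \<open>h x - R\<close>
  is the distance to the centre of the merge. The credit \<open>\<psi>\<close> of the attached
  subtree is a parameter: \<open>3 * dist k c\<close> for a light one,
  \<open>\<kappa> * R + dist \<tau> B\<close> for a tail, which has a further \<open>R\<close> to
  travel to the centre.\<close>

lemma attach:
  assumes f: "fresh S X E h A R b r Q T"
    and Z: "is_tree Z F" "X \<inter> Z = {}" "p \<in> X" "k \<in> Z" "S' \<subseteq> Z"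
    and light: "\<And>y. y \<in> Z \<Longrightarrow> walk_le F y k (\<kappa> * (h y - R) - \<psi>)"
    and P: "\<And>x. x \<in> X \<Longrightarrow> walk_le E x p (\<kappa> * (h x - R) + \<psi> - dist p k)"
    and r: "walk_le E p r (\<kappa> * R - 3 * dist r A + \<psi> - dist p k)"
    and Q: "\<And>q. q \<in> set Q \<Longrightarrow> walk_le E p q (\<kappa> * R - dist q A + \<psi> - dist p k)"
    and T': "set T' \<subseteq> X \<union> Z" "length T' \<le> 1" "distinct (r # Q @ T')"
      "\<And>t. t \<in> set T' \<Longrightarrow> walk_le (joined E F p k) r t (dist r t + 8/3 * (if b' then R else R/2))"
    and deg: "\<And>x. x \<in> X \<Longrightarrow> deg E x + (if x = p then 1 else 0) \<le> cap r Q T' x"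
      "\<And>y. y \<in> Z \<Longrightarrow> deg F y + (if y = k then 1 else 0) \<le> cap r Q T' y"
    and b: "b \<longrightarrow> b'" "b' \<or> Z = S'"
  shows "fresh (S \<union> S') (X \<union> Z) (joined E F p k) h A R b' r Q T'"
    and "\<And>x y. x \<in> X \<Longrightarrow> y \<in> Z \<Longrightarrow> walk_le (joined E F p k) x y (\<kappa> * (h x - R) + \<kappa> * (h y - R))"
proof -
  let ?G = "joined E F p k"
  have X: "r \<in> X" "set Q \<subseteq> X" using freshD(15,16)[OF f] .
  have new: "walk_le ?G y q (\<kappa> * h y + d)" if "y \<in> Z" "walk_le E p q (\<kappa> * R + d + \<psi> - dist p k)" for y q d
    by (rule walk_le_cross(2)[OF walk_le_sym[OF that(2)] light[OF that(1)]]) (simp add: algebra_simps)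
  show "fresh (S \<union> S') (X \<union> Z) ?G h A R b' r Q T'"
  proof (rule freshI)
    show "is_tree (X \<union> Z) ?G" using freshD(1)[OF f] Z by (intro is_tree.join)
    show "deg ?G x \<le> cap r Q T' x" if "x \<in> X \<union> Z" for x
      using that deg deg_join[OF freshD(1)[OF f] Z(1-4), of x] by (cases "x \<in> X") auto
    show "\<exists>s. 0 \<le> s \<and> s \<le> R \<and> (\<forall>j<length Q. dist r (Q ! j) \<le> 2 * s / 2 ^ (length Q - 1 - j) \<and>
       walk_le ?G r (Q ! j) (dist r (Q ! j) + \<theta> * s / 2 ^ (length Q - 1 - j)))"
      using freshD(10)[OF f] walk_le_jn(1) by blast
    show "walk_le ?G x q (\<kappa> * h x - dist q A)" if "x \<in> X \<union> Z" "q \<in> set Q" for x q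
      using that new[of x q "- dist q A"] Q[of q] walk_le_jn(1)[OF freshD(11)[OF f], of x q] by auto
    show "walk_le ?G x r (\<kappa> * h x - 3 * dist r A)" if "x \<in> X \<union> Z" for x
      using that new[of x r "- 3 * dist r A"] r walk_le_jn(1)[OF freshD(14)[OF f], of x] by auto
  qed (use freshD(2-4,7,13)[OF f] T' b Z in auto)
  show "walk_le ?G x y (\<kappa> * (h x - R) + \<kappa> * (h y - R))" if "x \<in> X" "y \<in> Z" for x y
    by (rule walk_le_cross(1)[OF P[OF that(1)] light[OF that(2)]]) simp
qed

text \<open>Every old entry ages by one, which doubles the denominator; passing from
  \<open>s \<le> R/2\<close> to \<open>R\<close> makes up for it. The new entry starts with exponent
  0.\<close>

lemma queue_append:
  assumes len: "length Q \<le> K" and s: "0 \<le> s" "s \<le> R/2"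
    and q: "\<And>j. j < length Q \<Longrightarrow> dist r (Q ! j) \<le> 2 * s / 2 ^ (length Q - 1 - j) \<and>
       walk_le E r (Q ! j) (dist r (Q ! j) + \<theta> * s / 2 ^ (length Q - 1 - j))"
    and i: "dist r i \<le> 2 * R" "walk_le E r i (dist r i + \<theta> * R)"
  shows "\<exists>s. 0 \<le> s \<and> s \<le> R \<and> (\<forall>j<length (Q @ [i]). dist r ((Q @ [i]) ! j) \<le> 2 * s / 2 ^ (length (Q @ [i]) - 1 - j) \<and>
       walk_le E r ((Q @ [i]) ! j) (dist r ((Q @ [i]) ! j) + \<theta> * s / 2 ^ (length (Q @ [i]) - 1 - j)))"
proof (intro exI[of _ R] conjI allI impI)
  show "0 \<le> R" "R \<le> R" using s by auto
  fix j assume j: "j < length (Q @ [i])"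
  have "dist r ((Q @ [i]) ! j) \<le> 2 * R / 2 ^ (length (Q @ [i]) - 1 - j) \<and>
    walk_le E r ((Q @ [i]) ! j) (dist r ((Q @ [i]) ! j) + \<theta> * R / 2 ^ (length (Q @ [i]) - 1 - j))"
  proof (cases "j < length Q")
    case True
    define m where "m = length Q - 1 - j"
    have m: "length (Q @ [i]) - 1 - j = Suc m" using True by (simp add: m_def)
    have "2 * s / 2 ^ m \<le> 2 * (R/2) / 2 ^ m" "\<theta> * s / 2 ^ m \<le> \<theta> * (R/2) / 2 ^ m"
      using s theta_pos by (intro divide_right_mono mult_left_mono; simp)+
    then have le: "2 * s / 2 ^ m \<le> 2 * R / 2 ^ Suc m" "\<theta> * s / 2 ^ m \<le> \<theta> * R / 2 ^ Suc m" by simp_all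
    have a: "dist r (Q ! j) \<le> 2 * s / 2 ^ m" "walk_le E r (Q ! j) (dist r (Q ! j) + \<theta> * s / 2 ^ m)"
      using q[OF True] by (simp_all only: m_def)
    have "(Q @ [i]) ! j = Q ! j" using True by (simp add: nth_append)
    then show ?thesis unfolding m
      using order_trans[OF a(1) le(1)] walk_le_le[OF a(2) add_left_mono[OF le(2)]] by (simp only:)
  next
    case False
    then have "j = length Q" using j by simp
    then have "(Q @ [i]) ! j = i" "length (Q @ [i]) - 1 - j = 0" by simp_all
    then show ?thesis using i by simp
  qed
  then show "dist r ((Q @ [i]) ! j) \<le> 2 * R / 2 ^ (length (Q @ [i]) - 1 - j)"
    "walk_le E r ((Q @ [i]) ! j) (dist r ((Q @ [i]) ! j) + \<theta> * R / 2 ^ (length (Q @ [i]) - 1 - j))"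
    by auto
qed

text \<open>The point \<open>q\<close> stands in for \<open>r\<close> at the next merge; \<open>Q0\<close> is what then remains of the queue.\<close>

definition target where
  "target S X E h c R r Q T q Q0 s \<longleftrightarrow>
     q \<in> S \<and> walk_le E r q (\<theta> * R - dist r q) \<and>
     (\<forall>x\<in>X. walk_le E x q (\<kappa> * h x - dist q c)) \<and>
     length Q0 < K \<and> set Q0 \<subseteq> set Q \<and> q \<notin> set Q0 \<and> q \<notin> set T \<and> distinct (r # Q0 @ T) \<and>
     0 \<le> s \<and> s \<le> R/2 \<and>
     (\<forall>j<length Q0. dist r (Q0 ! j) \<le> 2 * s / 2 ^ (length Q0 - 1 - j) \<and>
       walk_le E r (Q0 ! j) (dist r (Q0 ! j) + \<theta> * s / 2 ^ (length Q0 - 1 - j))) \<and>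
     (q = r \<and> Q0 = Q \<or> q \<noteq> r \<and> q \<in> set Q \<and> set Q \<subseteq> insert q (set Q0) \<and> Suc (length Q0) = length Q)"

lemma targetD:
  assumes "target S X E h c R r Q T q Q0 s"
  shows "q \<in> S" "walk_le E r q (\<theta> * R - dist r q)"
    "\<And>x. x \<in> X \<Longrightarrow> walk_le E x q (\<kappa> * h x - dist q c)"
    "length Q0 < K" "set Q0 \<subseteq> set Q" "q \<notin> set Q0" "q \<notin> set T" "distinct (r # Q0 @ T)"
    "0 \<le> s" "s \<le> R/2"
    "\<And>j. j < length Q0 \<Longrightarrow> dist r (Q0 ! j) \<le> 2 * s / 2 ^ (length Q0 - 1 - j) \<and>
       walk_le E r (Q0 ! j) (dist r (Q0 ! j) + \<theta> * s / 2 ^ (length Q0 - 1 - j))"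
    "q = r \<and> Q0 = Q \<or> q \<noteq> r \<and> q \<in> set Q \<and> set Q \<subseteq> insert q (set Q0) \<and> Suc (length Q0) = length Q"
  using assms unfolding target_def by blast+

text \<open>While the queue has room, \<open>r\<close> serves itself. A full queue gives up its
  head, whose exponent \<open>K - 1\<close> together with \<open>s \<le> R/2\<close> yields the
  power in \<open>theta_pow\<close>.\<close>

lemma fresh_target:
  assumes f: "fresh S X E h c (R/2) b r Q T" and R: "0 < R"
  shows "\<exists>q Q0 s. target S X E h c R r Q T q Q0 s"
proof -
  note F = freshD[OF f]
  obtain s where s: "0 \<le> s" "s \<le> R/2" "\<And>j. j<length Q \<Longrightarrow> dist r (Q ! j) \<le> 2 * s / 2 ^ (length Q - 1 - j) \<and>
       walk_le E r (Q ! j) (dist r (Q ! j) + \<theta> * s / 2 ^ (length Q - 1 - j))"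
    using F(10) by blast
  show ?thesis
  proof (cases "length Q < K")
    case True
    show ?thesis unfolding target_def
    proof (intro exI[of _ r] exI[of _ Q] exI[of _ s] conjI ballI allI impI)
      show "walk_le E r r (\<theta> * R - dist r r)" using theta_pos R by (intro walk_le_refl0) auto
      show "walk_le E x r (\<kappa> * h x - dist r c)" if "x \<in> X" for x
        by (rule walk_le_le[OF F(14)[OF that]]) simp
    qed (use True F s in auto)
  next
    case False
    then have K: "length Q = K" using F(7) by simp
    then obtain q Q0 where Q: "Q = q # Q0" using K1 by (cases Q) auto
    have "target S X E h c R r Q T q Q0 s" unfolding target_def
    proof (intro conjI ballI allI impI)
      have m: "length Q - 1 = length Q0" "Suc (length Q0) = K" using Q K by auto
      have h0: "dist r q \<le> 2 * s / 2 ^ length Q0" "walk_le E r q (dist r q + \<theta> * s / 2 ^ length Q0)"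
        using s(3)[of 0] Q m by auto
      have "(4 + \<theta>) * s / 2 ^ length Q0 \<le> (4 + \<theta>) * (R/2) / 2 ^ length Q0"
        using s theta_pos by (intro divide_right_mono mult_left_mono) auto
      also have "\<dots> = (4 + \<theta>) / 2 ^ K * R" unfolding m(2)[symmetric] by simp
      also have "\<dots> = \<theta> * R" by (simp add: theta_pow)
      \<comment> \<open>The distance \<open>dist r q\<close> is subtracted because an edge from
        \<open>q\<close> may be longer than one from \<open>r\<close> by that much; so the whole
        detour costs \<open>\<theta> * R\<close>.\<close>
      finally have "dist r q + \<theta> * s / 2 ^ length Q0 \<le> \<theta> * R - dist r q"
        using h0(1) by (simp add: distrib_right add_divide_distrib)
      then show "walk_le E r q (\<theta> * R - dist r q)" using h0(2) walk_le_le by blast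
      show "dist r (Q0 ! j) \<le> 2 * s / 2 ^ (length Q0 - 1 - j)"
          "walk_le E r (Q0 ! j) (dist r (Q0 ! j) + \<theta> * s / 2 ^ (length Q0 - 1 - j))" if "j < length Q0" for j
        using s(3)[of "Suc j"] Q that by simp_all
    qed (use F Q K s in auto)
    then show ?thesis by blast
  qed
qed

text \<open>Beyond the invariant this keeps what a second light subtree needs. It may be linked to
  \<open>q\<close> or to \<open>i\<close>, so both must have one unit of degree to spare.\<close>

definition light_at where
  "light_at S X E S' X' E' h c A R b b' r i T q Q1 \<longleftrightarrow>
     q \<in> S \<and>
     fresh (S \<union> S') (X \<union> X') (joined E E' q i) (\<lambda>x. h x + R) A R (b \<or> b') r Q1 T \<and>
     (\<forall>x\<in>X. \<forall>y\<in>X'. walk_le (joined E E' q i) x y (\<kappa> * h x + \<kappa> * h y)) \<and>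
     (\<forall>x\<in>X. walk_le (joined E E' q i) x q (\<kappa> * h x - dist q c)) \<and>
     walk_le (joined E E' q i) r q (\<theta> * R - dist r q) \<and>
     i \<in> set Q1 \<and>
     (\<forall>x\<in>set Q1. x = i \<or> x \<in> S \<and> 2 \<le> K \<and> walk_le E r x (dist r x + \<theta> * (R/2))) \<and>
     deg (joined E E' q i) q + 1 \<le> cap r Q1 T q \<and> deg (joined E E' q i) i + 1 \<le> cap r Q1 T i"

lemma light_atD:
  assumes "light_at S X E S' X' E' h c A R b b' r i T q Q1"
  shows "q \<in> S"
    "fresh (S \<union> S') (X \<union> X') (joined E E' q i) (\<lambda>x. h x + R) A R (b \<or> b') r Q1 T"
    "\<And>x y. x \<in> X \<Longrightarrow> y \<in> X' \<Longrightarrow> walk_le (joined E E' q i) x y (\<kappa> * h x + \<kappa> * h y)"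
    "\<And>x. x \<in> X \<Longrightarrow> walk_le (joined E E' q i) x q (\<kappa> * h x - dist q c)"
    "walk_le (joined E E' q i) r q (\<theta> * R - dist r q)" "i \<in> set Q1"
    "\<And>x. x \<in> set Q1 \<Longrightarrow> x = i \<or> x \<in> S \<and> 2 \<le> K \<and> walk_le E r x (dist r x + \<theta> * (R/2))"
    "deg (joined E E' q i) q + 1 \<le> cap r Q1 T q" "deg (joined E E' q i) i + 1 \<le> cap r Q1 T i"
  using assms unfolding light_at_def by blast+

text \<open>From \<open>i\<close> over the stand-in to \<open>r\<close> it is at most
  \<open>dist q i + \<theta> * R - dist r q\<close>, hence at most
  \<open>dist i r + \<theta> * R\<close> whichever point stands in; \<open>cost\<close> covers the
  rest.\<close>

lemma attach_light:
  assumes f: "fresh S X E h c (R/2) b r Q T" and g: "fresh S' X' E' h c (R/2) b' i Q' T'"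
    and R: "0 < R" and disj: "X \<inter> X' = {}" and A: "dist c A = R"
    and cost: "dist i r - 3 * dist i c + 3 * dist r A \<le> 4 * R"
    and S: "\<And>x. x \<in> S \<union> S' \<Longrightarrow> dist x c \<le> R" "\<And>x y. x \<in> S \<Longrightarrow> y \<in> S \<Longrightarrow> dist x y \<le> R"
      "\<And>x. x \<in> S \<Longrightarrow> min (dist r c) (4 * R - 3 * dist r A) + dist r x + dist x A \<le> 10/3 * R"
  shows "\<exists>q Q1. light_at S X E S' X' E' h c A R b b' r i T q Q1"
proof -
  note F = freshD[OF f] and G = freshD[OF g]
  obtain q Q0 s where "target S X E h c R r Q T q Q0 s" using fresh_target[OF f R] by blast
  note q = targetD[OF this]
  let ?G = "joined E E' q i" and ?Q = "Q0 @ [i]"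
  have qX: "q \<in> X" "q \<notin> X'" and iX: "i \<in> X'" "i \<notin> X" "i \<in> S'"
    using q(1) F(2) G(3,15) disj by auto
  have kap: "\<kappa> * R = 4 * R + \<theta> * R" by (simp add: kappa distrib_right)
  have thR: "0 < \<theta> * R" using theta_pos R by simp
  have h2: "\<kappa> * (h x + R) = \<kappa> * h x + \<kappa> * R" for x by (simp add: distrib_left)
  have tri: "dist x A \<le> dist x c + R" for x using dist_triangle[of x A c] A by simp
  have iq: "dist q i \<le> dist i r + dist r q" using dist_triangle[of q i r] by (simp add: dist_commute)
  have iq': "dist q i \<le> dist i c + dist q c" using dist_triangle2[of q i c] by (simp add: dist_commute add.commute)
  have ir: "dist i r \<le> dist i c + dist r c" by (rule dist_triangle2)
  have ec: "dist i c \<le> R" "dist r c \<le> R" "dist q c \<le> R" using S(1) iX F(3) q(1) by auto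
  \<comment> \<open>Since \<open>length Q0 < K\<close>, an entry can remain only if \<open>K\<close>
    is at least 2, and then \<open>\<theta> \<le> 4/3\<close> is available.\<close>
  have old: "2 \<le> K \<and> x \<in> S \<and> walk_le E r x (dist r x + \<theta> * (R/2))" if "x \<in> set Q0" for x
  proof -
    have "\<exists>j<length Q0. Q0 ! j = x" using that by (simp add: in_set_conv_nth)
    then obtain j where j: "j < length Q0" "Q0 ! j = x" by (elim exE conjE)
    have "\<theta> * s / 2 ^ (length Q0 - 1 - j) \<le> \<theta> * s / 1"
      using q(9) theta_pos by (intro divide_left_mono) auto
    also have "\<dots> \<le> \<theta> * (R/2)" using q(10) theta_pos by simp
    finally have le: "dist r x + \<theta> * s / 2 ^ (length Q0 - 1 - j) \<le> dist r x + \<theta> * (R/2)" by simp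
    have "walk_le E r x (dist r x + \<theta> * s / 2 ^ (length Q0 - 1 - j))"
      using conjunct2[OF q(11)[OF j(1)]] by (simp only: j(2))
    then have "walk_le E r x (dist r x + \<theta> * (R/2))" using le by (rule walk_le_le)
    moreover have "2 \<le> K" using j(1) q(4) by linarith
    moreover have "x \<in> S" by (rule subsetD[OF F(4) subsetD[OF q(5) that]])
    ultimately show ?thesis by simp
  qed
  have light: "walk_le E' y i (\<kappa> * h y - 3 * dist i c)" if "y \<in> X'" for y using G(14)[OF that] .
  have new: "walk_le ?G y o' L" if "y \<in> X'" "walk_le E q o' M" "M + dist q i - 3 * dist i c \<le> L - \<kappa> * h y" for y o' L M
    by (rule walk_le_cross(2)[OF walk_le_sym[OF that(2)] light[OF that(1)]]) (use that(3) in simp)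
  have sum_deg: "deg ?G x + (if x = q then 1 else 0) + (if x = i then 1 else 0) \<le> cap r ?Q T x" if x: "x \<in> X \<union> X'" for x
  proof (cases "x \<in> X")
    case True
    then have d: "deg ?G x = deg E x + (if x = q then 1 else 0)"
      using deg_join(1)[OF F(1) G(1) disj qX(1) iX(1)] by simp
    have "x \<noteq> i" using True iX by auto
    then have "x \<in> set ?Q \<longleftrightarrow> x \<in> set Q0" by simp
    moreover have "length ?Q = Suc (length Q0)" by simp
    moreover have "x \<in> set Q0 \<Longrightarrow> x \<in> set Q" using q(5) by auto
    moreover have "x \<in> set Q \<Longrightarrow> x \<in> set Q0 \<or> x = q" using q(12) by auto
    ultimately show ?thesis
      using F(9)[OF True] q(6,7,12) \<open>x \<noteq> i\<close> unfolding d cap_def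
      by (cases "x = r"; cases "x = q"; cases "x \<in> set Q"; cases "x \<in> set Q0"; cases "x \<in> set T") simp_all
  next
    case False
    then have xX: "x \<in> X'" "x \<noteq> q" "x \<noteq> r" "x \<notin> set T" "x \<notin> set Q0" 
      using x qX(1) F(15) subsetD[OF F(5)] subsetD[OF F(16) subsetD[OF q(5)]] by blast+
    then have d: "deg ?G x = deg E' x + (if x = i then 1 else 0)"
      using deg_join(2)[OF F(1) G(1) disj qX(1) iX(1)] by simp
    show ?thesis using fresh_deg[OF g xX(1)] fresh_rep_deg[OF g] xX unfolding d cap_def
      by (cases "x = i") simp_all
  qed
  have "light_at S X E S' X' E' h c A R b b' r i T q ?Q"
    unfolding light_at_def
  proof (intro conjI ballI)
    show "fresh (S \<union> S') (X \<union> X') ?G (\<lambda>x. h x + R) A R (b \<or> b') r ?Q T"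
    proof (rule freshI)
      show "is_tree (X \<union> X') ?G" by (rule is_tree.join[OF F(1) G(1) disj qX(1) iX(1)])
      show "deg ?G x \<le> cap r ?Q T x" if "x \<in> X \<union> X'" for x using sum_deg[OF that] by linarith
      have i1: "walk_le ?G r i (dist r i + \<theta> * R)"
        by (rule walk_le_cross(1)[OF q(2) walk_le.refl[OF order_refl]])
          (use iq dist_commute[of i r] in linarith)
      have i2: "dist r i \<le> 2 * R" using ir ec by (simp add: dist_commute)
      have i3: "dist r (Q0 ! j) \<le> 2 * s / 2 ^ (length Q0 - 1 - j) \<and>
          walk_le ?G r (Q0 ! j) (dist r (Q0 ! j) + \<theta> * s / 2 ^ (length Q0 - 1 - j))" if "j < length Q0" for j
        using conjunct1[OF q(11)[OF that]] walk_le_jn(1)[OF conjunct2[OF q(11)[OF that]]] by (rule conjI)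
      show "\<exists>s. 0 \<le> s \<and> s \<le> R \<and> (\<forall>j<length ?Q. dist r (?Q ! j) \<le> 2 * s / 2 ^ (length ?Q - 1 - j) \<and>
         walk_le ?G r (?Q ! j) (dist r (?Q ! j) + \<theta> * s / 2 ^ (length ?Q - 1 - j)))"
        by (rule queue_append[OF less_imp_le[OF q(4)] q(9,10) i3 i2 i1])
      show "walk_le ?G x p (\<kappa> * (h x + R) - dist p A)" if x: "x \<in> X \<union> X'" and p: "p \<in> set ?Q" for x p
      proof (cases "p = i")
        case True
        show ?thesis
        proof (cases "x \<in> X")
          case True
          show ?thesis unfolding \<open>p = i\<close> h2
            by (rule walk_le_cross(1)[OF q(3)[OF True] walk_le.refl[OF order_refl]])
              (use iq' ec tri[of i] kap thR R in linarith)
        next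
          case False
          then have "x \<in> X'" using x by simp
          show ?thesis unfolding \<open>p = i\<close> h2
            by (rule walk_le_jn(2), rule walk_le_le[OF light[OF \<open>x \<in> X'\<close>]]) (use tri[of i] ec kap thR R zero_le_dist[of i c] in linarith)
        qed
      next
        case False
        then have pQ: "p \<in> set Q0" using p by simp
        note o = old[OF pQ]
        have pS: "p \<in> S" "p \<in> set Q" using o pQ subsetD[OF q(5)] by simp_all
        show ?thesis
        proof (cases "x \<in> X")
          case True
          show ?thesis unfolding h2
            by (rule walk_le_jn(1), rule walk_le_le[OF F(11)[OF True pS(2)]]) (use tri[of p] kap thR R in linarith)
        next
          case False
          then have x': "x \<in> X'" using x by simp
          have qp: "walk_le E q p (\<theta> * R - dist r q + (dist r p + \<theta> * (R/2)))"
            using o by (intro walk_le_trans[OF walk_le_sym[OF q(2)]]) simp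
          have "\<theta> \<le> 4/3" using theta_le o by simp
          then have "\<theta> * R \<le> 4/3 * R" using R by (intro mult_right_mono) simp_all
          moreover have "\<theta> * (R/2) = \<theta> * R / 2" by simp
          \<comment> \<open>This is the form required by \<open>queue_path\<close>; its 10/3 and
            \<open>\<theta> / 2 \<le> 2/3\<close> add up to the budget 4.\<close>
          moreover have "dist i r - 3 * dist i c \<le> min (dist r c) (4 * R - 3 * dist r A)"
            using cost ir zero_le_dist[of i c] by linarith
          ultimately have "\<theta> * R - dist r q + (dist r p + \<theta> * (R/2)) + dist q i - 3 * dist i c
              \<le> \<kappa> * h x + \<kappa> * R - dist p A - \<kappa> * h x"
            using S(3)[OF pS(1)] iq kap by linarith
          then show ?thesis unfolding h2 by (rule new[OF x' qp])
        qed
      qed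
      show "walk_le ?G r t (dist r t + 8/3 * (if b \<or> b' then R else R/2))" if "t \<in> set T" for t
        by (rule walk_le_jn(1), rule walk_le_le[OF F(12)[OF that]]) (use R in \<open>cases b; cases b'; simp\<close>)
      show "walk_le ?G x r (\<kappa> * (h x + R) - 3 * dist r A)" if x: "x \<in> X \<union> X'" for x
      proof (cases "x \<in> X")
        case True
        show ?thesis unfolding h2
          by (rule walk_le_jn(1), rule walk_le_le[OF F(14)[OF True]]) (use tri[of r] kap thR R in linarith)
      next
        case False
        then have "x \<in> X'" using x by simp
        then show ?thesis unfolding h2
          by (rule new[OF _ walk_le_sym[OF q(2)]]) (use iq cost kap in linarith)
      qed
      show "S \<union> S' \<subseteq> X \<union> X'" using F(2) G(2) by blast
      show "r \<in> S \<union> S'" using F(3) by blast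
      show "set ?Q \<subseteq> S \<union> S'" using q(5) F(4) iX by auto
      show "set T \<subseteq> X \<union> X'" using F(5) by blast
      show "distinct (r # ?Q @ T)" using q(5,8) iX(2) F(5,15,16) by auto
      show "length ?Q \<le> K" using q(4) by simp
      show "(b \<or> b') \<or> X \<union> X' = S \<union> S'" using F(13) G(13) by blast
    qed (rule F(8))
    show "walk_le ?G x y (\<kappa> * h x + \<kappa> * h y)" if "x \<in> X" "y \<in> X'" for x y
      by (rule walk_le_cross(1)[OF q(3)[OF that(1)] light[OF that(2)]]) (use iq' zero_le_dist[of i c] in linarith)
    show "walk_le ?G x q (\<kappa> * h x - dist q c)" if "x \<in> X" for x using q(3)[OF that] by (rule walk_le_jn(1))
    show "walk_le ?G r q (\<theta> * R - dist r q)" using q(2) by (rule walk_le_jn(1))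
    show "x = i \<or> x \<in> S \<and> 2 \<le> K \<and> walk_le E r x (dist r x + \<theta> * (R/2))" if "x \<in> set ?Q" for x
      using that old[of x] by (cases "x = i") simp_all
    show "deg ?G q + 1 \<le> cap r ?Q T q" "deg ?G i + 1 \<le> cap r ?Q T i"
      using sum_deg[of q] sum_deg[of i] qX iX by auto
    show "q \<in> S" by (rule q(1))
    show "i \<in> set ?Q" by simp
  qed
  then show ?thesis by blast
qed


text \<open>The second light goes to \<open>p\<close>, the stand-in \<open>q\<close> in a star and
  the first light \<open>i\<close> in a chain. Only \<open>i\<close> enters the queue, so a merge
  lengthens it by one even if two subtrees are attached.\<close>

lemma attach_two_lights:
  assumes f: "fresh S X E h c (R/2) b r Q T" and g: "fresh S' X' E' h c (R/2) b' i Q' T'"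
    and g2: "fresh S'' X'' E'' h c (R/2) b'' k Q'' T''"
    and R: "0 < R" and disj: "X \<inter> X' = {}" "(X \<union> X') \<inter> X'' = {}" and A: "dist c A = R"
    and cost: "dist i r - 3 * dist i c + 3 * dist r A \<le> 4 * R"
    and ok: "dist i c \<le> dist k c \<and> dist k r - 3 * dist k c + 3 * dist r A \<le> 4 * R \<and>
       (\<forall>q\<in>S. dist i q + dist k q \<le> 3 * dist i c + 3 * dist k c) \<or>
      dist k i + dist i c \<le> 3 * dist k c \<and> dist k i + dist i r - 3 * dist k c + 3 * dist r A \<le> 4 * R"
    and S: "\<And>x. x \<in> S \<union> S' \<union> S'' \<Longrightarrow> dist x c \<le> R" "\<And>x y. x \<in> S \<Longrightarrow> y \<in> S \<Longrightarrow> dist x y \<le> R"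
      "\<And>x. x \<in> S \<Longrightarrow> min (dist r c) (4 * R - 3 * dist r A) + dist r x + dist x A \<le> 10/3 * R"
  shows "\<exists>G Q1. fresh (S \<union> S' \<union> S'') (X \<union> X' \<union> X'') G (\<lambda>x. h x + R) A R (b \<or> b' \<or> b'') r Q1 T \<and>
     E \<subseteq> G \<and> E' \<subseteq> G \<and> E'' \<subseteq> G \<and>
     (\<forall>x\<in>X. \<forall>y\<in>X'. walk_le G x y (\<kappa> * h x + \<kappa> * h y)) \<and>
     (\<forall>x\<in>X \<union> X'. \<forall>y\<in>X''. walk_le G x y (\<kappa> * h x + \<kappa> * h y))"
proof -
  have S1: "\<And>x. x \<in> S \<union> S' \<Longrightarrow> dist x c \<le> R" using S(1) by blast
  obtain q Q1 where "light_at S X E S' X' E' h c A R b b' r i T q Q1"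
    using attach_light[OF f g R disj(1) A cost S1 S(2,3)] by blast
  note L = light_atD[OF this]
  let ?G = "joined E E' q i"
  note F = freshD[OF L(2)] and G2 = freshD[OF g2]
  have mem: "i \<in> X'" "k \<in> X''" "q \<in> X" "r \<in> X" "k \<notin> X \<union> X'"
    using freshD(15)[OF g] freshD(15)[OF g2] freshD(2,15)[OF f] L(1) disj by blast+
  have ec: "dist i c \<le> R" "dist k c \<le> R" "dist q c \<le> R" "dist r c \<le> R"
    using S(1) freshD(3)[OF g] freshD(3)[OF g2] freshD(3)[OF f] L(1) by blast+
  have neq: "i \<noteq> q" using mem disj(1) by blast
  have kap: "\<kappa> * R = 4 * R + \<theta> * R" by (simp add: kappa distrib_right)
  have thR: "0 < \<theta> * R" using theta_pos R by simp
  have tri: "dist x A \<le> dist x c + R" for x using dist_triangle[of x A c] A by simp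
  have qi: "walk_le ?G q i (dist q i)" by (rule walk_le_edge) simp
  have t1: "dist q i \<le> dist q c + dist i c" "dist k q \<le> dist k r + dist r q" "dist k r \<le> dist k c + dist r c"
    "dist i r \<le> dist i c + dist r c" "dist q i \<le> dist i r + dist r q" "dist k q \<le> dist k c + dist q c"
    "dist i q = dist q i" "dist k i = dist i k" "dist k q = dist q k" "dist k i \<le> dist k c + dist i c"
    using dist_triangle2[of q i c] dist_triangle[of k q r] dist_triangle2[of k r c] dist_triangle2[of i r c]
      dist_triangle[of i q r] dist_triangle2[of k q c] dist_triangle2[of k i c] by (simp_all add: dist_commute)
  \<comment> \<open>The star condition is tested only at the actual stand-in; if it fails there,
    \<open>ok\<close> provides the chain.\<close>
  define p where "p = (if dist i c \<le> dist k c \<and> dist k r - 3 * dist k c + 3 * dist r A \<le> 4 * R \<and>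
       dist i q + dist k q \<le> 3 * dist i c + 3 * dist k c then q else i)"
  have p: "p = q \<and> dist i c \<le> dist k c \<and> dist k r - 3 * dist k c + 3 * dist r A \<le> 4 * R \<and>
       dist i q + dist k q \<le> 3 * dist i c + 3 * dist k c \<or>
     p = i \<and> dist k i + dist i c \<le> 3 * dist k c \<and> dist k i + dist i r - 3 * dist k c + 3 * dist r A \<le> 4 * R"
    using ok L(1) by (auto simp: p_def)
  have light: "walk_le E'' y k (\<kappa> * (h y + R - R) - 3 * dist k c)" if "y \<in> X''" for y
    using G2(14)[OF that] by simp
  have P: "walk_le ?G x p (\<kappa> * (h x + R - R) + 3 * dist k c - dist p k)" if x: "x \<in> X \<union> X'" for x
  proof (cases "x \<in> X")
    case True
    show ?thesis
    proof (cases "p = q")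
      case True
      show ?thesis unfolding True
        by (rule walk_le_le[OF L(4)[OF \<open>x \<in> X\<close>]]) (use t1 zero_le_dist[of k c] in \<open>simp; linarith\<close>)
    next
      case False
      then have pi: "p = i" using p by auto
      show ?thesis unfolding pi
        by (rule walk_le_le[OF walk_le_trans[OF L(4)[OF \<open>x \<in> X\<close>] qi]])
          (use t1 p False in \<open>simp; linarith\<close>)
    qed
  next
    case False
    then have x': "x \<in> X'" using x by blast
    have xi: "walk_le ?G x i (\<kappa> * h x - 3 * dist i c)" using walk_le_jn(2)[OF freshD(14)[OF g x']] .
    show ?thesis
    proof (cases "p = i")
      case True
      show ?thesis unfolding True
        by (rule walk_le_le[OF xi]) (use t1 zero_le_dist[of k c] zero_le_dist[of i c] in \<open>simp; linarith\<close>)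
    next
      case False
      then have pq: "p = q" using p by auto
      show ?thesis unfolding pq
        by (rule walk_le_le[OF walk_le_trans[OF xi walk_le_sym[OF qi]]]) (use t1 p False in \<open>simp; linarith\<close>)
    qed
  qed
  define len where "len = dist k p + (if p = q then 0 else dist q i)"
  \<comment> \<open>The walk from \<open>k\<close> over \<open>p\<close> and \<open>q\<close> to
    \<open>r\<close>, less the credit of \<open>k\<close>, obeys the same two bounds as that of the
    first light, so \<open>queue_path\<close> serves for both.\<close>
  have phi: "dist k p + (if p = q then 0 else dist i q) - dist r q - 3 * dist k c \<le> min (dist r c) (4 * R - 3 * dist r A)"
  proof (cases "p = q")
    case True
    then have "dist k r - 3 * dist k c + 3 * dist r A \<le> 4 * R" using p neq by auto
    moreover have "dist k p = dist k q" using True by simp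
    ultimately show ?thesis unfolding if_P[OF True] using t1 zero_le_dist[of k c] by linarith
  next
    case False
    then have "p = i" "dist k i + dist i c \<le> 3 * dist k c"
      "dist k i + dist i r - 3 * dist k c + 3 * dist r A \<le> 4 * R" using p by auto
    then show ?thesis unfolding if_not_P[OF False] using t1 dist_triangle[of i q r] dist_commute[of q r]
      by (simp; linarith)
  qed
  have pr: "walk_le ?G p r (\<theta> * R - dist r q + (if p = q then 0 else dist i q))"
  proof (cases "p = q")
    case False
    then have pi: "p = i" using p by auto
    show ?thesis unfolding pi
      by (rule walk_le_le[OF walk_le_trans[OF walk_le_sym[OF qi] walk_le_sym[OF L(5)]]]) (use False pi t1 in auto)
  qed (use walk_le_sym[OF L(5)] in simp)
  have Rr: "walk_le ?G p r (\<kappa> * R - 3 * dist r A + 3 * dist k c - dist p k)"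
    by (rule walk_le_le[OF pr]) (use phi kap dist_commute[of p k] in linarith)
  have Qq: "walk_le ?G p x (\<kappa> * R - dist x A + 3 * dist k c - dist p k)" if x: "x \<in> set Q1" for x
  proof (cases "x = i")
    case True
    have pi: "walk_le ?G p i (if p = q then dist q i else 0)"
      using qi p by (auto intro: walk_le_refl0)
    show ?thesis unfolding True
    proof (rule walk_le_le[OF pi], cases "p = q")
      case True
      then have "dist i c \<le> dist k c" "dist p k = dist k q" using p neq t1(9) by auto
      then show "(if p = q then dist q i else 0) \<le> \<kappa> * R - dist i A + 3 * dist k c - dist p k"
        unfolding if_P[OF True] using t1 tri[of i] ec kap thR R by linarith
    next
      case False
      then have "dist p k = dist k i" "dist k i + dist i c \<le> 3 * dist k c" using p t1(8) by auto
      then show "(if p = q then dist q i else 0) \<le> \<kappa> * R - dist i A + 3 * dist k c - dist p k"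
        unfolding if_not_P[OF False] using tri[of i] ec kap thR R zero_le_dist[of i c] by linarith
    qed
  next
    case False
    then have o: "x \<in> S" "2 \<le> K" "walk_le E r x (dist r x + \<theta> * (R/2))" using L(7)[OF x] by auto
    have "\<theta> \<le> 4/3" using theta_le o(2) by simp
    then have "\<theta> * R \<le> 4/3 * R" using R by (intro mult_right_mono) simp_all
    then show ?thesis
      by (intro walk_le_le[OF walk_le_trans[OF pr walk_le_jn(1)[OF o(3)]]])
        (use phi S(3)[OF o(1)] kap dist_commute[of p k] in linarith)
  qed
  let ?H = "joined ?G E'' p k"
  have pX: "p \<in> X \<union> X'" using p mem by blast
  have deg1: "deg ?G x + (if x = p then 1 else 0) \<le> cap r Q1 T x" if "x \<in> X \<union> X'" for x
    using F(9)[OF that] L(8,9) p by (cases "x = p") auto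
  have deg2: "deg E'' y + (if y = k then 1 else 0) \<le> cap r Q1 T y" if y: "y \<in> X''" for y
  proof -
    have "y \<noteq> r" "y \<notin> set Q1" "y \<notin> set T"
      using y disj(2) subsetD[OF F(5)] subsetD[OF F(16)] F(15) by blast+
    then show ?thesis using fresh_deg[OF g2 y] fresh_rep_deg[OF g2] unfolding cap_def
      by (cases "y = k") simp_all
  qed
  have T1: "set T \<subseteq> (X \<union> X') \<union> X''" using F(5) by blast
  have T2: "walk_le ?H r t (dist r t + 8/3 * (if b \<or> b' \<or> b'' then R else R/2))" if "t \<in> set T" for t
    by (rule walk_le_jn(1), rule walk_le_le[OF F(12)[OF that]]) (use R in \<open>cases b; cases b'; cases b''; simp\<close>)
  have B: "b \<or> b' \<longrightarrow> b \<or> b' \<or> b''" "(b \<or> b' \<or> b'') \<or> X'' = S''" using G2(13) by blast+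
  have at: "walk_le ?H x y (\<kappa> * (h x + R - R) + \<kappa> * (h y + R - R))" if "x \<in> X \<union> X'" "y \<in> X''" for x y
    by (rule attach(2)[OF L(2) G2(1) disj(2) pX mem(2) G2(2) light P Rr Qq T1 F(8,6) T2 deg1 deg2 B])
      (assumption | rule that)+
  show ?thesis
  proof (intro exI[of _ ?H] exI[of _ Q1] conjI ballI)
    show "fresh (S \<union> S' \<union> S'') (X \<union> X' \<union> X'') ?H (\<lambda>x. h x + R) A R (b \<or> b' \<or> b'') r Q1 T"
      by (rule attach(1)[OF L(2) G2(1) disj(2) pX mem(2) G2(2) light P Rr Qq T1 F(8,6) T2 deg1 deg2 B])
    show "walk_le ?H x y (\<kappa> * h x + \<kappa> * h y)" if "x \<in> X" "y \<in> X'" for x y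
      by (rule walk_le_jn(1)[OF L(3)[OF that]])
    show "walk_le ?H x y (\<kappa> * h x + \<kappa> * h y)" if "x \<in> X \<union> X'" "y \<in> X''" for x y
      using at[OF that] by simp
  qed blast+
qed


section \<open>Tails\<close>

text \<open>A subtree \<open>Y\<close> that enters the next cell at the corner \<open>B\<close> opposite to the root corner.\<close>

definition is_tail :: "complex set \<Rightarrow> complex set set \<Rightarrow> (complex \<Rightarrow> real) \<Rightarrow> complex \<Rightarrow> complex \<Rightarrow> bool" where
  "is_tail Y F g B \<tau> \<longleftrightarrow> is_tree Y F \<and> \<tau> \<in> Y \<and> (\<forall>y\<in>Y. deg F y \<le> 2 * K + 5) \<and> deg F \<tau> \<le> 2 * K + 3 \<and>
     (\<forall>y\<in>Y. walk_le F y \<tau> (\<kappa> * g y - dist \<tau> B))"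

lemma is_tailD:
  assumes "is_tail Y F g B \<tau>"
  shows "is_tree Y F" "\<tau> \<in> Y" "\<And>y. y \<in> Y \<Longrightarrow> deg F y \<le> 2 * K + 5" "deg F \<tau> \<le> 2 * K + 3"
    "\<And>y. y \<in> Y \<Longrightarrow> walk_le F y \<tau> (\<kappa> * g y - dist \<tau> B)"
  using assms unfolding is_tail_def by blast+

text \<open>A tail is linked to its predecessor if there is one, else to \<open>r\<close>, so
  \<open>r\<close> pays for one tail only. The slack 8/3 is the fixed point of x = 2 + x/4: the walk
  to the predecessor has slack for radius \<open>R/4\<close>, that is \<open>2/3 * R\<close>, and
  going to it and back adds at most \<open>2 * R\<close>.\<close>

lemma attach_tail:
  assumes f: "fresh S X E (\<lambda>x. h x + R) A R b r Q T" and t: "is_tail Y F g B \<tau>"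
    and R: "0 < R" and disj: "X \<inter> Y = {}" and hY: "\<And>y. y \<in> Y \<Longrightarrow> h y = g y + R"
    and T: "\<And>t. t \<in> set T \<Longrightarrow> t \<in> S0 \<and> walk_le E r t (dist r t + 2/3 * R)" and r: "r \<in> S0"
    and rb: "\<And>x. x \<in> X \<Longrightarrow> walk_le E x r (\<kappa> * h x + \<theta> * R + dist r c)"
    and Qb: "\<And>q. q \<in> set Q \<Longrightarrow> walk_le E r q (2 * R + \<theta> * R) \<and> dist q A \<le> 1582/1000 * R"
    and geo: "\<And>t. t \<in> S0 \<Longrightarrow> dist r c + dist r t + dist t B \<le> 10/3 * R"
      "\<And>t. t \<in> S0 \<Longrightarrow> dist r t \<le> R" "\<And>t. t \<in> S0 \<Longrightarrow> dist t B \<le> 1582/1000 * R" "dist r A \<le> 1582/1000 * R"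
  shows "\<exists>G T'. fresh S (X \<union> Y) G (\<lambda>x. h x + R) A R True r Q T' \<and> E \<subseteq> G \<and> F \<subseteq> G \<and>
    (\<forall>x\<in>X. \<forall>y\<in>Y. walk_le G x y (\<kappa> * h x + \<kappa> * h y))"
proof -
  note Fr = freshD[OF f] and Ta = is_tailD[OF t]
  define p where "p = (case T of [] \<Rightarrow> r | t # _ \<Rightarrow> t)"
  have Tcases: "T = [] \<and> p = r \<or> T = [p] \<and> p \<noteq> r \<and> p \<notin> set Q"
    using Fr(6,8) by (cases T) (auto simp: p_def)
  have p: "p \<in> S0" "p \<in> X" using Tcases T[of p] r Fr(15,5) by auto
  have rp: "walk_le E r p (dist r p + 2/3 * R)" using Tcases T[of p] R by (auto intro: walk_le_refl0)
  note pr = walk_le_sym[OF rp]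
  have kap: "\<kappa> * R = 4 * R + \<theta> * R" by (simp add: kappa distrib_right)
  have thR: "0 < \<theta> * R" using theta_pos R by simp
  have pt: "dist p \<tau> \<le> dist p B + dist \<tau> B" by (rule dist_triangle2)
  note gp = geo(1-3)[OF p(1)]
  let ?\<psi> = "\<kappa> * R + dist \<tau> B" and ?G = "joined E F p \<tau>"
  have light: "walk_le F y \<tau> (\<kappa> * (h y + R - R) - ?\<psi>)" if "y \<in> Y" for y
    using Ta(5)[OF that] hY[OF that] by (simp add: distrib_left)
  \<comment> \<open>This uses up \<open>\<kappa> * R\<close>: \<open>\<theta> * R\<close> occurs in
    \<open>rb\<close>, \<open>2/3 * R\<close> is the slack of the walk from \<open>r\<close> to
    \<open>p\<close>, and the first bound of \<open>geo\<close> takes the other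
    \<open>10/3 * R\<close>.\<close>
  have P: "walk_le E x p (\<kappa> * (h x + R - R) + ?\<psi> - dist p \<tau>)" if "x \<in> X" for x
    by (rule walk_le_le[OF walk_le_trans[OF rb[OF that] rp]]) (use gp pt kap in \<open>simp; linarith\<close>)
  have Rr: "walk_le E p r (\<kappa> * R - 3 * dist r A + ?\<psi> - dist p \<tau>)"
    by (rule walk_le_le[OF pr]) (use gp pt kap thR R geo(4) in linarith)
  have Qq: "walk_le E p q (\<kappa> * R - dist q A + ?\<psi> - dist p \<tau>)" if "q \<in> set Q" for q
    by (rule walk_le_le[OF walk_le_trans[OF pr conjunct1[OF Qb[OF that]]]])
      (use conjunct2[OF Qb[OF that]] gp pt kap thR R in linarith)
  have nX: "\<tau> \<notin> X" "\<tau> \<noteq> r" "\<tau> \<notin> set Q" using Ta(2) disj Fr(15,16) by blast+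
  have T1: "set [\<tau>] \<subseteq> X \<union> Y" "length [\<tau>] \<le> 1" "distinct (r # Q @ [\<tau>])"
    using nX Ta(2) Fr(6) by auto
  have T2: "walk_le ?G r t (dist r t + 8/3 * (if True then R else R/2))" if "t \<in> set [\<tau>]" for t
  proof -
    have "t = \<tau>" using that by simp
    moreover have "walk_le ?G r \<tau> (dist r \<tau> + 8/3 * R)"
      by (rule walk_le_cross(1)[OF rp walk_le.refl[OF order_refl]])
        (use gp dist_triangle[of p \<tau> r] dist_commute[of p r] in linarith)
    ultimately show ?thesis by simp
  qed
  have deg1: "deg E x + (if x = p then 1 else 0) \<le> cap r Q [\<tau>] x" if x: "x \<in> X" for x
  proof -
    have xt: "x \<noteq> \<tau>" using x nX by blast
    from Tcases show ?thesis
    proof (elim disjE conjE)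
      assume "T = []" "p = r"
      then show ?thesis using Fr(9)[OF x] xt by (cases "x = r"; cases "x \<in> set Q") (simp_all add: cap_def)
    next
      assume "T = [p]" "p \<noteq> r" "p \<notin> set Q"
      then show ?thesis using Fr(9)[OF x] xt
        by (cases "x = r"; cases "x \<in> set Q"; cases "x = p") (simp_all add: cap_def)
    qed
  qed
  have deg2: "deg F y + (if y = \<tau> then 1 else 0) \<le> cap r Q [\<tau>] y" if y: "y \<in> Y" for y
  proof -
    have "y \<noteq> r" "y \<notin> set Q" using y disj Fr(15,16) by blast+
    then show ?thesis using Ta(3)[OF y] Ta(4) by (cases "y = \<tau>") (simp_all add: cap_def)
  qed
  have B: "b \<longrightarrow> True" "True \<or> Y = {}" by auto
  have at1: "fresh (S \<union> {}) (X \<union> Y) ?G (\<lambda>x. h x + R) A R True r Q [\<tau>]"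
    by (rule attach(1)[OF f Ta(1) disj p(2) Ta(2) empty_subsetI light P Rr Qq T1 T2 deg1 deg2 B])
  have at2: "walk_le ?G x y (\<kappa> * (h x + R - R) + \<kappa> * (h y + R - R))" if "x \<in> X" "y \<in> Y" for x y
    by (rule attach(2)[OF f Ta(1) disj p(2) Ta(2) empty_subsetI light P Rr Qq T1 T2 deg1 deg2 B])
      (assumption | rule that)+
  show ?thesis
  proof (intro exI[of _ ?G] exI[of _ "[\<tau>]"] conjI ballI)
    show "fresh S (X \<union> Y) ?G (\<lambda>x. h x + R) A R True r Q [\<tau>]" using at1 by simp
    show "walk_le ?G x y (\<kappa> * h x + \<kappa> * h y)" if "x \<in> X" "y \<in> Y" for x y using at2[OF that] by simp
  qed blast+
qed

text \<open>Merging at a centre \<open>c\<close> whose root-side cell is occupied: the hub, the representative closest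
  to \<open>c\<close>, takes all edges itself, since it becomes a tail and is never a hub again.\<close>

definition hub_tree :: "complex set \<Rightarrow> complex set set \<Rightarrow> complex \<Rightarrow> nat \<Rightarrow> (complex \<Rightarrow> real) \<Rightarrow> complex \<Rightarrow> bool" where
  "hub_tree X E z n h c \<longleftrightarrow> is_tree X E \<and> z \<in> X \<and> (\<forall>x\<in>X. deg E x \<le> 2 * K + 5) \<and> deg E z \<le> 2 * K + 1 + n \<and>
     (\<forall>x\<in>X. walk_le E x z (\<kappa> * h x - dist z c))"

lemma hub_treeD:
  assumes "hub_tree X E z n h c"
  shows "is_tree X E" "z \<in> X" "\<And>x. x \<in> X \<Longrightarrow> deg E x \<le> 2 * K + 5" "deg E z \<le> 2 * K + 1 + n"
    "\<And>x. x \<in> X \<Longrightarrow> walk_le E x z (\<kappa> * h x - dist z c)"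
  using assms unfolding hub_tree_def by blast+

lemma hub_tree_fresh:
  assumes "fresh S X E h c R b r Q T"
  shows "hub_tree X E r 0 h c"
  unfolding hub_tree_def
proof (intro conjI ballI)
  show "walk_le E x r (\<kappa> * h x - dist r c)" if "x \<in> X" for x
    by (rule walk_le_le[OF freshD(14)[OF assms that]]) simp
  show "deg E r \<le> 2 * K + 1 + 0" using fresh_rep_deg[OF assms] by simp
qed (use freshD(1,15)[OF assms] fresh_deg[OF assms] in auto)

lemma hub_tree_tailst: "hub_tree X E z n h c \<Longrightarrow> n \<le> 2 \<Longrightarrow> is_tail X E h c z"
  unfolding hub_tree_def is_tail_def by auto

lemma hub_tree_add:
  assumes m: "hub_tree X E z n h c" and n: "n \<le> 1" and Z: "is_tree Y F" "X \<inter> Y = {}" "k \<in> Y"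
    and deg: "\<And>y. y \<in> Y \<Longrightarrow> deg F y + (if y = k then 1 else 0) \<le> 2 * K + 5"
    and light: "\<And>y. y \<in> Y \<Longrightarrow> walk_le F y k (\<kappa> * h y - \<psi>)" and psi: "dist z k + dist z c \<le> \<psi>"
  shows "hub_tree (X \<union> Y) (joined E F z k) z (Suc n) h c"
    "\<And>x y. x \<in> X \<Longrightarrow> y \<in> Y \<Longrightarrow> walk_le (joined E F z k) x y (\<kappa> * h x + \<kappa> * h y)"
proof -
  note M = hub_treeD[OF m]
  let ?G = "joined E F z k"
  have d: "deg ?G x \<le> 2 * K + 5 \<and> (x = z \<longrightarrow> deg ?G x \<le> 2 * K + 1 + Suc n)" if "x \<in> X \<union> Y" for x
  proof (cases "x \<in> X")
    case True
    then show ?thesis using deg_join(1)[OF M(1) Z(1,2) M(2) Z(3) True] M(3)[OF True] M(4) n by auto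
  next
    case False
    then have "x \<in> Y" "x \<noteq> z" using that M(2) by auto
    then show ?thesis using deg_join(2)[OF M(1) Z(1,2) M(2) Z(3), of x] deg[of x] by auto
  qed
  show "hub_tree (X \<union> Y) ?G z (Suc n) h c"
    unfolding hub_tree_def
  proof (intro conjI ballI)
    show "is_tree (X \<union> Y) ?G" using M(1) Z M(2) by (intro is_tree.join)
    show "deg ?G x \<le> 2 * K + 5" if "x \<in> X \<union> Y" for x using d[OF that] by blast
    show "z \<in> X \<union> Y" using M(2) by blast
    then show "deg ?G z \<le> 2 * K + 1 + Suc n" using d by blast
    show "walk_le ?G x z (\<kappa> * h x - dist z c)" if x: "x \<in> X \<union> Y" for x
    proof (cases "x \<in> X")
      case True
      show ?thesis by (rule walk_le_jn(1)[OF M(5)[OF True]])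
    next
      case False
      then have y: "x \<in> Y" using x by blast
      show ?thesis
        by (rule walk_le_cross(2)[OF walk_le.refl[OF order_refl] light[OF y]]) (use psi in linarith)
    qed
  qed
  show "walk_le ?G x y (\<kappa> * h x + \<kappa> * h y)" if "x \<in> X" "y \<in> Y" for x y
    by (rule walk_le_cross(1)[OF M(5)[OF that(1)] light[OF that(2)]]) (use psi zero_le_dist[of z c] in linarith)
qed

text \<open>As \<open>z\<close> is closest to \<open>c\<close>, the edge and the remaining distance
  satisfy \<open>dist z k + dist z c \<le> 2 * dist z c + dist k c\<close>, which the credit
  \<open>3 * dist k c\<close> covers.\<close>

lemma hub_tree_add_fresh:
  assumes m: "hub_tree X E z n h c" "n \<le> 1" "X \<inter> Y = {}" and f: "fresh S Y F h c R b k Q T"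
    and z: "dist z c \<le> dist k c"
  shows "hub_tree (X \<union> Y) (joined E F z k) z (Suc n) h c"
    "\<And>x y. x \<in> X \<Longrightarrow> y \<in> Y \<Longrightarrow> walk_le (joined E F z k) x y (\<kappa> * h x + \<kappa> * h y)"
proof -
  have d: "deg F y + (if y = k then 1 else 0) \<le> 2 * K + 5" if "y \<in> Y" for y
    using fresh_deg[OF f that] fresh_rep_deg[OF f] by auto
  have psi: "dist z k + dist z c \<le> 3 * dist k c" using z dist_triangle2[of z k c] by linarith
  show "hub_tree (X \<union> Y) (joined E F z k) z (Suc n) h c"
    by (rule hub_tree_add(1)[OF m(1,2) freshD(1)[OF f] m(3) freshD(15)[OF f] d freshD(14)[OF f] psi])
  show "walk_le (joined E F z k) x y (\<kappa> * h x + \<kappa> * h y)" if "x \<in> X" "y \<in> Y" for x y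
    by (rule hub_tree_add(2)[OF m(1,2) freshD(1)[OF f] m(3) freshD(15)[OF f] d freshD(14)[OF f] psi])
      (assumption | rule that)+
qed

lemma hub_tree_add_tail:
  assumes m: "hub_tree X E z n h c" "n \<le> 1" "X \<inter> Y = {}" and t: "is_tail Y F g B \<tau>"
    and R: "0 < R" "dist z c \<le> R" "dist c B = R" and h: "\<And>y. y \<in> Y \<Longrightarrow> h y = g y + R"
  shows "hub_tree (X \<union> Y) (joined E F z \<tau>) z (Suc n) h c"
    "\<And>x y. x \<in> X \<Longrightarrow> y \<in> Y \<Longrightarrow> walk_le (joined E F z \<tau>) x y (\<kappa> * h x + \<kappa> * h y)"
proof -
  note Ta = is_tailD[OF t]
  have d: "deg F y + (if y = \<tau> then 1 else 0) \<le> 2 * K + 5" if "y \<in> Y" for y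
    using Ta(3)[OF that] Ta(4) by auto
  have light: "walk_le F y \<tau> (\<kappa> * h y - (\<kappa> * R + dist \<tau> B))" if "y \<in> Y" for y
    using Ta(5)[OF that] h[OF that] by (simp add: distrib_left)
  have "4 * R \<le> \<kappa> * R" using R theta_pos by (simp add: kappa)
  then have psi: "dist z \<tau> + dist z c \<le> \<kappa> * R + dist \<tau> B"
    using dist_triangle2[of z \<tau> B] dist_triangle[of z B c] R by linarith
  show "hub_tree (X \<union> Y) (joined E F z \<tau>) z (Suc n) h c"
    by (rule hub_tree_add(1)[OF m(1,2) Ta(1) m(3) Ta(2) d light psi])
  show "walk_le (joined E F z \<tau>) x y (\<kappa> * h x + \<kappa> * h y)" if "x \<in> X" "y \<in> Y" for x y
    by (rule hub_tree_add(2)[OF m(1,2) Ta(1) m(3) Ta(2) d light psi]) (assumption | rule that)+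
qed

text \<open>For a tail that meets no other subtree at \<open>c\<close> and travels on: the credit
  needed grows by at most \<open>R\<close>, and \<open>\<kappa> * R\<close> is gained.\<close>

lemma is_tail_shift:
  assumes t: "is_tail Y F g B \<tau>" and R: "0 < R" "dist c B = R" and h: "\<And>y. y \<in> Y \<Longrightarrow> h y = g y + R"
  shows "is_tail Y F h c \<tau>"
  unfolding is_tail_def
proof (intro conjI ballI)
  have kap: "4 * R \<le> \<kappa> * R" using R theta_pos by (simp add: kappa)
  have tri: "dist \<tau> c \<le> dist \<tau> B + R" using dist_triangle[of \<tau> c B] R(2) dist_commute[of c B] by linarith
  show "walk_le F y \<tau> (\<kappa> * h y - dist \<tau> c)" if "y \<in> Y" for y
  proof (rule walk_le_le[OF is_tailD(5)[OF t that]])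
    have "\<kappa> * h y = \<kappa> * g y + \<kappa> * R" by (simp add: h[OF that] distrib_left)
    then show "\<kappa> * g y - dist \<tau> B \<le> \<kappa> * h y - dist \<tau> c" using kap tri R(1) by linarith
  qed
qed (use is_tailD[OF t] in auto)

end

lemma dist_corner: "w \<in> units \<Longrightarrow> 0 \<le> R \<Longrightarrow> dist c (c + complex_of_real R * w) = R"
  "w \<in> units \<Longrightarrow> 0 \<le> R \<Longrightarrow> dist c (c - complex_of_real R * w) = R"
  by (simp_all add: dist_norm norm_mult unit_simps)

lemma units_distinct:
  assumes "w \<in> units"
  shows "- w \<noteq> w" "\<i> * w \<noteq> w" "- \<i> * w \<noteq> w" "- w \<noteq> \<i> * w" "- w \<noteq> - \<i> * w" "\<i> * w \<noteq> - \<i> * w"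
  using assms by (auto simp: units_def complex_eq_iff)

context scheme begin

lemma fresh_queue_dl:
  assumes f: "fresh S X E h c \<rho> b r Q T" and q: "q \<in> set Q"
  shows "walk_le E r q (dist r q + \<theta> * \<rho>)"
proof -
  obtain s where s: "0 \<le> s" "s \<le> \<rho>" "\<forall>j<length Q. dist r (Q ! j) \<le> 2 * s / 2 ^ (length Q - 1 - j) \<and>
       walk_le E r (Q ! j) (dist r (Q ! j) + \<theta> * s / 2 ^ (length Q - 1 - j))"
    using freshD(10)[OF f] by blast
  have "\<exists>j<length Q. Q ! j = q" using q by (simp add: in_set_conv_nth)
  then obtain j where j: "j < length Q" "Q ! j = q" by (elim exE conjE)
  have "\<theta> * s / 2 ^ (length Q - 1 - j) \<le> \<theta> * s / 1"
    using s(1) theta_pos by (intro divide_left_mono) auto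
  also have "\<dots> \<le> \<theta> * \<rho>" using s(2) theta_pos by simp
  finally have "dist r q + \<theta> * s / 2 ^ (length Q - 1 - j) \<le> dist r q + \<theta> * \<rho>" by simp
  moreover have "walk_le E r q (dist r q + \<theta> * s / 2 ^ (length Q - 1 - j))"
    using s(3)[rule_format, OF j(1)] by (simp only: j(2))
  ultimately show ?thesis using walk_le_le by blast
qed

end

section \<open>One merge at the centre of a cell\<close>

text \<open>The quarter at \<open>w\<close> has no subtree here, as it is either empty or treated
  after the merge. A tail arriving at the corner opposite to the root has been absorbed by the
  quarter \<open>- w\<close> if that is occupied, which explains its occurrence in
  \<open>blob\<close> and the assumption on \<open>F\<close>; otherwise it is a participant of its
  own.\<close>

locale centre = scheme K \<theta> \<kappa> for K \<theta> \<kappa> +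
  fixes c :: complex and R :: real and w :: complex and S Y :: "complex set" and F :: "complex set set"
    and g h :: "complex \<Rightarrow> real" and \<tau> :: complex
    and E :: "complex \<Rightarrow> complex set set" and r :: "complex \<Rightarrow> complex" and Q T :: "complex \<Rightarrow> complex list"
  assumes R: "0 < R" and w: "w \<in> units" and S: "S \<subseteq> cell c R" and SY: "S \<inter> Y = {}"
    and tail: "Y \<noteq> {} \<Longrightarrow> is_tail Y F g (c - complex_of_real R * w) \<tau>" and noF: "Y = {} \<Longrightarrow> F = {}"
    and hY: "\<And>y. y \<in> Y \<Longrightarrow> h y = g y + R"
    and blob: "\<And>v. v \<in> units \<Longrightarrow> v \<noteq> w \<Longrightarrow> {x \<in> S. dir (x - c) = v} \<noteq> {} \<Longrightarrow>
      fresh {x \<in> S. dir (x - c) = v} ({x \<in> S. dir (x - c) = v} \<union> (if v = - w then Y else {})) (E v) h c (R/2)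
        (v = - w \<and> Y \<noteq> {}) (r v) (Q v) (T v)"
    and FE: "{x \<in> S. dir (x - c) = - w} \<noteq> {} \<Longrightarrow> F \<subseteq> E (- w)"
begin

definition "sect v = {x \<in> S. dir (x - c) = v}"
definition "X v = sect v \<union> (if v = - w then Y else {})"
definition "parts = {v \<in> units. v \<noteq> w \<and> sect v \<noteq> {}}"
definition "A = c + complex_of_real R * w"
definition "B = c - complex_of_real R * w"

text \<open>The participant that a point belongs to; \<open>0\<close> stands for a tail that passes the cell at \<open>- w\<close>.\<close>

definition "owner x = (if x \<in> S then dir (x - c) else if sect (- w) = {} then 0 else - w)"

text \<open>Points of different participants part at \<open>c\<close> in the Steiner tree, so the
  sum of their distances to \<open>c\<close> is the length to compare with.\<close>

definition "cross G Z \<longleftrightarrow> (\<forall>x\<in>Z. \<forall>y\<in>Z. owner x \<noteq> owner y \<longrightarrow> walk_le G x y (\<kappa> * h x + \<kappa> * h y))"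

lemma part_fresh: "v \<in> parts \<Longrightarrow> fresh (sect v) (X v) (E v) h c (R/2) (v = - w \<and> Y \<noteq> {}) (r v) (Q v) (T v)"
  unfolding parts_def X_def sect_def by (rule blob) auto

lemma dcA: "dist c A = R" and dcB: "dist c B = R"
  using dist_corner[OF w, of R c] R by (simp_all add: A_def B_def)

lemma sect_cell: "x \<in> sect v \<Longrightarrow> x \<in> cell c R \<and> dir (x - c) = v \<and> x \<in> S"
  using S by (auto simp: sect_def)

lemma sect_dist: "x \<in> sect v \<Longrightarrow> dist x c \<le> R" "x \<in> sect v \<Longrightarrow> y \<in> sect v \<Longrightarrow> dist x y \<le> R"
  using sect_cell[of x v] sect_cell[of y v] dist_centre dist_sub_cell by auto

lemma rS: "v \<in> parts \<Longrightarrow> r v \<in> sect v"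
  using freshD(3)[OF part_fresh] .

lemma X_disj: "v \<noteq> u \<Longrightarrow> X v \<inter> X u = {}"
  using SY by (auto simp: X_def sect_def)

lemma owner_X: "v \<in> parts \<Longrightarrow> x \<in> X v \<Longrightarrow> owner x = v"
  using SY by (auto simp: X_def sect_def owner_def parts_def split: if_splits)

lemma owner_Y: "sect (- w) = {} \<Longrightarrow> y \<in> Y \<Longrightarrow> owner y = 0"
  using SY by (auto simp: owner_def)

lemma parts_nz: "v \<in> parts \<Longrightarrow> v \<noteq> 0 \<and> v \<in> units \<and> v \<noteq> w"
  using unit_simps by (auto simp: parts_def)

lemma target_path:
  assumes "v \<in> parts" "x \<in> sect v"
  shows "min (dist (r v) c) (4 * R - 3 * dist (r v) A) + dist (r v) x + dist x A \<le> 10/3 * R"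
  unfolding A_def
  using sect_cell[OF rS[OF assms(1)]] sect_cell[OF assms(2)] parts_nz[OF assms(1)]
  by (intro queue_path[OF R w]) auto

lemma light_step:
  assumes v: "v \<in> parts" "u \<in> parts" "v \<noteq> u"
    and cost: "dist (r u) (r v) - 3 * dist (r u) c + 3 * dist (r v) A \<le> 4 * R"
  shows "\<exists>q Q1. light_at (sect v) (X v) (E v) (sect u) (X u) (E u) h c A R (v = - w \<and> Y \<noteq> {}) (u = - w \<and> Y \<noteq> {})
    (r v) (r u) (T v) q Q1"
proof (rule attach_light[OF part_fresh[OF v(1)] part_fresh[OF v(2)] R X_disj[OF v(3)] dcA cost])
  show "dist x c \<le> R" if "x \<in> sect v \<union> sect u" for x using that sect_dist(1) by blast
  show "dist x y \<le> R" if "x \<in> sect v" "y \<in> sect v" for x y using sect_dist(2)[OF that] .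
  show "min (dist (r v) c) (4 * R - 3 * dist (r v) A) + dist (r v) x + dist x A \<le> 10/3 * R"
    if "x \<in> sect v" for x using target_path[OF v(1) that] .
qed

lemma two_lights_step:
  assumes v: "v \<in> parts" "u \<in> parts" "z \<in> parts" "v \<noteq> u" "v \<noteq> z" "u \<noteq> z"
    and ok: "merge_ok c R w (r v) (r u) (r z)"
  shows "\<exists>G Q1. fresh (sect v \<union> sect u \<union> sect z) (X v \<union> X u \<union> X z) G (\<lambda>x. h x + R) A R
      ((v = - w \<and> Y \<noteq> {}) \<or> (u = - w \<and> Y \<noteq> {}) \<or> (z = - w \<and> Y \<noteq> {})) (r v) Q1 (T v) \<and>
     E v \<subseteq> G \<and> E u \<subseteq> G \<and> E z \<subseteq> G \<and>
     (\<forall>x\<in>X v. \<forall>y\<in>X u. walk_le G x y (\<kappa> * h x + \<kappa> * h y)) \<and>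
     (\<forall>x\<in>X v \<union> X u. \<forall>y\<in>X z. walk_le G x y (\<kappa> * h x + \<kappa> * h y))"
proof (rule attach_two_lights[OF part_fresh[OF v(1)] part_fresh[OF v(2)] part_fresh[OF v(3)] R X_disj[OF v(4)] _ dcA])
  show "(X v \<union> X u) \<inter> X z = {}" using X_disj[OF v(5)] X_disj[OF v(6)] by blast
  show "dist (r u) (r v) - 3 * dist (r u) c + 3 * dist (r v) A \<le> 4 * R"
    using ok by (simp add: merge_ok_def A_def)
  have "q \<in> cell c R \<and> dir (q - c) = dir (r v - c)" if "q \<in> sect v" for q
    using sect_cell[OF that] sect_cell[OF rS[OF v(1)]] by simp
  then show "dist (r u) c \<le> dist (r z) c \<and> dist (r z) (r v) - 3 * dist (r z) c + 3 * dist (r v) A \<le> 4 * R \<and>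
      (\<forall>q\<in>sect v. dist (r u) q + dist (r z) q \<le> 3 * dist (r u) c + 3 * dist (r z) c) \<or>
    dist (r z) (r u) + dist (r u) c \<le> 3 * dist (r z) c \<and>
      dist (r z) (r u) + dist (r u) (r v) - 3 * dist (r z) c + 3 * dist (r v) A \<le> 4 * R"
    using ok unfolding merge_ok_def A_def by meson
  show "dist x c \<le> R" if "x \<in> sect v \<union> sect u \<union> sect z" for x using that sect_dist(1) by blast
  show "dist x y \<le> R" if "x \<in> sect v" "y \<in> sect v" for x y using sect_dist(2)[OF that] .
  show "min (dist (r v) c) (4 * R - 3 * dist (r v) A) + dist (r v) x + dist x A \<le> 10/3 * R"
    if "x \<in> sect v" for x using target_path[OF v(1) that] .
qed

lemma tail_step:
  assumes v: "v \<in> parts" "v \<noteq> - w" and Y: "Y \<noteq> {}"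
    and f: "fresh S0 X0 G (\<lambda>x. h x + R) A R False (r v) Q1 (T v)" and G: "E v \<subseteq> G" "X0 \<inter> Y = {}"
    and S0: "\<And>x. x \<in> S0 \<Longrightarrow> x \<in> S \<and> dir (x - c) \<noteq> w \<and> dir (x - c) \<noteq> - w"
    and rb: "\<And>x. x \<in> X0 \<Longrightarrow> walk_le G x (r v) (\<kappa> * h x + \<theta> * R + dist (r v) c)"
    and Qb: "\<And>q. q \<in> set Q1 \<Longrightarrow> walk_le G (r v) q (2 * R + \<theta> * R)"
  shows "\<exists>G' T'. fresh S0 (X0 \<union> Y) G' (\<lambda>x. h x + R) A R True (r v) Q1 T' \<and> G \<subseteq> G' \<and> F \<subseteq> G' \<and>
    (\<forall>x\<in>X0. \<forall>y\<in>Y. walk_le G' x y (\<kappa> * h x + \<kappa> * h y))"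
proof (rule attach_tail[OF f tail[OF Y] R G(2) hY _ rS[OF v(1)] rb])
  note b = part_fresh[OF v(1)]
  have X: "X v = sect v" using v(2) by (simp add: X_def)
  have rv: "r v \<in> cell c R" "dir (r v - c) = v" using sect_cell[OF rS[OF v(1)]] by auto
  have vw: "v \<noteq> w" using parts_nz[OF v(1)] by simp
  show "t \<in> sect v \<and> walk_le G (r v) t (dist (r v) t + 2/3 * R)" if "t \<in> set (T v)" for t
    using that freshD(5)[OF b] X walk_le_mono[OF freshD(12)[OF b that] G(1)] v(2) by auto
  show "walk_le G (r v) q (2 * R + \<theta> * R) \<and> dist q A \<le> 1582/1000 * R" if "q \<in> set Q1" for q
    unfolding A_def
    using Qb[OF that] S0[of q] freshD(4)[OF f] that S side_bounds(1)[OF R w, of q c] by blast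
  show "dist (r v) c + dist (r v) t + dist t (c - complex_of_real R * w) \<le> 10/3 * R" if "t \<in> sect v" for t
    using sect_cell[OF that] rv vw v(2) by (intro tail_path[OF R w]) auto
  show "dist (r v) t \<le> R" if "t \<in> sect v" for t using sect_dist(2)[OF rS[OF v(1)] that] .
  show "dist t (c - complex_of_real R * w) \<le> 1582/1000 * R" if "t \<in> sect v" for t
    using sect_cell[OF that] vw v(2) by (intro side_bounds[OF R w]) auto
  show "dist (r v) A \<le> 1582/1000 * R" unfolding A_def
    using rv vw v(2) by (intro side_bounds[OF R w]) auto
qed


lemma cross_owner: "(\<And>x. x \<in> Z \<Longrightarrow> owner x = u) \<Longrightarrow> cross G Z"
  by (simp add: cross_def)

lemma cross_add:
  assumes c: "cross G Z" and G: "G \<subseteq> G'" and u: "\<And>y. y \<in> Z' \<Longrightarrow> owner y = u"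
    and d: "\<And>x y. x \<in> Z \<Longrightarrow> y \<in> Z' \<Longrightarrow> walk_le G' x y (\<kappa> * h x + \<kappa> * h y)"
  shows "cross G' (Z \<union> Z')"
  unfolding cross_def
proof (intro ballI impI)
  fix x y assume xy: "x \<in> Z \<union> Z'" "y \<in> Z \<union> Z'" and o: "owner x \<noteq> owner y"
  consider "x \<in> Z" "y \<in> Z" | "x \<in> Z" "y \<in> Z'" | "x \<in> Z'" "y \<in> Z" | "x \<in> Z'" "y \<in> Z'"
    using xy by blast
  then show "walk_le G' x y (\<kappa> * h x + \<kappa> * h y)"
  proof cases
    case 1 then show ?thesis using c o walk_le_mono[OF _ G] by (simp add: cross_def)
  next
    case 2 then show ?thesis by (rule d)
  next
    case 3
    show ?thesis using walk_le_sym[OF d[OF 3(2,1)]] by (simp only: add.commute)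
  next
    case 4 then show ?thesis using u o by simp
  qed
qed

lemma parts_sub: "parts \<subseteq> {- w, \<i> * w, - \<i> * w}"
  using w by (auto simp: parts_def units_def)

lemma in_parts: "u \<in> units \<Longrightarrow> u \<noteq> w \<Longrightarrow> u \<in> parts \<longleftrightarrow> sect u \<noteq> {}"
  by (simp add: parts_def)

lemma mw_parts: "- w \<in> parts \<longleftrightarrow> sect (- w) \<noteq> {}"
  using in_parts[of "- w"] w units_distinct(1)[OF w] by simp

lemma S_parts: "S = sect w \<union> (\<Union>u\<in>parts. sect u)"
proof -
  have "x \<in> sect w \<union> (\<Union>u\<in>parts. sect u)" if "x \<in> S" for x
    using that dir_units[of "x - c"] by (auto simp: sect_def parts_def)
  then show ?thesis by (auto simp: sect_def)
qed

lemma sect_disj: "u \<noteq> v \<Longrightarrow> sect u \<inter> sect v = {}"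
  by (auto simp: sect_def)

lemma S_minus: "S - sect w = (\<Union>u\<in>parts. sect u)"
proof -
  have "sect w \<inter> sect u = {}" if "u \<in> parts" for u
    using that parts_nz by (intro sect_disj) auto
  then show ?thesis using S_parts by blast
qed

lemma UX: "(\<Union>u\<in>parts. X u) = (\<Union>u\<in>parts. sect u) \<union> (if - w \<in> parts then Y else {})"
  by (auto simp: X_def split: if_splits)

text \<open>A tail is still outstanding only if the quarter \<open>- w\<close> is empty, and then it
  is attached last. The bounds on walks to \<open>r v\<close> and to the queue are required only
  then, when at most two quarters are occupied.\<close>

lemma finish:
  assumes v: "v \<in> parts" and sw: "sect w = {}"
    and f: "fresh S (\<Union>u\<in>parts. X u) G (\<lambda>x. h x + R) A R (- w \<in> parts \<and> Y \<noteq> {}) (r v) Q1 (T v)"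
    and G: "\<And>u. u \<in> parts \<Longrightarrow> E u \<subseteq> G" and cr: "cross G (\<Union>u\<in>parts. X u)"
    and rb: "\<And>x. - w \<notin> parts \<Longrightarrow> x \<in> (\<Union>u\<in>parts. X u) \<Longrightarrow> walk_le G x (r v) (\<kappa> * h x + \<theta> * R + dist (r v) c)"
    and Qb: "\<And>q. - w \<notin> parts \<Longrightarrow> q \<in> set Q1 \<Longrightarrow> walk_le G (r v) q (2 * R + \<theta> * R)"
  shows "\<exists>G r' Q' T'. fresh S (S \<union> Y) G (\<lambda>x. h x + R) A R (Y \<noteq> {}) r' Q' T' \<and>
    (\<forall>u\<in>parts. E u \<subseteq> G) \<and> F \<subseteq> G \<and> cross G (S \<union> Y)"
proof (cases "- w \<in> parts \<or> Y = {}")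
  case True
  have SY': "(\<Union>u\<in>parts. X u) = S \<union> Y" using True S_parts sw by (auto simp: UX)
  have b: "(- w \<in> parts \<and> Y \<noteq> {}) = (Y \<noteq> {})" using True by blast
  have "F \<subseteq> G"
  proof (cases "Y = {}")
    case False
    then have mw: "- w \<in> parts" using True by blast
    then show ?thesis using FE G[OF mw] mw_parts by (simp add: sect_def)
  qed (simp add: noF)
  then show ?thesis using f[unfolded SY' b] cr[unfolded SY'] G by blast
next
  case False
  then have nw: "- w \<notin> parts" and Y: "Y \<noteq> {}" by blast+
  have US: "(\<Union>u\<in>parts. X u) = S" using nw S_parts sw by (auto simp: UX)
  have b: "(- w \<in> parts \<and> Y \<noteq> {}) = False" using nw by blast
  have vw: "v \<noteq> - w" using v nw by blast
  have sm: "sect (- w) = {}" using nw mw_parts by blast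
  have S0: "x \<in> S \<and> dir (x - c) \<noteq> w \<and> dir (x - c) \<noteq> - w" if "x \<in> S" for x
    using that sw sm by (auto simp: sect_def)
  obtain G' T' where G': "fresh S (S \<union> Y) G' (\<lambda>x. h x + R) A R True (r v) Q1 T'" "G \<subseteq> G'" "F \<subseteq> G'"
    "\<And>x y. x \<in> S \<Longrightarrow> y \<in> Y \<Longrightarrow> walk_le G' x y (\<kappa> * h x + \<kappa> * h y)"
    using tail_step[OF v vw Y f[unfolded US b] G[OF v] SY S0 rb[OF nw, unfolded US] Qb[OF nw]] by blast
  have "cross G' (S \<union> Y)"
    using cross_add[OF cr[unfolded US] G'(2) owner_Y[OF sm] G'(4)] by blast
  then show ?thesis using G'(1-3) G Y by (intro exI[of _ G'] exI[of _ "r v"] exI[of _ Q1] exI[of _ T']) auto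
qed

lemma one_part:
  assumes p: "parts = {v}" and sw: "sect w = {}"
  shows "\<exists>G r' Q' T'. fresh S (S \<union> Y) G (\<lambda>x. h x + R) A R (Y \<noteq> {}) r' Q' T' \<and>
    (\<forall>u\<in>parts. E u \<subseteq> G) \<and> F \<subseteq> G \<and> cross G (S \<union> Y)"
proof (rule finish[OF _ sw])
  show v: "v \<in> parts" using p by simp
  have Sv: "sect v = S" using S_parts sw p by simp
  have Xv: "(\<Union>u\<in>parts. X u) = X v" by (simp add: p)
  have b: "(- w \<in> parts \<and> Y \<noteq> {}) = (v = - w \<and> Y \<noteq> {})" using p by auto
  show "fresh S (\<Union>u\<in>parts. X u) (E v) (\<lambda>x. h x + R) A R (- w \<in> parts \<and> Y \<noteq> {}) (r v) (Q v) (T v)"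
    unfolding b Xv using fresh_lift[OF part_fresh[OF v] R dcA imp_refl] by (simp only: Sv)
  show "E u \<subseteq> E v" if "u \<in> parts" for u using that p by simp
  show "cross (E v) (\<Union>u\<in>parts. X u)" by (rule cross_owner[of _ v]) (use owner_X[OF v] p in simp)
  have tR: "0 < \<theta> * R" using theta_pos R by simp
  show "walk_le (E v) x (r v) (\<kappa> * h x + \<theta> * R + dist (r v) c)" if "x \<in> (\<Union>u\<in>parts. X u)" for x
  proof -
    have x: "x \<in> X v" using that p by simp
    show ?thesis by (rule walk_le_le[OF freshD(14)[OF part_fresh[OF v] x]]) (use tR zero_le_dist[of "r v" c] in linarith)
  qed
  show "walk_le (E v) (r v) q (2 * R + \<theta> * R)" if "q \<in> set (Q v)" for q
  proof (rule walk_le_le[OF fresh_queue_dl[OF part_fresh[OF v] that]])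
    have "q \<in> sect v" using freshD(4)[OF part_fresh[OF v]] that by blast
    then have "dist (r v) q \<le> R" using sect_dist(2)[OF rS[OF v]] by blast
    then show "dist (r v) q + \<theta> * (R/2) \<le> 2 * R + \<theta> * R" using R tR by simp
  qed
qed

lemma two_parts:
  assumes p: "parts = {v, u}" "v \<noteq> u" and sw: "sect w = {}"
    and cost: "dist (r u) (r v) - 3 * dist (r u) c + 3 * dist (r v) A \<le> 4 * R"
  shows "\<exists>G r' Q' T'. fresh S (S \<union> Y) G (\<lambda>x. h x + R) A R (Y \<noteq> {}) r' Q' T' \<and>
    (\<forall>u\<in>parts. E u \<subseteq> G) \<and> F \<subseteq> G \<and> cross G (S \<union> Y)"
proof -
  have v: "v \<in> parts" and u: "u \<in> parts" using p by auto
  obtain q Q1 where "light_at (sect v) (X v) (E v) (sect u) (X u) (E u) h c A R (v = - w \<and> Y \<noteq> {}) (u = - w \<and> Y \<noteq> {})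
    (r v) (r u) (T v) q Q1" using light_step[OF v u p(2) cost] by blast
  note L = light_atD[OF this]
  let ?G = "joined (E v) (E u) q (r u)"
  have Sv: "sect v \<union> sect u = S" using S_parts sw p by simp
  have Xv: "(\<Union>u\<in>parts. X u) = X v \<union> X u" by (simp add: p)
  have b: "(- w \<in> parts \<and> Y \<noteq> {}) = ((v = - w \<and> Y \<noteq> {}) \<or> (u = - w \<and> Y \<noteq> {}))" using p by auto
  have tR: "0 < \<theta> * R" using theta_pos R by simp
  have e: "dist (r u) c \<le> R" "dist (r v) c \<le> R" using rS[OF u] rS[OF v] sect_dist(1) by blast+
  have qi: "dist q (r u) \<le> dist (r u) c + dist (r v) c + dist (r v) q"
    using dist_triangle2[of "r u" "r v" c] dist_triangle[of q "r u" "r v"]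
    by (simp add: dist_commute)
  have ed: "walk_le ?G q (r u) (dist q (r u))" by (rule walk_le_edge) simp
  show ?thesis
  proof (rule finish[OF v sw])
    show "fresh S (\<Union>u\<in>parts. X u) ?G (\<lambda>x. h x + R) A R (- w \<in> parts \<and> Y \<noteq> {}) (r v) Q1 (T v)"
      unfolding b Xv using L(2) by (simp only: Sv)
    show "E z \<subseteq> ?G" if "z \<in> parts" for z using that p by auto
    have "cross (E v) (X v)" by (rule cross_owner[OF owner_X[OF v]])
    then show "cross ?G (\<Union>u\<in>parts. X u)" unfolding Xv
      by (rule cross_add[OF _ _ owner_X[OF u] L(3)]) auto
    show "walk_le ?G x (r v) (\<kappa> * h x + \<theta> * R + dist (r v) c)" if "x \<in> (\<Union>u\<in>parts. X u)" for x
    proof (cases "x \<in> X v")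
      case True
      show ?thesis by (rule walk_le_jn(1)[OF walk_le_le[OF freshD(14)[OF part_fresh[OF v] True]]])
        (use tR zero_le_dist[of "r v" c] in linarith)
    next
      case False
      then have x: "x \<in> X u" using that Xv by blast
      show ?thesis
        by (rule walk_le_le[OF walk_le_trans[OF walk_le_jn(2)[OF freshD(14)[OF part_fresh[OF u] x]] walk_le_trans[OF walk_le_sym[OF ed] walk_le_sym[OF L(5)]]]])
          (use qi zero_le_dist[of "r u" c] in linarith)
    qed
    show "walk_le ?G (r v) y (2 * R + \<theta> * R)" if "y \<in> set Q1" for y
      using L(7)[OF that]
    proof (elim disjE conjE)
      assume y: "y = r u"
      show ?thesis unfolding y
        by (rule walk_le_le[OF walk_le_trans[OF L(5) ed]]) (use qi e in linarith)
    next
      assume y: "y \<in> sect v" "walk_le (E v) (r v) y (dist (r v) y + \<theta> * (R/2))"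
      have "dist (r v) y \<le> R" by (rule sect_dist(2)[OF rS[OF v] y(1)])
      then have "dist (r v) y + \<theta> * (R/2) \<le> 2 * R + \<theta> * R" using R tR by simp
      then show ?thesis using walk_le_jn(1)[OF walk_le_le[OF y(2)]] by blast
    qed
  qed
qed

lemma three_parts:
  assumes p: "parts = {v, u, z}" "v \<noteq> u" "v \<noteq> z" "u \<noteq> z" "- w \<in> parts" and sw: "sect w = {}"
    and ok: "merge_ok c R w (r v) (r u) (r z)"
  shows "\<exists>G r' Q' T'. fresh S (S \<union> Y) G (\<lambda>x. h x + R) A R (Y \<noteq> {}) r' Q' T' \<and>
    (\<forall>u\<in>parts. E u \<subseteq> G) \<and> F \<subseteq> G \<and> cross G (S \<union> Y)"
proof -
  have v: "v \<in> parts" and u: "u \<in> parts" and z: "z \<in> parts" using p by auto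
  obtain G Q1 where G: "fresh (sect v \<union> sect u \<union> sect z) (X v \<union> X u \<union> X z) G (\<lambda>x. h x + R) A R
      ((v = - w \<and> Y \<noteq> {}) \<or> (u = - w \<and> Y \<noteq> {}) \<or> (z = - w \<and> Y \<noteq> {})) (r v) Q1 (T v)"
     "E v \<subseteq> G" "E u \<subseteq> G" "E z \<subseteq> G"
     "\<And>x y. x\<in>X v \<Longrightarrow> y\<in>X u \<Longrightarrow> walk_le G x y (\<kappa> * h x + \<kappa> * h y)"
     "\<And>x y. x\<in>X v \<union> X u \<Longrightarrow> y\<in>X z \<Longrightarrow> walk_le G x y (\<kappa> * h x + \<kappa> * h y)"
    using two_lights_step[OF v u z p(2-4) ok] by blast
  have Sv: "sect v \<union> sect u \<union> sect z = S" using S_parts sw p(1) by (simp add: Un_assoc)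
  have Xv: "(\<Union>u\<in>parts. X u) = X v \<union> X u \<union> X z" by (simp add: p(1) Un_assoc)
  have b: "(- w \<in> parts \<and> Y \<noteq> {}) = ((v = - w \<and> Y \<noteq> {}) \<or> (u = - w \<and> Y \<noteq> {}) \<or> (z = - w \<and> Y \<noteq> {}))"
    using p(1) by auto
  show ?thesis
  proof (rule finish[OF v sw])
    show "fresh S (\<Union>u\<in>parts. X u) G (\<lambda>x. h x + R) A R (- w \<in> parts \<and> Y \<noteq> {}) (r v) Q1 (T v)"
      unfolding b Xv using G(1) by (simp only: Sv)
    show "E y \<subseteq> G" if "y \<in> parts" for y using that p(1) G(2-4) by auto
    have "cross (E v) (X v)" by (rule cross_owner[OF owner_X[OF v]])
    then have "cross G (X v \<union> X u)" by (rule cross_add[OF _ G(2) owner_X[OF u] G(5)])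
    then show "cross G (\<Union>u\<in>parts. X u)" unfolding Xv
      by (rule cross_add[OF _ order_refl owner_X[OF z] G(6)])
  qed (use p(5) in simp_all)
qed

lemma fresh_case:
  assumes ne: "S \<noteq> {}" and sw: "sect w = {}"
  shows "\<exists>G r' Q' T'. fresh S (S \<union> Y) G (\<lambda>x. h x + R) A R (Y \<noteq> {}) r' Q' T' \<and>
    (\<forall>u\<in>parts. E u \<subseteq> G) \<and> F \<subseteq> G \<and> cross G (S \<union> Y)"
proof -
  have pair: ?thesis if p: "parts = {v, u}" "v \<noteq> u" for v u
  proof -
    have v: "v \<in> parts" "u \<in> parts" using p by auto
    note rv = sect_cell[OF rS[OF v(1)]] and ru = sect_cell[OF rS[OF v(2)]]
    have "dist (r u) (r v) - 3 * dist (r u) c + 3 * dist (r v) A \<le> 4 * R \<or>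
       dist (r v) (r u) - 3 * dist (r v) c + 3 * dist (r u) A \<le> 4 * R"
      unfolding A_def
      by (rule pair_cost[OF R w]) (use rv ru p(2) parts_nz[OF v(1)] parts_nz[OF v(2)] in auto)
    then show ?thesis
    proof
      assume "dist (r u) (r v) - 3 * dist (r u) c + 3 * dist (r v) A \<le> 4 * R"
      then show ?thesis by (rule two_parts[OF p sw])
    next
      assume a: "dist (r v) (r u) - 3 * dist (r v) c + 3 * dist (r u) A \<le> 4 * R"
      show ?thesis by (rule two_parts[OF _ p(2)[symmetric] sw a]) (simp add: p(1) insert_commute)
    qed
  qed
  have ne': "parts \<noteq> {}" using S_parts ne sw by auto
  show ?thesis
  proof (cases "parts = {- w, \<i> * w, - \<i> * w}")
    case True
    then have p: "- w \<in> parts" "\<i> * w \<in> parts" "- \<i> * w \<in> parts" by auto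
    note c1 = sect_cell[OF rS[OF p(1)]] and c2 = sect_cell[OF rS[OF p(2)]] and c3 = sect_cell[OF rS[OF p(3)]]
    note d = units_distinct(4-6)[OF w]
    note three = three_parts[OF _ _ _ _ p(1) sw]
    from hub_exists[OF R w conjunct1[OF c1] conjunct1[OF c2] conjunct1[OF c3]] c1 c2 c3
    have "merge_ok c R w (r (- w)) (r (\<i> * w)) (r (- \<i> * w)) \<or> merge_ok c R w (r (- w)) (r (- \<i> * w)) (r (\<i> * w)) \<or>
      merge_ok c R w (r (\<i> * w)) (r (- w)) (r (- \<i> * w)) \<or> merge_ok c R w (r (\<i> * w)) (r (- \<i> * w)) (r (- w)) \<or>
      merge_ok c R w (r (- \<i> * w)) (r (- w)) (r (\<i> * w)) \<or> merge_ok c R w (r (- \<i> * w)) (r (\<i> * w)) (r (- w))"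
      by blast
    then show ?thesis
    proof (elim disjE)
      assume "merge_ok c R w (r (- w)) (r (\<i> * w)) (r (- \<i> * w))"
      from three[OF _ _ _ _ this] show ?thesis using True d by simp
    next
      assume "merge_ok c R w (r (- w)) (r (- \<i> * w)) (r (\<i> * w))"
      from three[OF _ _ _ _ this] show ?thesis using True d by (simp add: insert_commute)
    next
      assume "merge_ok c R w (r (\<i> * w)) (r (- w)) (r (- \<i> * w))"
      from three[OF _ _ _ _ this] show ?thesis using True d by (simp add: insert_commute)
    next
      assume "merge_ok c R w (r (\<i> * w)) (r (- \<i> * w)) (r (- w))"
      from three[OF _ _ _ _ this] show ?thesis using True d by (simp add: insert_commute)
    next
      assume "merge_ok c R w (r (- \<i> * w)) (r (- w)) (r (\<i> * w))"
      from three[OF _ _ _ _ this] show ?thesis using True d by (simp add: insert_commute)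
    next
      assume "merge_ok c R w (r (- \<i> * w)) (r (\<i> * w)) (r (- w))"
      from three[OF _ _ _ _ this] show ?thesis using True d by (simp add: insert_commute)
    qed
  next
    case False
    have "card {- w, \<i> * w, - \<i> * w} = 3" using units_distinct(4-6)[OF w] by simp
    moreover have "card parts < card {- w, \<i> * w, - \<i> * w}"
      using parts_sub False by (intro psubset_card_mono) auto
    moreover have "card parts \<noteq> 0" using ne' finite_subset[OF parts_sub] by simp
    ultimately have "card parts = 1 \<or> card parts = 2" by linarith
    then show ?thesis
    proof
      assume "card parts = 1"
      then obtain v where "parts = {v}" by (rule card_1_singletonE)
      then show ?thesis by (rule one_part[OF _ sw])
    next
      assume "card parts = 2"
      then obtain v u where "parts = {v, u}" "v \<noteq> u" by (auto simp: card_2_iff)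
      then show ?thesis by (rule pair)
    qed
  qed
qed

definition "star v W G \<longleftrightarrow> hub_tree (\<Union>u\<in>insert v W. X u) G (r v) (card W) h c \<and> (\<forall>u\<in>insert v W. E u \<subseteq> G) \<and>
  cross G (\<Union>u\<in>insert v W. X u)"

lemma star_exists:
  assumes v: "v \<in> parts" and min: "\<And>u. u \<in> parts \<Longrightarrow> dist (r v) c \<le> dist (r u) c"
    and W: "finite W" "W \<subseteq> parts - {v}" "card W \<le> 2"
  shows "\<exists>G. star v W G"
  using W
proof (induction W rule: finite_induct)
  case empty
  have "star v {} (E v)" unfolding star_def
    using hub_tree_fresh[OF part_fresh[OF v]] cross_owner[OF owner_X[OF v]] by simp
  then show ?case by blast
next
  case (insert u W)
  then have W: "W \<subseteq> parts - {v}" "card W \<le> 1" and u: "u \<in> parts" "u \<noteq> v" by auto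
  then obtain G where "star v W G" using insert.IH by auto
  then have G: "hub_tree (\<Union>z\<in>insert v W. X z) G (r v) (card W) h c" "\<forall>z\<in>insert v W. E z \<subseteq> G"
    "cross G (\<Union>z\<in>insert v W. X z)" unfolding star_def by blast+
  have "X z \<inter> X u = {}" if "z \<in> insert v W" for z
    using that insert.hyps(2) u by (intro X_disj) auto
  then have disj: "(\<Union>z\<in>insert v W. X z) \<inter> X u = {}" by blast
  note m = hub_tree_add_fresh[OF G(1) W(2) disj part_fresh[OF u(1)] min[OF u(1)]]
  let ?G = "joined G (E u) (r v) (r u)"
  have U: "(\<Union>z\<in>insert v (insert u W). X z) = (\<Union>z\<in>insert v W. X z) \<union> X u" by auto
  have card: "card (insert u W) = Suc (card W)" using insert.hyps by simp
  have "cross ?G ((\<Union>z\<in>insert v W. X z) \<union> X u)"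
    by (rule cross_add[OF G(3) _ owner_X[OF u(1)] m(2)]) auto
  then have "star v (insert u W) ?G"
    unfolding star_def U card using m(1) G(2) by auto
  then show ?case by blast
qed

text \<open>The degree works out because an empty quarter \<open>- w\<close> leaves at most two
  others: the hub spends at most one edge on a quarter and one on the tail, and otherwise at most
  two on quarters. Both keep it within \<open>2 * K + 3\<close>.\<close>

lemma tail_case:
  assumes ne: "parts \<noteq> {} \<or> Y \<noteq> {}"
  shows "\<exists>G z. is_tail ((S - sect w) \<union> Y) G h c z \<and> (\<forall>u\<in>parts. E u \<subseteq> G) \<and> F \<subseteq> G \<and> cross G ((S - sect w) \<union> Y)"
proof (cases "parts = {}")
  case True
  then have SY': "(S - sect w) \<union> Y = Y" "Y \<noteq> {}" "sect (- w) = {}" using S_minus ne mw_parts by auto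
  have cB: "dist c (c - complex_of_real R * w) = R" using dcB by (simp add: B_def)
  have "is_tail Y F h c \<tau>" by (rule is_tail_shift[OF tail[OF SY'(2)] R cB hY])
  moreover have "cross F Y" by (rule cross_owner[OF owner_Y[OF SY'(3)]])
  ultimately show ?thesis unfolding SY'(1) using True by blast
next
  case False
  have fin: "finite parts" using parts_sub by (rule finite_subset) simp
  then obtain v where v: "v \<in> parts" "\<And>u. u \<in> parts \<Longrightarrow> dist (r v) c \<le> dist (r u) c"
    using False ex_min_if_finite[of "(\<lambda>u. dist (r u) c) ` parts"] by (auto simp: not_less)
  have c3: "card {- w, \<i> * w, - \<i> * w} = 3" using units_distinct(4-6)[OF w] by simp
  have card: "card parts \<le> 3" using card_mono[OF _ parts_sub] c3 by simp
  have cardW: "card (parts - {v}) = card parts - 1" using v(1) fin by simp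
  have ins: "insert v (parts - {v}) = parts" using v(1) by blast
  obtain G where "star v (parts - {v}) G"
    using star_exists[OF v finite_Diff[OF fin] order_refl] card cardW by fastforce
  then have G: "hub_tree (\<Union>z\<in>parts. X z) G (r v) (card parts - 1) h c" "\<forall>z\<in>parts. E z \<subseteq> G"
    "cross G (\<Union>z\<in>parts. X z)" unfolding star_def ins cardW by blast+
  show ?thesis
  proof (cases "- w \<in> parts \<or> Y = {}")
    case True
    have U: "(\<Union>z\<in>parts. X z) = (S - sect w) \<union> Y" using True by (auto simp: UX S_minus)
    have "F \<subseteq> G"
    proof (cases "Y = {}")
      case False
      then have "- w \<in> parts" using True by blast
      then show ?thesis using FE G(2) mw_parts by (simp add: sect_def) blast
    qed (simp add: noF)
    moreover have "is_tail ((S - sect w) \<union> Y) G h c (r v)"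
      by (rule hub_tree_tailst[OF G(1)[unfolded U]]) (use card in simp)
    ultimately show ?thesis using G(2,3) unfolding U by blast
  next
    case nw: False
    then have Y: "Y \<noteq> {}" and sm: "sect (- w) = {}" using mw_parts by blast+
    have U: "(\<Union>z\<in>parts. X z) = S - sect w" using nw by (auto simp: UX S_minus)
    have "parts \<subseteq> {\<i> * w, - \<i> * w}" using parts_sub nw by auto
    from card_mono[OF _ this] have card: "card parts - 1 \<le> 1"
      by (simp add: card_insert_if split: if_splits)
    then have n2: "Suc (card parts - 1) \<le> 2" by linarith
    have disj: "(S - sect w) \<inter> Y = {}" using SY by blast
    have rc: "dist (r v) c \<le> R" by (rule sect_dist(1)[OF rS[OF v(1)]])
    have cB: "dist c (c - complex_of_real R * w) = R" using dcB by (simp add: B_def)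
    note m = hub_tree_add_tail[OF G(1)[unfolded U] card disj tail[OF Y] R rc cB hY]
    let ?G = "joined G F (r v) \<tau>"
    have "is_tail ((S - sect w) \<union> Y) ?G h c (r v)"
      by (rule hub_tree_tailst[OF m(1) n2])
    moreover have "cross ?G ((S - sect w) \<union> Y)"
      by (rule cross_add[OF G(3)[unfolded U] _ owner_Y[OF sm] m(2)]) auto
    ultimately show ?thesis using G(2) by (intro exI[of _ ?G] exI[of _ "r v"]) auto
  qed
qed

end

section \<open>Recursion over the quadtree\<close>

context scheme begin

text \<open>The quarter at the root corner shares its corner \<open>A\<close> with the cell, so
  Steiner distances stay the same and only the scale changes.\<close>

lemma fresh_widen:
  assumes f: "fresh S0 X E h A (R/2) b r Q T" and S: "S0 \<subseteq> S" "S \<subseteq> X" and R: "0 < R" and b: "b' \<or> X = S"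
  shows "fresh S X E h A R b' r Q T"
proof (rule freshI)
  note F = freshD[OF f]
  obtain s where s: "0 \<le> s" "s \<le> R/2" "\<forall>j<length Q. dist r (Q ! j) \<le> 2 * s / 2 ^ (length Q - 1 - j) \<and>
       walk_le E r (Q ! j) (dist r (Q ! j) + \<theta> * s / 2 ^ (length Q - 1 - j))"
    using F(10) by blast
  show "\<exists>s. 0 \<le> s \<and> s \<le> R \<and> (\<forall>j<length Q. dist r (Q ! j) \<le> 2 * s / 2 ^ (length Q - 1 - j) \<and>
       walk_le E r (Q ! j) (dist r (Q ! j) + \<theta> * s / 2 ^ (length Q - 1 - j)))"
    using s R by (intro exI[of _ s]) auto
  show "walk_le E r t (dist r t + 8/3 * (if b' then R else R/2))" if "t \<in> set T" for t
    by (rule walk_le_le[OF F(12)[OF that]]) (use R in auto)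
qed (use freshD[OF f] S b in auto)

lemma fresh_leaf:
  assumes h: "3 * dist p A \<le> \<kappa> * h p"
    and "0 \<le> R"
  shows "fresh {p} {p} {} h A R False p [] []"
proof (rule freshI)
  show "walk_le {} x p (\<kappa> * h x - 3 * dist p A)" if "x \<in> {p}" for x
    using that h by (intro walk_le_refl0) auto
qed (use assms in \<open>auto simp: is_tree.single cap_def deg_def\<close>)

lemma fresh_leaf_tail:
  assumes t: "is_tail Y F g B \<tau>" and p: "p \<notin> Y" and R: "0 < R"
    and d: "dist p B \<le> 2 * R" "dist p A \<le> 2 * R"
    and h: "dist p A \<le> h p" "\<And>y. y \<in> Y \<Longrightarrow> h y = g y + 2 * R"
  shows "fresh {p} (insert p Y) (joined {} F p \<tau>) h A R True p [] [\<tau>]"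
    "\<And>y. y \<in> Y \<Longrightarrow> walk_le (joined {} F p \<tau>) p y (\<kappa> * (dist p B + g y))"
proof -
  note Ta = is_tailD[OF t]
  let ?G = "joined {} F p \<tau>"
  have k4: "4 \<le> \<kappa>" using theta_pos by (simp add: kappa)
  have pt: "dist p \<tau> \<le> dist p B + dist \<tau> B" by (rule dist_triangle2)
  have disj: "{p} \<inter> Y = {}" using p by blast
  have path: "walk_le ?G p y (\<kappa> * g y + dist p B)" if "y \<in> Y" for y
    by (rule walk_le_cross(1)[OF walk_le.refl[OF order_refl] Ta(5)[OF that]]) (use pt in linarith)
  have kR: "8 * R \<le> \<kappa> * (2 * R)" using mult_right_mono[OF k4, of "2 * R"] R by simp
  have kA: "4 * dist p A \<le> \<kappa> * h p" using mult_mono[OF k4 h(1)] k4 by simp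
  show "walk_le ?G p y (\<kappa> * (dist p B + g y))" if "y \<in> Y" for y
  proof (rule walk_le_le[OF path[OF that]])
    have "1 * dist p B \<le> \<kappa> * dist p B" using k4 by (intro mult_right_mono) auto
    then show "\<kappa> * g y + dist p B \<le> \<kappa> * (dist p B + g y)" by (simp add: distrib_left)
  qed
  note deg = deg_join[OF is_tree.single[of p] Ta(1) disj singletonI Ta(2)]
  have tp: "\<tau> \<noteq> p" using Ta(2) p by blast
  show "fresh {p} (insert p Y) ?G h A R True p [] [\<tau>]"
  proof (rule freshI)
    show "is_tree (insert p Y) ?G" using is_tree.join[OF is_tree.single[of p] Ta(1) disj singletonI Ta(2)] by simp
    show "deg ?G x \<le> cap p [] [\<tau>] x" if "x \<in> insert p Y" for x
    proof (cases "x = p")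
      case True
      then show ?thesis using deg(1)[of p] by (simp add: cap_def deg_def)
    next
      case False
      then have x: "x \<in> Y" using that by blast
      show ?thesis using deg(2)[OF x] Ta(3)[OF x] Ta(4) False by (auto simp: cap_def)
    qed
    show "walk_le ?G x p (\<kappa> * h x - 3 * dist p A)" if "x \<in> insert p Y" for x
    proof (cases "x = p")
      case True
      have "0 \<le> \<kappa> * h p - 3 * dist p A" using kA zero_le_dist[of p A] by linarith
      then show ?thesis using True by (intro walk_le_refl0) auto
    next
      case False
      then have x: "x \<in> Y" using that by blast
      have "\<kappa> * h x = \<kappa> * g x + \<kappa> * (2 * R)" using h(2)[OF x] by (simp add: distrib_left)
      then show ?thesis by (intro walk_le_le[OF walk_le_sym[OF path[OF x]]]) (use kR d in linarith)
    qed
    show "walk_le ?G p t (dist p t + 8/3 * (if True then R else R/2))" if "t \<in> set [\<tau>]" for t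
      using that R by (intro walk_le_le[OF walk_le_edge]) auto
  qed (use R tp Ta(2) in auto)
qed

text \<open>The tail belongs to the induction statement, since an occupied root quarter receives the
  tree of the other quarters, together with any old tail, as its own tail. Points of a tail are
  farther from \<open>A\<close> than from their entry corner by the full diagonal
  \<open>2 * R\<close>. The separation halves with the radius and leaves one point per cell at depth
  0.\<close>

theorem scheme_exists:
  assumes "finite S" "S \<noteq> {}" "S \<subseteq> cell c R" "0 < R" "w \<in> units"
    and "\<And>x y. x \<in> S \<Longrightarrow> y \<in> S \<Longrightarrow> x \<noteq> y \<Longrightarrow> 2 * R / 2 ^ n < dist x y"
    and "S \<inter> Y = {}" "Y \<noteq> {} \<Longrightarrow> is_tail Y F g (c - complex_of_real R * w) \<tau>" "Y = {} \<Longrightarrow> F = {}"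
  shows "\<exists>E r Q T. fresh S (S \<union> Y) E (\<lambda>x. if x \<in> S then corner_dist n c R w x else g x + 2 * R) (c + complex_of_real R * w)
      R (Y \<noteq> {}) r Q T \<and> F \<subseteq> E \<and>
    (\<forall>x\<in>S. \<forall>y\<in>S. x \<noteq> y \<longrightarrow> walk_le E x y (\<kappa> * tree_dist n c R x y)) \<and>
    (\<forall>x\<in>S. \<forall>y\<in>Y. walk_le E x y (\<kappa> * (corner_dist n c R (- w) x + g y)))"
  using assms
proof (induction n arbitrary: S c R w Y F g \<tau>)
  case 0
  note R = \<open>0 < R\<close> and w = \<open>w \<in> units\<close>
  let ?A = "c + complex_of_real R * w" and ?B = "c - complex_of_real R * w"
  have dc: "dist x c \<le> R" if "x \<in> S" for x using that 0(3) dist_centre by blast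
  obtain p where p: "p \<in> S" using 0(2) by blast
  have "x = p" if "x \<in> S" for x
    using 0(6)[OF that p] dc[OF that] dc[OF p] dist_triangle2[of x p c] by fastforce
  then have Sp: "S = {p}" using p by blast
  have AB: "dist p ?A \<le> 2 * R" "dist p ?B \<le> 2 * R"
    using dist_triangle[of p ?A c] dist_triangle[of p ?B c] dist_corner[OF w, of R c] dc[OF p] R by linarith+
  show ?case
  proof (cases "Y = {}")
    case True
    have "3 * dist p ?A \<le> \<kappa> * dist p ?A" using theta_pos by (intro mult_right_mono) (auto simp: kappa)
    then have "fresh {p} {p} {} (\<lambda>x. if x \<in> S then corner_dist 0 c R w x else g x + 2 * R) ?A R False p [] []"
      using R Sp by (intro fresh_leaf) auto
    then show ?thesis using True 0(9) unfolding Sp by fastforce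
  next
    case False
    note t = 0(8)[OF False]
    have pY: "p \<notin> Y" using 0(7) p by blast
    have h: "dist p ?A \<le> (if p \<in> S then corner_dist 0 c R w p else g p + 2 * R)"
      "\<And>y. y \<in> Y \<Longrightarrow> (if y \<in> S then corner_dist 0 c R w y else g y + 2 * R) = g y + 2 * R"
      using p 0(7) by auto
    note l = fresh_leaf_tail[OF t pY R AB(2,1), where h = "\<lambda>x. if x \<in> S then corner_dist 0 c R w x else g x + 2 * R", OF h]
    have Y: "(Y \<noteq> {}) = True" "S \<union> Y = insert p Y" using False Sp by auto
    show ?thesis unfolding Y
    proof (rule exI[of _ "joined {} F p \<tau>"], rule exI[of _ p], rule exI[of _ "[]"], rule exI[of _ "[\<tau>]"],
        intro conjI ballI impI)
      show "fresh S (insert p Y) (joined {} F p \<tau>) (\<lambda>x. if x \<in> S then corner_dist 0 c R w x else g x + 2 * R) ?A R True p [] [\<tau>]"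
        using l(1) by (simp only: Sp)
      show "F \<subseteq> joined {} F p \<tau>" by blast
      show "walk_le (joined {} F p \<tau>) x y (\<kappa> * (corner_dist 0 c R (- w) x + g y))" if "x \<in> S" "y \<in> Y" for x y
      proof -
        have "x = p" using that(1) Sp by blast
        then show ?thesis using l(2)[OF _ that(2)] by simp
      qed
    qed (use Sp in auto)
  qed
next
  case (Suc n)
  note R = \<open>0 < R\<close> and w = \<open>w \<in> units\<close>
  define sec where "sec v = {x \<in> S. dir (x - c) = v}" for v
  define cc where "cc v = c + complex_of_real (R/2) * v" for v
  define h where "h x = (if x \<in> S then centre_dist n c R x else g x + R)" for x
  let ?Y = "\<lambda>v. if v = - w then Y else {}" and ?F = "\<lambda>v. if v = - w then F else {}"
  have cc: "sub_centre c R x = cc v" "x \<in> S" if "x \<in> sec v" for x v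
    using that by (auto simp: sec_def cc_def sub_centre_def)
  have sc: "sec v \<subseteq> cell (cc v) (R/2)" for v
  proof
    fix x assume "x \<in> sec v"
    then have x: "x \<in> cell c R" "sub_centre c R x = cc v" using Suc.prems(3) cc[of x v] by blast+
    show "x \<in> cell (cc v) (R/2)" using sub_cell[OF x(1)] unfolding x(2) .
  qed
  have cn: "cc v + complex_of_real (R/2) * - v = c" "cc v - complex_of_real (R/2) * - v = c + complex_of_real R * v"
    "cc v + complex_of_real (R/2) * v = c + complex_of_real R * v" "cc v - complex_of_real (R/2) * v = c" for v
    by (simp_all add: cc_def algebra_simps)
  have sep: "2 * (R/2) / 2 ^ n < dist x y" if "x \<in> sec v" "y \<in> sec v" "x \<noteq> y" for x y v
    using Suc.prems(6)[OF cc(2)[OF that(1)] cc(2)[OF that(2)] that(3)] by simp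
  have R2: "0 < R/2" and fin: "finite (sec v)" for v using R Suc.prems(1) by (auto simp: sec_def)
  have h_sec: "h x = corner_dist n (cc v) (R/2) (- v) x" if "x \<in> sec v" for x v
  proof -
    have "dir (x - c) = v" using that by (simp add: sec_def)
    then show ?thesis using cc[OF that] by (simp add: h_def centre_dist_def)
  qed
  define P where "P v E r Q T \<longleftrightarrow> fresh (sec v) (sec v \<union> ?Y v) E h c (R/2) (v = - w \<and> Y \<noteq> {}) r Q T \<and>
     ?F v \<subseteq> E \<and> (\<forall>x\<in>sec v. \<forall>y\<in>sec v. x \<noteq> y \<longrightarrow> walk_le E x y (\<kappa> * tree_dist n (cc v) (R/2) x y)) \<and>
     (\<forall>x\<in>sec v. \<forall>y\<in>?Y v. walk_le E x y (\<kappa> * (corner_dist n (cc v) (R/2) v x + g y)))" for v E r Q T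
  have ex: "\<exists>E r Q T. P v E r Q T" if v: "v \<in> units" "v \<noteq> w" "sec v \<noteq> {}" for v
  proof -
    have mv: "- v \<in> units" using v by simp
    have b: "(?Y v \<noteq> {}) = (v = - w \<and> Y \<noteq> {})" by simp
    have "\<exists>E r Q T. fresh (sec v) (sec v \<union> ?Y v) E (\<lambda>x. if x \<in> sec v then corner_dist n (cc v) (R/2) (- v) x else g x + 2 * (R/2))
        (cc v + complex_of_real (R/2) * - v) (R/2) (?Y v \<noteq> {}) r Q T \<and> ?F v \<subseteq> E \<and>
       (\<forall>x\<in>sec v. \<forall>y\<in>sec v. x \<noteq> y \<longrightarrow> walk_le E x y (\<kappa> * tree_dist n (cc v) (R/2) x y)) \<and>
       (\<forall>x\<in>sec v. \<forall>y\<in>?Y v. walk_le E x y (\<kappa> * (corner_dist n (cc v) (R/2) (- (- v)) x + g y)))"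
    proof (rule Suc.IH[OF fin v(3) sc R2 mv sep])
      show "sec v \<inter> ?Y v = {}" using Suc.prems(7) cc(2) by auto
      show "is_tail (?Y v) (?F v) g (cc v - complex_of_real (R/2) * - v) \<tau>" if "?Y v \<noteq> {}"
      proof -
        have vw: "v = - w" "Y \<noteq> {}" using that by (auto split: if_splits)
        have "c + complex_of_real R * v = c - complex_of_real R * w" by (simp add: vw)
        then show ?thesis unfolding cn(2) using Suc.prems(8)[OF vw(2)] vw(1) by simp
      qed
      show "?F v = {}" if "?Y v = {}" using that Suc.prems(9) by (auto split: if_splits)
    qed
    then obtain E r Q T where E: "fresh (sec v) (sec v \<union> ?Y v) E
        (\<lambda>x. if x \<in> sec v then corner_dist n (cc v) (R/2) (- v) x else g x + 2 * (R/2)) c (R/2) (v = - w \<and> Y \<noteq> {}) r Q T"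
      "?F v \<subseteq> E" "\<forall>x\<in>sec v. \<forall>y\<in>sec v. x \<noteq> y \<longrightarrow> walk_le E x y (\<kappa> * tree_dist n (cc v) (R/2) x y)"
      "\<forall>x\<in>sec v. \<forall>y\<in>?Y v. walk_le E x y (\<kappa> * (corner_dist n (cc v) (R/2) v x + g y))"
      unfolding cn(1) b minus_minus by (elim exE conjE)
    have "fresh (sec v) (sec v \<union> ?Y v) E h c (R/2) (v = - w \<and> Y \<noteq> {}) r Q T"
    proof (rule fresh_cong[OF E(1)])
      fix x assume x: "x \<in> sec v \<union> ?Y v"
      show "h x = (if x \<in> sec v then corner_dist n (cc v) (R/2) (- v) x else g x + 2 * (R/2))"
      proof (cases "x \<in> sec v")
        case True then show ?thesis using h_sec by simp
      next
        case False
        then have "x \<in> Y" using x by (auto split: if_splits)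
        then have "x \<notin> S" using Suc.prems(7) by blast
        then show ?thesis using False by (simp add: h_def)
      qed
    qed
    then have "P v E r Q T" unfolding P_def using E(2-4) by blast
    then show ?thesis by blast
  qed
  \<comment> \<open>Quadruples, so that one choice function yields edges, representative, queue and
    tails for each direction.\<close>
  have "\<forall>v. \<exists>a. v \<in> units \<longrightarrow> v \<noteq> w \<longrightarrow> sec v \<noteq> {} \<longrightarrow> P v (fst a) (fst (snd a)) (fst (snd (snd a))) (snd (snd (snd a)))"
    using ex by fastforce
  then obtain a where a: "\<And>v. v \<in> units \<Longrightarrow> v \<noteq> w \<Longrightarrow> sec v \<noteq> {} \<Longrightarrow>
      P v (fst (a v)) (fst (snd (a v))) (fst (snd (snd (a v)))) (snd (snd (snd (a v))))"
    by (metis (no_types, lifting))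
  define E r Q T where "E v = fst (a v)" and "r v = fst (snd (a v))" and "Q v = fst (snd (snd (a v)))"
    and "T v = snd (snd (snd (a v)))" for v
  have P: "P v (E v) (r v) (Q v) (T v)" if "v \<in> units" "v \<noteq> w" "sec v \<noteq> {}" for v
    using a[OF that] by (simp only: E_def r_def Q_def T_def)
  interpret ce: centre K \<theta> \<kappa> c R w S Y F g h \<tau> E r Q T
  proof (unfold_locales, goal_cases)
    case (1) show ?case by (rule R)
  next case (2) show ?case by (rule w)
  next case (3) show ?case by (rule Suc.prems(3))
  next case (4) show ?case by (rule Suc.prems(7))
  next case (5) then show ?case by (rule Suc.prems(8))
  next case (6) then show ?case by (rule Suc.prems(9))
  next case (7 y) then show ?case using Suc.prems(7) by (auto simp: h_def)
  next case (8 v) then show ?case using P[of v] unfolding P_def sec_def by blast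
  next case (9)
    have "P (- w) (E (- w)) (r (- w)) (Q (- w)) (T (- w))"
      by (rule P) (use 9 w units_distinct(1)[OF w] in \<open>auto simp: sec_def\<close>)
    then show ?case unfolding P_def by simp
  qed
  have sect: "ce.sect = sec" by (simp add: fun_eq_iff ce.sect_def sec_def)
  have dirx: "dir (x - c) \<in> ce.parts" "x \<in> sec (dir (x - c))" "x \<in> S" "dir (x - c) \<noteq> w" if "x \<in> S - sec w" for x
    using that unfolding ce.parts_def sect by (auto simp: sec_def)
  have Pp: "P v (E v) (r v) (Q v) (T v)" if "v \<in> ce.parts" for v
    using that unfolding ce.parts_def sect by (intro P) auto
  have inS: "walk_le G x y (\<kappa> * tree_dist (Suc n) c R x y)"
    if G: "\<forall>u\<in>ce.parts. E u \<subseteq> G" "ce.cross G ((S - sec w) \<union> Y)" and x: "x \<in> S - sec w" and y: "y \<in> S - sec w"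
      and "x \<noteq> y" for G x y
  proof (cases "dir (x - c) = dir (y - c)")
    case True
    have "walk_le (E (dir (x - c))) x y (\<kappa> * tree_dist n (cc (dir (x - c))) (R/2) x y)"
      using Pp[OF dirx(1)[OF x]] dirx(2)[OF x] dirx(2)[OF y] \<open>x \<noteq> y\<close> True unfolding P_def by simp
    then have "walk_le G x y (\<kappa> * tree_dist n (cc (dir (x - c))) (R/2) x y)"
      using walk_le_mono G(1) dirx(1)[OF x] by blast
    then show ?thesis using True cc(1)[OF dirx(2)[OF x]] by simp
  next
    case False
    then have "ce.owner x \<noteq> ce.owner y" using dirx(3)[OF x] dirx(3)[OF y] by (simp add: ce.owner_def)
    then have "walk_le G x y (\<kappa> * h x + \<kappa> * h y)" using G(2) x y unfolding ce.cross_def by blast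
    then show ?thesis using False dirx(3)[OF x] dirx(3)[OF y] by (simp add: h_def distrib_left)
  qed
  have inY: "walk_le G x y (\<kappa> * (corner_dist (Suc n) c R (- w) x + g y))"
    if G: "\<forall>u\<in>ce.parts. E u \<subseteq> G" "ce.cross G ((S - sec w) \<union> Y)" and x: "x \<in> S - sec w" and y: "y \<in> Y" for G x y
  proof (cases "dir (x - c) = - w")
    case True
    have "walk_le (E (dir (x - c))) x y (\<kappa> * (corner_dist n (cc (dir (x - c))) (R/2) (dir (x - c)) x + g y))"
      using Pp[OF dirx(1)[OF x]] dirx(2)[OF x] y True unfolding P_def by simp
    then have "walk_le G x y (\<kappa> * (corner_dist n (cc (dir (x - c))) (R/2) (dir (x - c)) x + g y))"
      using walk_le_mono G(1) dirx(1)[OF x] by blast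
    then show ?thesis using True cc(1)[OF dirx(2)[OF x]] by simp
  next
    case False
    have yS: "y \<notin> S" using y Suc.prems(7) by blast
    have "dir (x - c) \<noteq> 0" using dir_units[of "x - c"] unit_simps by auto
    then have "ce.owner x \<noteq> ce.owner y" using dirx(3)[OF x] yS False by (simp add: ce.owner_def)
    then have "walk_le G x y (\<kappa> * h x + \<kappa> * h y)" using G(2) x y unfolding ce.cross_def by blast
    then show ?thesis using False dirx(3)[OF x] yS by (simp add: h_def centre_dist_def algebra_simps)
  qed
  let ?H = "\<lambda>x. if x \<in> S then corner_dist (Suc n) c R w x else g x + 2 * R"
  show ?case
  proof (cases "sec w = {}")
    case True
    obtain G r' Q' T' where G: "fresh S (S \<union> Y) G (\<lambda>x. h x + R) ce.A R (Y \<noteq> {}) r' Q' T'"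
      "\<forall>u\<in>ce.parts. E u \<subseteq> G" "F \<subseteq> G" "ce.cross G (S \<union> Y)"
      using ce.fresh_case[OF Suc.prems(2)] True unfolding sect by blast
    have S: "S - sec w = S" using True by simp
    have f: "fresh S (S \<union> Y) G ?H (c + complex_of_real R * w) R (Y \<noteq> {}) r' Q' T'"
    proof (rule fresh_cong[OF G(1)[unfolded ce.A_def]])
      fix x assume "x \<in> S \<union> Y"
      show "?H x = h x + R"
        using dirx(4)[of x] S by (auto simp: h_def centre_dist_def)
    qed
    show ?thesis
      using f G(3) inS[OF G(2)] inY[OF G(2)] G(4) unfolding S
      by (intro exI[of _ G] exI[of _ r'] exI[of _ Q'] exI[of _ T'] conjI ballI impI) assumption+
  next
    case False
    let ?Z = "(S - sec w) \<union> Y"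
    have "\<exists>G z. (?Z \<noteq> {} \<longrightarrow> is_tail ?Z G h c z) \<and> (?Z = {} \<longrightarrow> G = {}) \<and>
      (\<forall>u\<in>ce.parts. E u \<subseteq> G) \<and> F \<subseteq> G \<and> ce.cross G ?Z"
    proof (cases "ce.parts \<noteq> {} \<or> Y \<noteq> {}")
      case True
      have "?Z \<noteq> {}"
        using True ce.S_minus unfolding sect by (auto simp: ce.parts_def sect)
      then show ?thesis using ce.tail_case[OF True] unfolding sect by blast
    next
      case False
      then have "ce.parts = {}" "Y = {}" "S - sec w = {}" using ce.S_minus unfolding sect by auto
      then show ?thesis using Suc.prems(9) by (intro exI[of _ "{}"]) (auto simp: ce.cross_def)
    qed
    then obtain G z where G: "?Z \<noteq> {} \<Longrightarrow> is_tail ?Z G h c z" "?Z = {} \<Longrightarrow> G = {}"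
      "\<forall>u\<in>ce.parts. E u \<subseteq> G" "F \<subseteq> G" "ce.cross G ?Z" by blast
    have disj: "sec w \<inter> ?Z = {}" using Suc.prems(7) cc(2) by blast
    \<comment> \<open>The centre \<open>c\<close> is the corner of the root quarter opposite to the
      root corner, that is, the place where a tail enters.\<close>
    have t: "is_tail ?Z G h (cc w - complex_of_real (R/2) * w) z" if "?Z \<noteq> {}"
      unfolding cn(4) by (rule G(1)[OF that])
    have "\<exists>E r Q T. fresh (sec w) (sec w \<union> ?Z) E (\<lambda>x. if x \<in> sec w then corner_dist n (cc w) (R/2) w x else h x + 2 * (R/2))
        (cc w + complex_of_real (R/2) * w) (R/2) (?Z \<noteq> {}) r Q T \<and> G \<subseteq> E \<and>
       (\<forall>x\<in>sec w. \<forall>y\<in>sec w. x \<noteq> y \<longrightarrow> walk_le E x y (\<kappa> * tree_dist n (cc w) (R/2) x y)) \<and>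
       (\<forall>x\<in>sec w. \<forall>y\<in>?Z. walk_le E x y (\<kappa> * (corner_dist n (cc w) (R/2) (- w) x + h y)))"
      by (rule Suc.IH[OF fin False sc R2 w sep disj]; (assumption | rule t G(2)))
    then obtain E' r' Q' T' where E': "fresh (sec w) (sec w \<union> ?Z) E' (\<lambda>x. if x \<in> sec w then corner_dist n (cc w) (R/2) w x else h x + 2 * (R/2))
        (c + complex_of_real R * w) (R/2) (?Z \<noteq> {}) r' Q' T'" "G \<subseteq> E'"
       "\<forall>x\<in>sec w. \<forall>y\<in>sec w. x \<noteq> y \<longrightarrow> walk_le E' x y (\<kappa> * tree_dist n (cc w) (R/2) x y)"
       "\<forall>x\<in>sec w. \<forall>y\<in>?Z. walk_le E' x y (\<kappa> * (corner_dist n (cc w) (R/2) (- w) x + h y))"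
      unfolding cn(3) by (elim exE conjE)
    have SZ: "sec w \<union> ?Z = S \<union> Y" "sec w \<subseteq> S" using cc(2) by blast+
    have dw: "dir (x - c) = w" if "x \<in> sec w" for x using that by (simp add: sec_def)
    have f: "fresh S (S \<union> Y) E' ?H (c + complex_of_real R * w) R (Y \<noteq> {}) r' Q' T'"
    proof (rule fresh_widen[OF _ SZ(2) Un_upper1 R])
      show "fresh (sec w) (S \<union> Y) E' ?H (c + complex_of_real R * w) (R/2) (?Z \<noteq> {}) r' Q' T'"
      proof (rule fresh_cong[OF E'(1)[unfolded SZ(1)]])
        fix x assume "x \<in> S \<union> Y"
        show "?H x = (if x \<in> sec w then corner_dist n (cc w) (R/2) w x else h x + 2 * (R/2))"
        proof (cases "x \<in> sec w")
          case True
          then show ?thesis using dw cc by simp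
        next
          case False
          then show ?thesis using dirx(4)[of x] by (auto simp: h_def centre_dist_def)
        qed
      qed
      show "Y \<noteq> {} \<or> S \<union> Y = S" by blast
    qed
    have h': "walk_le E' x y (\<kappa> * (centre_dist n c R x + h y))" if "x \<in> sec w" "y \<in> ?Z" for x y
      using E'(4)[rule_format, OF that] cc[OF that(1)] dw[OF that(1)] by (simp add: centre_dist_def)
    have up: "\<forall>u\<in>ce.parts. E u \<subseteq> E'" "ce.cross E' ?Z"
      using G(3,5) E'(2) walk_le_mono[OF _ E'(2)] unfolding ce.cross_def by blast+
    show ?thesis
    proof (rule exI[of _ E'], rule exI[of _ r'], rule exI[of _ Q'], rule exI[of _ T'], intro conjI ballI impI)
      show "fresh S (S \<union> Y) E' ?H (c + complex_of_real R * w) R (Y \<noteq> {}) r' Q' T'" by (rule f)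
      show "F \<subseteq> E'" using G(4) E'(2) by blast
      fix x assume x: "x \<in> S"
      show "walk_le E' x y (\<kappa> * tree_dist (Suc n) c R x y)" if y: "y \<in> S" "x \<noteq> y" for y
      proof -
        have hS: "h x = centre_dist n c R x" "h y = centre_dist n c R y" using x y by (simp_all add: h_def)
        consider "x \<in> sec w" "y \<in> sec w" | "x \<in> sec w" "y \<notin> sec w" | "x \<notin> sec w" "y \<in> sec w" | "x \<notin> sec w" "y \<notin> sec w"
          by blast
        then show ?thesis
        proof cases
          case 1
          show ?thesis using E'(3)[rule_format, OF 1 y(2)] dw[OF 1(1)] dw[OF 1(2)] cc(1)[OF 1(1)] by simp
        next
          case 2
          have "dir (y - c) \<noteq> w" using 2(2) y(1) by (simp add: sec_def)
          then show ?thesis using h'[OF 2(1), of y] 2(2) y(1) dw[OF 2(1)] hS by simp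
        next
          case 3
          have "dir (x - c) \<noteq> w" using 3(1) x by (simp add: sec_def)
          then show ?thesis using walk_le_sym[OF h'[OF 3(2), of x]] 3(1) x dw[OF 3(2)] hS by (simp add: add.commute)
        next
          case 4
          then show ?thesis using inS[OF up] x y by blast
        qed
      qed
      show "walk_le E' x y (\<kappa> * (corner_dist (Suc n) c R (- w) x + g y))" if y: "y \<in> Y" for y
      proof (cases "x \<in> sec w")
        case True
        have "y \<notin> S" using y Suc.prems(7) by blast
        moreover have "w \<noteq> - w" using units_distinct(1)[OF w] by simp
        ultimately show ?thesis using h'[OF True, of y] y dw[OF True]
          by (simp add: h_def centre_dist_def algebra_simps)
      next
        case False
        then show ?thesis using inY[OF up] x y by blast
      qed
    qed
  qed
qed

end

section \<open>Steiner distances in coordinates\<close>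

lemma dir_cases:
  "dir z = 1 \<and> \<bar>Im z\<bar> < Re z \<or> dir z = - 1 \<and> \<bar>Im z\<bar> < - Re z \<or>
   dir z = \<i> \<and> \<bar>Re z\<bar> \<le> Im z \<or> dir z = - \<i> \<and> \<bar>Re z\<bar> \<le> - Im z \<and> Im z < 0"
  by (auto simp: dir_def)

lemma dir_arm: "\<bar>Im (z * cnj (dir z))\<bar> \<le> Re (z * cnj (dir z))"
  using dir_cases[of z] by (auto simp del: complex_cnj_mult)

lemma half_cancel: "2 * (R/2) = R" "R - (R - a) = a" for R a :: real
  by simp_all

lemma arm_leaf:
  fixes a b d R :: real
  assumes "d \<le> \<bar>a - R\<bar> + \<bar>b\<bar>" "a \<le> R"
  shows "d \<le> 2 * (R - a + \<bar>b\<bar>)" "d \<le> R - a + 5 * \<bar>b\<bar>"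
proof -
  have "d \<le> R - a + \<bar>b\<bar>" using assms by simp
  then show "d \<le> 2 * (R - a + \<bar>b\<bar>)" "d \<le> R - a + 5 * \<bar>b\<bar>" using assms(2) by auto
qed

lemma arm_same:
  fixes a b d R :: real
  assumes "d \<le> 2 * (R/2) \<and> d \<le> 2 * (R/2 - (a - R/2) + \<bar>b\<bar>) \<and> d \<le> R/2 - (a - R/2) + 5 * \<bar>b\<bar>" "0 \<le> R"
  shows "d \<le> 2 * R \<and> d \<le> 2 * (R - a + \<bar>b\<bar>) \<and> d \<le> R - a + 5 * \<bar>b\<bar>"
  using assms by auto

lemma arm_back:
  fixes a b B R :: real
  assumes "B \<le> R" "B \<le> - a + 5 * \<bar>b\<bar>" "\<bar>b\<bar> \<le> - a"
  shows "R + B \<le> 2 * R \<and> R + B \<le> 2 * (R - a + \<bar>b\<bar>) \<and> R + B \<le> R - a + 5 * \<bar>b\<bar>"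
  using assms by auto

lemma arm_side:
  fixes a b B R q :: real
  assumes "B \<le> R" "B \<le> 2 * (q + \<bar>a\<bar>)" "B \<le> q + 5 * \<bar>a\<bar>" "\<bar>a\<bar> \<le> q" "b = q \<or> b = - q"
  shows "R + B \<le> 2 * R \<and> R + B \<le> 2 * (R - a + \<bar>b\<bar>) \<and> R + B \<le> R - a + 5 * \<bar>b\<bar>"
proof -
  have b: "\<bar>b\<bar> = q" using assms(4,5) abs_ge_zero[of a] by auto
  have "a \<le> \<bar>a\<bar>" "- a \<le> \<bar>a\<bar>" "0 \<le> \<bar>a\<bar>" "a = \<bar>a\<bar> \<or> a = - \<bar>a\<bar>" by auto
  then show ?thesis using assms(1-4) unfolding b by (elim disjE) auto
qed

text \<open>\<open>Re z\<close> is measured along the diagonal through the corner and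
  \<open>Im z\<close> across it. The bounds are proved together because a turn into a side quarter
  exchanges these roles: the last bound then rests on the second one a level below.\<close>

lemma corner_dist_arm:
  assumes "x \<in> cell c R" "w \<in> units"
  defines "z \<equiv> (x - c) * cnj w"
  shows "corner_dist n c R w x \<le> 2 * R \<and> corner_dist n c R w x \<le> 2 * (R - Re z + \<bar>Im z\<bar>) \<and> corner_dist n c R w x \<le> R - Re z + 5 * \<bar>Im z\<bar>"
  using assms(1,2) unfolding z_def
proof (induction n arbitrary: c R w)
  case 0
  let ?z = "(x - c) * cnj w"
  have R: "0 \<le> R" "dist x c \<le> R" using 0(1) dist_centre[OF 0(1)] zero_le_dist[of x c] by linarith+
  have ww: "w * cnj w = 1" using 0(2) by (auto simp: units_def)
  have "x - (c + complex_of_real R * w) = (?z - complex_of_real R) * w"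
    using ww by (simp add: algebra_simps)
  then have "dist x (c + complex_of_real R * w) = cmod (?z - complex_of_real R)"
    using 0(2) by (simp add: dist_norm norm_mult unit_simps)
  also have "\<dots> \<le> \<bar>Re ?z - R\<bar> + \<bar>Im ?z\<bar>" using cmod_le[of "?z - complex_of_real R"] by simp
  finally have d: "dist x (c + complex_of_real R * w) \<le> \<bar>Re ?z - R\<bar> + \<bar>Im ?z\<bar>" .
  have "\<bar>Re ?z\<bar> \<le> cmod ?z" by (rule abs_Re_le_cmod)
  also have "\<dots> = dist x c" using 0(2) by (simp add: dist_norm norm_mult unit_simps)
  finally have "Re ?z \<le> R" using R by linarith
  moreover have "dist x (c + complex_of_real R * w) \<le> 2 * R"
    using dist_triangle[of x "c + complex_of_real R * w" c] dist_corner(1)[OF 0(2) R(1), of c] R(2) by linarith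
  ultimately have "dist x (c + complex_of_real R * w) \<le> 2 * R"
    "dist x (c + complex_of_real R * w) \<le> 2 * (R - Re ?z + \<bar>Im ?z\<bar>)"
    "dist x (c + complex_of_real R * w) \<le> R - Re ?z + 5 * \<bar>Im ?z\<bar>" using arm_leaf[OF d] by blast+
  then show ?case unfolding corner_dist.simps by blast
next
  case (Suc n)
  note w = Suc.prems(2)
  let ?z = "(x - c) * cnj w" and ?v = "dir (x - c)"
  note sub = sub_cell[OF Suc.prems(1)]
  show ?case
  proof (cases "?v = w")
    case True
    have "w * cnj w = 1" using w by (auto simp: units_def)
    then have "(x - sub_centre c R x) * cnj w = ?z - complex_of_real (R/2)"
      using True by (simp add: sub_centre_def algebra_simps)
    then have "Re ((x - sub_centre c R x) * cnj w) = Re ?z - R/2" "Im ((x - sub_centre c R x) * cnj w) = Im ?z"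
      by simp_all
    moreover have "0 \<le> R" using dist_centre[OF Suc.prems(1)] zero_le_dist[of x c] by linarith
    moreover have "corner_dist (Suc n) c R w x = corner_dist n (sub_centre c R x) (R/2) w x" using True by simp
    ultimately have r: "corner_dist (Suc n) c R w x = corner_dist n (sub_centre c R x) (R/2) w x" "0 \<le> R"
      "Re ((x - sub_centre c R x) * cnj w) = Re ?z - R/2" "Im ((x - sub_centre c R x) * cnj w) = Im ?z" by blast+
    note b = Suc.IH[OF sub w, unfolded r(3,4)]
    show ?thesis unfolding r(1) by (rule arm_same[OF b r(2)])
  next
    case False
    have vv: "?v * cnj ?v = 1" using dir_units[of "x - c"] by (auto simp: units_def simp del: dir_units)
    have "- ?v \<in> units" by simp
    note IH = Suc.IH[OF sub this]
    have "(x - sub_centre c R x) * cnj (- ?v) = complex_of_real (R/2) - (x - c) * cnj ?v"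
      using vv by (simp add: sub_centre_def algebra_simps)
    then have e: "Re ((x - sub_centre c R x) * cnj (- ?v)) = R/2 - Re ((x - c) * cnj ?v)"
       "Im ((x - sub_centre c R x) * cnj (- ?v)) = - Im ((x - c) * cnj ?v)" by simp_all
    define B where "B = corner_dist n (sub_centre c R x) (R/2) (- ?v) x"
    have B: "B \<le> R \<and> B \<le> 2 * (Re ((x - c) * cnj ?v) + \<bar>Im ((x - c) * cnj ?v)\<bar>) \<and>
        B \<le> Re ((x - c) * cnj ?v) + 5 * \<bar>Im ((x - c) * cnj ?v)\<bar>"
      using IH unfolding e B_def[symmetric] abs_minus_cancel half_cancel .
    note B = conjunct1[OF B] conjunct1[OF conjunct2[OF B]] conjunct2[OF conjunct2[OF B]]
    note a = dir_arm[of "x - c"]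
    have corner_dist: "corner_dist (Suc n) c R w x = R + B" using False by (simp add: B_def)
    have "?v = - w \<or> ?v = \<i> * w \<or> ?v = - \<i> * w"
      using units_cases[OF dir_units w False] by blast
    moreover have ?thesis if v: "?v = - w"
    proof -
      have "(x - c) * cnj ?v = - ?z" by (simp add: v)
      then have r: "Re ((x - c) * cnj ?v) = - Re ?z" "Im ((x - c) * cnj ?v) = - Im ?z"
        by (simp_all only: uminus_complex.sel)
      note b = B[unfolded r abs_minus_cancel] a[unfolded r abs_minus_cancel]
      show ?thesis unfolding corner_dist by (rule arm_back[OF b(1,3,4)])
    qed
    moreover have ?thesis if v: "?v = \<i> * w"
    proof -
      have "(x - c) * cnj ?v = - (\<i> * ?z)" by (simp add: v)
      then have r: "Re ((x - c) * cnj ?v) = Im ?z" "Im ((x - c) * cnj ?v) = - Re ?z"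
        by (simp_all only: Re_i_times Im_i_times uminus_complex.sel minus_minus)
      note b = B[unfolded r abs_minus_cancel] a[unfolded r abs_minus_cancel]
      show ?thesis unfolding corner_dist by (rule arm_side[OF b disjI1[OF HOL.refl]])
    qed
    moreover have ?thesis if v: "?v = - \<i> * w"
    proof -
      have "(x - c) * cnj ?v = \<i> * ?z" by (simp add: v)
      then have r: "Re ((x - c) * cnj ?v) = - Im ?z" "Im ((x - c) * cnj ?v) = Re ?z"
        by (simp_all only: Re_i_times Im_i_times)
      note b = B[unfolded r abs_minus_cancel] a[unfolded r abs_minus_cancel]
      show ?thesis unfolding corner_dist by (rule arm_side[OF b disjI2[OF minus_minus[symmetric]]])
    qed
    ultimately show ?thesis by blast
  qed
qed

lemma centre_dist_arm:
  assumes "x \<in> cell c R"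
  defines "z \<equiv> (x - c) * cnj (dir (x - c))"
  shows "centre_dist n c R x \<le> 2 * (Re z + \<bar>Im z\<bar>)" "centre_dist n c R x \<le> Re z + 5 * \<bar>Im z\<bar>"
proof -
  let ?v = "dir (x - c)"
  have vv: "?v * cnj ?v = 1" using dir_units[of "x - c"] by (auto simp: units_def simp del: dir_units)
  have "(x - sub_centre c R x) * cnj (- ?v) = complex_of_real (R/2) - z"
    using vv by (simp add: sub_centre_def z_def algebra_simps)
  then have e: "Re ((x - sub_centre c R x) * cnj (- ?v)) = R/2 - Re z"
     "Im ((x - sub_centre c R x) * cnj (- ?v)) = - Im z" by simp_all
  have "- ?v \<in> units" by simp
  from corner_dist_arm[OF sub_cell[OF assms(1)] this, of n]
  have I: "centre_dist n c R x \<le> R \<and> centre_dist n c R x \<le> 2 * (Re z + \<bar>Im z\<bar>) \<and> centre_dist n c R x \<le> Re z + 5 * \<bar>Im z\<bar>"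
    unfolding e abs_minus_cancel centre_dist_def half_cancel .
  show "centre_dist n c R x \<le> 2 * (Re z + \<bar>Im z\<bar>)" "centre_dist n c R x \<le> Re z + 5 * \<bar>Im z\<bar>"
    using conjunct1[OF conjunct2[OF I]] conjunct2[OF conjunct2[OF I]] .
qed

abbreviation horizontal :: "complex \<Rightarrow> bool" where "horizontal z \<equiv> \<bar>Im z\<bar> < \<bar>Re z\<bar>"

lemma horizontal_arm:
  "horizontal z \<Longrightarrow> Re (z * cnj (dir z)) = \<bar>Re z\<bar> \<and> \<bar>Im (z * cnj (dir z))\<bar> = \<bar>Im z\<bar>"
  by (auto simp: dir_def)

lemma vertical_arm:
  "\<not> horizontal z \<Longrightarrow> Re (z * cnj (dir z)) = \<bar>Im z\<bar> \<and> \<bar>Im (z * cnj (dir z))\<bar> = \<bar>Re z\<bar>"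
  by (auto simp: dir_def)

lemma dir_opposite:
  "dir z \<noteq> dir u \<Longrightarrow> horizontal z \<Longrightarrow> horizontal u \<Longrightarrow> \<bar>Re z - Re u\<bar> = \<bar>Re z\<bar> + \<bar>Re u\<bar>"
  "dir z \<noteq> dir u \<Longrightarrow> \<not> horizontal z \<Longrightarrow> \<not> horizontal u \<Longrightarrow> \<bar>Im z - Im u\<bar> = \<bar>Im z\<bar> + \<bar>Im u\<bar>"
  by (auto simp: dir_def split: if_splits)

lemma centre_dist_coord:
  assumes "x \<in> cell c R"
  shows "centre_dist n c R x \<le> 2 * (\<bar>Re (x - c)\<bar> + \<bar>Im (x - c)\<bar>)"
    "horizontal (x - c) \<Longrightarrow> centre_dist n c R x \<le> \<bar>Re (x - c)\<bar> + 5 * \<bar>Im (x - c)\<bar>"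
    "\<not> horizontal (x - c) \<Longrightarrow> centre_dist n c R x \<le> \<bar>Im (x - c)\<bar> + 5 * \<bar>Re (x - c)\<bar>"
proof -
  note corner_dist = centre_dist_arm[OF assms, of n]
  show "centre_dist n c R x \<le> 2 * (\<bar>Re (x - c)\<bar> + \<bar>Im (x - c)\<bar>)"
  proof (cases "horizontal (x - c)")
    case True
    show ?thesis using corner_dist(1) unfolding horizontal_arm[OF True, THEN conjunct1] horizontal_arm[OF True, THEN conjunct2] .
  next
    case False
    show ?thesis using corner_dist(1) unfolding vertical_arm[OF False, THEN conjunct1] vertical_arm[OF False, THEN conjunct2]
      by (simp only: add.commute)
  qed
  show "centre_dist n c R x \<le> \<bar>Re (x - c)\<bar> + 5 * \<bar>Im (x - c)\<bar>" if "horizontal (x - c)"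
    using corner_dist(2) horizontal_arm[OF that] by linarith
  show "centre_dist n c R x \<le> \<bar>Im (x - c)\<bar> + 5 * \<bar>Re (x - c)\<bar>" if "\<not> horizontal (x - c)"
    using corner_dist(2) vertical_arm[OF that] by linarith
qed

lemma sep_sign: "(a::real) * b \<le> 0 \<Longrightarrow> \<bar>a - b\<bar> = \<bar>a\<bar> + \<bar>b\<bar>"
  by (auto simp: mult_le_0_iff)

lemma sep_arith:
  fixes X Y X' Y' P Q d d' :: real
  assumes "0 \<le> X" "0 \<le> Y" "0 \<le> X'" "0 \<le> Y'" "Y \<le> Y' + Q" "Y' \<le> Y + Q" "0 \<le> Q" "P = X + X'"
    and d: "d \<le> 2 * X + 2 * Y" "d' \<le> 2 * X' + 2 * Y'" "v \<Longrightarrow> d \<le> Y + 5 * X" "v' \<Longrightarrow> d' \<le> Y' + 5 * X'"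
    and v: "\<not> v \<Longrightarrow> Y \<le> X" "\<not> v' \<Longrightarrow> Y' \<le> X'" "v \<Longrightarrow> v' \<Longrightarrow> Q = Y + Y'"
  shows "d + d' \<le> 5 * P + Q"
proof -
  consider "v" "v'" | "v" "\<not> v'" | "\<not> v" "v'" | "\<not> v" "\<not> v'" by blast
  then show ?thesis
  proof cases
    case 1 show ?thesis using assms(1-8) d(3)[OF 1(1)] d(4)[OF 1(2)] v(3)[OF 1] by linarith
  next
    case 2 show ?thesis using assms(1-8) d(2) d(3)[OF 2(1)] v(2)[OF 2(2)] by linarith
  next
    case 3 show ?thesis using assms(1-8) d(1) d(4)[OF 3(2)] v(1)[OF 3(1)] by linarith
  next
    case 4 show ?thesis using assms(1-8) d(1,2) v(1)[OF 4(1)] v(2)[OF 4(2)] by linarith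
  qed
qed

text \<open>Across the separating axis the coordinates of the two points add up and can bear the
  factor 5; along the axis only their difference is available, with factor 1.\<close>

lemma tree_dist_sep:
  assumes x: "x \<in> cell c R" and y: "y \<in> cell c R" and dd: "dir (x - c) \<noteq> dir (y - c)"
  shows "Re (x - c) * Re (y - c) \<le> 0 \<Longrightarrow> centre_dist n c R x + centre_dist n c R y \<le> 5 * \<bar>Re (x - y)\<bar> + \<bar>Im (x - y)\<bar>"
    "Im (x - c) * Im (y - c) \<le> 0 \<Longrightarrow> centre_dist n c R x + centre_dist n c R y \<le> \<bar>Re (x - y)\<bar> + 5 * \<bar>Im (x - y)\<bar>"
proof -
  have e: "Re (x - y) = Re (x - c) - Re (y - c)" "Im (x - y) = Im (x - c) - Im (y - c)" by simp_all
  define X Y X' Y' where d: "X = \<bar>Re (x - c)\<bar>" "Y = \<bar>Im (x - c)\<bar>" "X' = \<bar>Re (y - c)\<bar>" "Y' = \<bar>Im (y - c)\<bar>"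
  define P Q where PQ: "P = \<bar>Re (x - y)\<bar>" "Q = \<bar>Im (x - y)\<bar>"
  have nn: "0 \<le> X" "0 \<le> Y" "0 \<le> X'" "0 \<le> Y'" by (simp_all only: d abs_ge_zero)
  have tri: "X \<le> X' + P" "X' \<le> X + P" "Y \<le> Y' + Q" "Y' \<le> Y + Q" unfolding d PQ e by linarith+
  have Q0: "0 \<le> P" "0 \<le> Q" by (simp_all only: PQ abs_ge_zero)
  note o = dir_opposite[OF dd, folded e d PQ]
  note corner_dist = centre_dist_coord[OF x, of n, folded d] centre_dist_coord[OF y, of n, folded d]
  show "centre_dist n c R x + centre_dist n c R y \<le> 5 * \<bar>Re (x - y)\<bar> + \<bar>Im (x - y)\<bar>" if "Re (x - c) * Re (y - c) \<le> 0"
  proof -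
    have s: "P = X + X'" using sep_sign[OF that] unfolding PQ e d .
    show ?thesis unfolding PQ[symmetric]
      using sep_arith[of X Y X' Y' Q P "centre_dist n c R x" "centre_dist n c R y" "\<not> Y < X" "\<not> Y' < X'"] corner_dist o(2) nn tri s Q0 by simp
  qed
  show "centre_dist n c R x + centre_dist n c R y \<le> \<bar>Re (x - y)\<bar> + 5 * \<bar>Im (x - y)\<bar>" if "Im (x - c) * Im (y - c) \<le> 0"
  proof -
    have s: "Q = Y + Y'" using sep_sign[OF that] unfolding PQ e d .
    show ?thesis unfolding PQ[symmetric]
      using sep_arith[of Y X Y' X' P Q "centre_dist n c R x" "centre_dist n c R y" "Y < X" "Y' < X'"] corner_dist o(1) nn tri s Q0
      by (simp add: add.commute)
  qed
qed


lemma dir_sign: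
  "dir z = 1 \<Longrightarrow> 0 < Re z" "dir z = - 1 \<Longrightarrow> Re z < 0" "dir z = - \<i> \<Longrightarrow> Im z < 0"
  "dir z = \<i> \<Longrightarrow> \<bar>Re z\<bar> \<le> Im z"
  by (auto simp: dir_def complex_eq_iff split: if_splits)

lemma same_dir_horizontal:
  assumes "dir z = dir u" "dir z = 1 \<or> dir z = - 1"
  shows "0 < Re z * Re u"
  using assms(2)
proof
  assume "dir z = 1"
  then show ?thesis using dir_sign(1)[of z] dir_sign(1)[of u] assms(1) by (intro mult_pos_pos) simp_all
next
  assume "dir z = - 1"
  then show ?thesis using dir_sign(2)[of z] dir_sign(2)[of u] assms(1) by (intro mult_neg_neg) simp_all
qed

text \<open>A vertical quarter touches the horizontal axis only in the centre, so that axis can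
  separate two of its points only in this degenerate way.\<close>

lemma same_dir_vertical:
  assumes "dir z = dir u" "dir z = \<i> \<or> dir z = - \<i>" "Im z * Im u \<le> 0"
  shows "z = 0 \<and> \<bar>Re u\<bar> \<le> \<bar>Im u\<bar> \<or> u = 0 \<and> \<bar>Re z\<bar> \<le> \<bar>Im z\<bar>"
  using assms(2)
proof
  assume z: "dir z = \<i>"
  have le: "\<bar>Re z\<bar> \<le> Im z" "\<bar>Re u\<bar> \<le> Im u" using dir_sign(4) z assms(1) by simp_all
  have "Im z = 0 \<or> Im u = 0"
  proof (rule ccontr)
    assume "\<not> ?thesis"
    then have "0 < Im z" "0 < Im u" using le abs_ge_zero[of "Re z"] abs_ge_zero[of "Re u"] by linarith+
    then show False using mult_pos_pos assms(3) by fastforce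
  qed
  then have "z = 0 \<or> u = 0" using le by (auto simp: complex_eq_iff)
  then show ?thesis using le by linarith
next
  assume "dir z = - \<i>"
  then have "Im z < 0" "Im u < 0" using dir_sign(3) assms(1) by simp_all
  then show ?thesis using assms(3) mult_neg_neg[of "Im z" "Im u"] by simp
qed

text \<open>While both points descend into the same quarter, it lies above or below \<open>c\<close>
  and its centre is on the same axis; so the axis still separates them where they part.\<close>

lemma tree_dist_vertical_axis:
  assumes "x \<in> cell c R" "y \<in> cell c R" "Re (x - c) * Re (y - c) \<le> 0"
  shows "tree_dist n c R x y \<le> 5 * \<bar>Re (x - y)\<bar> + \<bar>Im (x - y)\<bar>"
  using assms
proof (induction n arbitrary: c R)
  case (Suc n)
  show ?case
  proof (cases "dir (x - c) = dir (y - c)")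
    case True
    let ?c = "sub_centre c R x"
    have c: "?c = sub_centre c R y" using True by (simp add: sub_centre_def)
    have "dir (x - c) = \<i> \<or> dir (x - c) = - \<i>"
      using same_dir_horizontal[OF True] Suc.prems(3) dir_cases[of "x - c"] by force
    then have "Re ?c = Re c" by (auto simp: sub_centre_def)
    then have "tree_dist n ?c (R/2) x y \<le> 5 * \<bar>Re (x - y)\<bar> + \<bar>Im (x - y)\<bar>"
      using Suc.prems sub_cell[of y c R] by (intro Suc.IH) (simp_all add: sub_cell c[symmetric])
    then show ?thesis using True by simp
  next
    case False
    then show ?thesis using tree_dist_sep(1)[OF Suc.prems(1,2) False Suc.prems(3)] by simp
  qed
qed simp

lemma tree_dist_horizontal_axis:
  assumes "x \<in> cell c R" "y \<in> cell c R" "Im (x - c) * Im (y - c) \<le> 0"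
  shows "tree_dist n c R x y \<le> \<bar>Re (x - y)\<bar> + 5 * \<bar>Im (x - y)\<bar>"
  using assms
proof (induction n arbitrary: c R)
  case (Suc n)
  show ?case
  proof (cases "dir (x - c) = dir (y - c)")
    case True
    let ?c = "sub_centre c R x"
    have c: "?c = sub_centre c R y" using True by (simp add: sub_centre_def)
    have sub: "x \<in> cell ?c (R/2)" "y \<in> cell ?c (R/2)"
      using sub_cell[OF Suc.prems(1)] sub_cell[OF Suc.prems(2)] by (simp_all add: c[symmetric])
    show ?thesis
    proof (cases "dir (x - c) = \<i> \<or> dir (x - c) = - \<i>")
      case v: True
      \<comment> \<open>By the tie rule of \<open>dir\<close> one of the points is the centre \<open>c\<close>, which lies on the vertical axis of the subcell.\<close>
      have "x = c \<and> \<bar>Re (y - c)\<bar> \<le> \<bar>Im (y - c)\<bar> \<or> y = c \<and> \<bar>Re (x - c)\<bar> \<le> \<bar>Im (x - c)\<bar>"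
        using same_dir_vertical[OF True v Suc.prems(3)] by (simp only: right_minus_eq)
      then have le: "\<bar>Re (x - y)\<bar> \<le> \<bar>Im (x - y)\<bar>" and z: "Re (x - c) = 0 \<or> Re (y - c) = 0" by auto
      have "Re ?c = Re c" using v by (auto simp: sub_centre_def)
      then have "Re (x - ?c) * Re (y - ?c) \<le> 0" using z by auto
      from tree_dist_vertical_axis[OF sub this, of n] show ?thesis using True le by simp
    next
      case False
      then have "dir (x - c) = 1 \<or> dir (x - c) = - 1" using dir_cases[of "x - c"] by blast
      then have "Im ?c = Im c" by (auto simp: sub_centre_def)
      then have "tree_dist n ?c (R/2) x y \<le> \<bar>Re (x - y)\<bar> + 5 * \<bar>Im (x - y)\<bar>"
        using Suc.prems(3) sub by (intro Suc.IH) simp_all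
      then show ?thesis using True by simp
    qed
  next
    case False
    then show ?thesis using tree_dist_sep(2)[OF Suc.prems(1,2) False Suc.prems(3)] by simp
  qed
qed simp

section \<open>Diamonds aligned with the lattice of cell centres\<close>

lemma dir_signs:
  assumes "Re z + Im z \<noteq> 0" "Re z - Im z \<noteq> 0"
  shows "dir z = (if 0 < Re z + Im z then if 0 < Re z - Im z then 1 else \<i> else if 0 < Re z - Im z then - \<i> else - 1)"
  using assms by (auto simp: dir_def)

lemma sign_odd:
  fixes s d :: real
  assumes "odd (m::int)" "\<bar>d\<bar> < s"
  shows "s * real_of_int m + d \<noteq> 0" "0 < s * real_of_int m + d \<longleftrightarrow> 0 < m"
proof -
  have s: "0 < s" using assms(2) by linarith
  have "1 \<le> m \<or> m \<le> - 1" using assms(1) by presburger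
  then consider "1 \<le> m" | "m \<le> - 1" by blast
  then have "0 < m \<and> s \<le> s * real_of_int m \<or> m < 0 \<and> s * real_of_int m \<le> - s"
  proof cases
    case 1
    then have "s * 1 \<le> s * real_of_int m" using s by (intro mult_left_mono) auto
    then show ?thesis using 1 by simp
  next
    case 2
    then have "real_of_int m \<le> - 1" by linarith
    then have "s * real_of_int m \<le> s * - 1" using s by (intro mult_left_mono) auto
    then show ?thesis using 2 by simp
  qed
  then show "s * real_of_int m + d \<noteq> 0" "0 < s * real_of_int m + d \<longleftrightarrow> 0 < m" using assms(2) by auto
qed

text \<open>The diamond \<open>cell q s\<close> lies on the lattice of the diamonds of the tree rooted at \<open>c\<close>, so that no larger
  cell separates two points in its interior.\<close>

lemma tree_dist_lattice_cell:
  assumes "x \<in> cell c R" "y \<in> cell c R" "R = 2 ^ j * s"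
    and "\<bar>Re (x - q)\<bar> + \<bar>Im (x - q)\<bar> < s" "\<bar>Re (y - q)\<bar> + \<bar>Im (y - q)\<bar> < s"
    and "q - c = Complex (s * real_of_int a) (s * real_of_int b)" "even (a + b) \<longleftrightarrow> j = 0"
    and "Re (x - q) * Re (y - q) \<le> 0 \<and> B = 5 * \<bar>Re (x - y)\<bar> + \<bar>Im (x - y)\<bar> \<or>
      Im (x - q) * Im (y - q) \<le> 0 \<and> B = \<bar>Re (x - y)\<bar> + 5 * \<bar>Im (x - y)\<bar>"
  shows "tree_dist n c R x y \<le> B"
  using assms(1-3,6,7)
proof (induction n arbitrary: c R j a b)
  case 0
  then show ?case using assms(8) by auto
next
  case (Suc n)
  have s: "0 < s" using assms(4) by linarith
  have qc: "Re q - Re c = s * real_of_int a" "Im q - Im c = s * real_of_int b"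
    using Suc.prems(4) by (simp_all add: complex_eq_iff)
  show ?case
  proof (cases j)
    case 0
    have R: "R = s" using 0 Suc.prems(3) by simp
    have x: "\<bar>Re x - Re c\<bar> + \<bar>Im x - Im c\<bar> \<le> s" "\<bar>Re x - Re q\<bar> + \<bar>Im x - Im q\<bar> < s"
      using Suc.prems(1) assms(4) by (simp_all add: cell_def R)
    have "\<bar>s * real_of_int (a + b)\<bar> < s * 2" "\<bar>s * real_of_int (a - b)\<bar> < s * 2"
      using x qc by (simp_all add: distrib_left right_diff_distrib)
    then have "\<bar>real_of_int (a + b)\<bar> < 2" "\<bar>real_of_int (a - b)\<bar> < 2"
      using s by (simp_all only: abs_mult abs_of_pos mult_less_cancel_left_pos)
    \<comment> \<open>On the level of the diamond itself parity leaves \<open>q = c\<close> as the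
      only cell that can contain \<open>x\<close>.\<close>
    then have "\<bar>a + b\<bar> < 2" "\<bar>a - b\<bar> < 2" by linarith+
    moreover have "even (a + b)" "even (a - b)" using 0 Suc.prems(5) by simp_all
    ultimately have "a + b = 0" "a - b = 0" by presburger+
    then have "q = c" using qc by (simp add: complex_eq_iff)
    then show ?thesis
      using assms(8) tree_dist_vertical_axis[OF Suc.prems(1,2), of "Suc n"] tree_dist_horizontal_axis[OF Suc.prems(1,2), of "Suc n"]
      by blast
  next
    case (Suc j')
    \<comment> \<open>Odd \<open>a + b\<close> and \<open>a - b\<close> keep \<open>q\<close> so far
      from both diagonals through \<open>c\<close> that the open diamond around it crosses neither;
      hence \<open>x\<close> and \<open>y\<close> share a quarter.\<close>
    have odd: "odd (a + b)" "odd (a - b)" using Suc Suc.prems(5) by simp_all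
    have sg: "dir (z - c) = (if 0 < a + b then if 0 < a - b then 1 else \<i> else if 0 < a - b then - \<i> else - 1)"
      if z: "\<bar>Re (z - q)\<bar> + \<bar>Im (z - q)\<bar> < s" for z
    proof -
      have d: "\<bar>Re (z - q) + Im (z - q)\<bar> < s" "\<bar>Re (z - q) - Im (z - q)\<bar> < s" using z by linarith+
      have e: "Re (z - c) + Im (z - c) = s * real_of_int (a + b) + (Re (z - q) + Im (z - q))"
        "Re (z - c) - Im (z - c) = s * real_of_int (a - b) + (Re (z - q) - Im (z - q))"
        using qc by (simp_all add: distrib_left right_diff_distrib)
      note o = sign_odd[OF odd(1) d(1), folded e] sign_odd[OF odd(2) d(2), folded e]
      show ?thesis using dir_signs[OF o(1,3)] unfolding o(2,4) .
    qed
    have dd: "dir (x - c) = dir (y - c)"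
      unfolding sg[OF assms(4)] sg[OF assms(5)] ..
    let ?c = "sub_centre c R x"
    have c: "?c = sub_centre c R y" using dd by (simp add: sub_centre_def)
    have sub: "x \<in> cell ?c (R/2)" "y \<in> cell ?c (R/2)"
      using sub_cell[OF Suc.prems(1)] sub_cell[OF Suc.prems(2)] by (simp_all add: c[symmetric])
    have R2: "R/2 = 2 ^ j' * s" using Suc Suc.prems(3) by simp
    obtain e f :: int where v: "dir (x - c) = Complex (real_of_int e) (real_of_int f)" "odd (e + f)"
    proof -
      have "dir (x - c) = 1 \<or> dir (x - c) = - 1 \<or> dir (x - c) = \<i> \<or> dir (x - c) = - \<i>"
        using dir_units[of "x - c"] by (auto simp: units_def simp del: dir_units)
      then show thesis
        using that[of 1 0] that[of "- 1" 0] that[of 0 1] that[of 0 "- 1"] by (auto simp: complex_eq_iff)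
    qed
    have "tree_dist n ?c (R/2) x y \<le> B"
    proof (rule Suc.IH[OF sub R2])
      show "q - ?c = Complex (s * real_of_int (a - 2 ^ j' * e)) (s * real_of_int (b - 2 ^ j' * f))"
        using qc by (simp add: sub_centre_def v(1) R2 complex_eq_iff algebra_simps)
      \<comment> \<open>The shift of the centre has even coordinate sum except at the last step,
        \<open>j' = 0\<close>, where the odd \<open>e + f\<close> flips the parity.\<close>
      show "even ((a - 2 ^ j' * e) + (b - 2 ^ j' * f)) \<longleftrightarrow> j' = 0"
        using odd(1) v(2) by (cases j') auto
    qed
    then show ?thesis using dd by simp
  qed
qed

section \<open>Points in different quarters, in diagonal coordinates\<close>

lemma dir_quadrant:
  "dir z = 1 \<Longrightarrow> 0 < Re z - Im z \<and> 0 < Re z + Im z"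
  "dir z = - 1 \<Longrightarrow> Re z - Im z < 0 \<and> Re z + Im z < 0"
  "dir z = \<i> \<Longrightarrow> Re z - Im z \<le> 0 \<and> 0 \<le> Re z + Im z"
  "dir z = - \<i> \<Longrightarrow> 0 \<le> Re z - Im z \<and> Re z + Im z \<le> 0"
  by (auto simp: dir_def complex_eq_iff split: if_splits)

text \<open>In the diagonal coordinates \<open>U - V\<close> and \<open>U + V\<close>, the sum of
  the moduli of \<open>U\<close> and \<open>V\<close> becomes a maximum and their difference a
  minimum.\<close>

lemma max_min_arith:
  fixes U V d :: real
  assumes "d \<le> 2 * (\<bar>U\<bar> + \<bar>V\<bar>)" "\<bar>V\<bar> < \<bar>U\<bar> \<Longrightarrow> d \<le> \<bar>U\<bar> + 5 * \<bar>V\<bar>" "\<not> \<bar>V\<bar> < \<bar>U\<bar> \<Longrightarrow> d \<le> \<bar>V\<bar> + 5 * \<bar>U\<bar>"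
  shows "d \<le> 2 * max \<bar>U - V\<bar> \<bar>U + V\<bar>"
    "d \<le> 3 * max \<bar>U - V\<bar> \<bar>U + V\<bar> - 2 * min \<bar>U - V\<bar> \<bar>U + V\<bar>"
proof -
  have m: "max \<bar>U - V\<bar> \<bar>U + V\<bar> = \<bar>U\<bar> + \<bar>V\<bar>" "min \<bar>U - V\<bar> \<bar>U + V\<bar> = \<bar>\<bar>U\<bar> - \<bar>V\<bar>\<bar>"
    by (auto simp: max_def min_def abs_if)
  show "d \<le> 2 * max \<bar>U - V\<bar> \<bar>U + V\<bar>" using assms(1) unfolding m .
  show "d \<le> 3 * max \<bar>U - V\<bar> \<bar>U + V\<bar> - 2 * min \<bar>U - V\<bar> \<bar>U + V\<bar>"
    unfolding m using assms(2,3) by (cases "\<bar>V\<bar> < \<bar>U\<bar>") simp_all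
qed

lemma adjacent_arith:
  fixes A B A' B' d d' :: real
  assumes "0 \<le> A" "0 \<le> A'" "0 \<le> B" "0 \<le> B'"
    and d: "d \<le> 2 * max A B" "d \<le> 3 * max A B - 2 * min A B" "d' \<le> 2 * max A' B'" "d' \<le> 3 * max A' B' - 2 * min A' B'"
    and "B \<le> A \<or> B' \<le> A'"
  shows "d + d' \<le> 3 * (A + A') + 2 * \<bar>B - B'\<bar>"
proof -
  define z where "z = \<bar>B - B'\<bar>"
  have ab: "B - B' \<le> z" "B' - B \<le> z" "0 \<le> z" by (simp_all add: z_def)
  consider "B \<le> A" "B' \<le> A'" | "B \<le> A" "A' \<le> B'" | "A \<le> B" "B' \<le> A'" using assms(9) by linarith
  then show ?thesis
  proof cases
    case 1
    then have "max A B = A" "max A' B' = A'" by auto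
    then have "d \<le> 2 * A" "d' \<le> 2 * A'" using d by simp_all
    then show ?thesis unfolding z_def[symmetric] distrib_left using assms(1,2) ab(3) by linarith
  next
    case 2
    then have "max A B = A" "min A B = B" "max A' B' = B'" by auto
    then have "d \<le> 3 * A - 2 * B" "d' \<le> 2 * B'" using d by simp_all
    then show ?thesis unfolding z_def[symmetric] distrib_left using ab assms(2) by linarith
  next
    case 3
    then have "max A' B' = A'" "min A' B' = B'" "max A B = B" by auto
    then have "d' \<le> 3 * A' - 2 * B'" "d \<le> 2 * B" using d by simp_all
    then show ?thesis unfolding z_def[symmetric] distrib_left using ab assms(1) by linarith
  qed
qed

lemma opposite_arith:
  fixes A B A' B' d d' :: real
  assumes "0 \<le> A" "0 \<le> A'" "0 \<le> B" "0 \<le> B'" "d \<le> 2 * max A B" "d' \<le> 2 * max A' B'"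
  shows "d + d' \<le> 3 * (A + A') + 2 * (B + B')"
proof -
  have "max A B \<le> A + B" "max A' B' \<le> A' + B'" using assms(1-4) by simp_all
  then show ?thesis unfolding distrib_left using assms by linarith
qed

lemma same_sign_abs:
  fixes a b :: real
  assumes "0 \<le> a * b"
  shows "a = \<bar>a\<bar> \<and> b = \<bar>b\<bar> \<or> - a = \<bar>a\<bar> \<and> - b = \<bar>b\<bar>"
  using assms by (auto simp: zero_le_mult_iff)

lemma abs_add_le: "\<bar>a\<bar> + \<bar>b\<bar> \<le> R \<Longrightarrow> \<bar>a - b\<bar> \<le> R \<and> \<bar>a + b\<bar> \<le> R" for a b R :: real
  by auto

lemma same_sign: "0 \<le> (a::real) * b \<Longrightarrow> \<bar>\<bar>a\<bar> - \<bar>b\<bar>\<bar> = \<bar>a - b\<bar>"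
  by (auto simp: zero_le_mult_iff abs_if)

text \<open>In the coordinates \<open>X\<close> and \<open>Y\<close> the cell is an axis-parallel
  square. If one axis separates the points, weights 3 and 2 suffice once some point is at least as
  far from that axis as from the other. The last two alternatives are what remains: both points in
  one triangle spanned by the centre and a side.\<close>

lemma tree_dist_sep_diagonal:
  assumes x: "x \<in> cell c R" and y: "y \<in> cell c R" and dd: "dir (x - c) \<noteq> dir (y - c)"
    and X: "X = Re (x - c) - Im (x - c)" "Y = Re (x - c) + Im (x - c)"
    and X': "X' = Re (y - c) - Im (y - c)" "Y' = Re (y - c) + Im (y - c)"
  shows "centre_dist n c R x + centre_dist n c R y \<le> 3 * \<bar>X - X'\<bar> + 2 * \<bar>Y - Y'\<bar> \<or>
    centre_dist n c R x + centre_dist n c R y \<le> 2 * \<bar>X - X'\<bar> + 3 * \<bar>Y - Y'\<bar> \<or>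
    X * X' \<le> 0 \<and> (\<bar>X\<bar> < Y \<and> \<bar>X'\<bar> < Y' \<or> \<bar>X\<bar> < - Y \<and> \<bar>X'\<bar> < - Y') \<or>
    Y * Y' \<le> 0 \<and> (\<bar>Y\<bar> < X \<and> \<bar>Y'\<bar> < X' \<or> \<bar>Y\<bar> < - X \<and> \<bar>Y'\<bar> < - X')"
proof -
  note m = max_min_arith[OF centre_dist_coord[OF x, of n], folded X] max_min_arith[OF centre_dist_coord[OF y, of n], folded X']
  have dx: "dir (x - c) = 1 \<or> dir (x - c) = - 1 \<or> dir (x - c) = \<i> \<or> dir (x - c) = - \<i>"
    and dy: "dir (y - c) = 1 \<or> dir (y - c) = - 1 \<or> dir (y - c) = \<i> \<or> dir (y - c) = - \<i>"
    using dir_cases[of "x - c"] dir_cases[of "y - c"] by blast+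
  note q = dir_quadrant[of "x - c", folded X] and q' = dir_quadrant[of "y - c", folded X']
  have "X * X' \<le> 0 \<and> Y * Y' \<le> 0 \<or> X * X' \<le> 0 \<and> 0 \<le> Y * Y' \<or> Y * Y' \<le> 0 \<and> 0 \<le> X * X'"
    using dx dy dd
    by (elim disjE) (use q q' in \<open>auto simp: mult_le_0_iff zero_le_mult_iff\<close>)
  then consider "X * X' \<le> 0" "Y * Y' \<le> 0" | "X * X' \<le> 0" "0 \<le> Y * Y'" | "Y * Y' \<le> 0" "0 \<le> X * X'" by blast
  then show ?thesis
  proof cases
    case 1
    note s = sep_sign[OF 1(1)] sep_sign[OF 1(2)]
    have "centre_dist n c R x + centre_dist n c R y \<le> 3 * \<bar>X - X'\<bar> + 2 * \<bar>Y - Y'\<bar>"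
      unfolding s by (rule opposite_arith[OF abs_ge_zero abs_ge_zero abs_ge_zero abs_ge_zero m(1,3)])
    then show ?thesis by blast
  next
    case 2
    show ?thesis
    proof (cases "\<bar>Y\<bar> \<le> \<bar>X\<bar> \<or> \<bar>Y'\<bar> \<le> \<bar>X'\<bar>")
      case True
      from adjacent_arith[OF abs_ge_zero abs_ge_zero abs_ge_zero abs_ge_zero m True]
      show ?thesis unfolding sep_sign[OF 2(1), symmetric] same_sign[OF 2(2)] by blast
    next
      case False
      then have "\<bar>X\<bar> < \<bar>Y\<bar>" "\<bar>X'\<bar> < \<bar>Y'\<bar>" by (simp_all only: de_Morgan_disj not_le)
      then have "\<bar>X\<bar> < Y \<and> \<bar>X'\<bar> < Y' \<or> \<bar>X\<bar> < - Y \<and> \<bar>X'\<bar> < - Y'"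
        using same_sign_abs[OF 2(2)] by metis
      then show ?thesis using 2(1) by blast
    qed
  next
    case 3
    show ?thesis
    proof (cases "\<bar>X\<bar> \<le> \<bar>Y\<bar> \<or> \<bar>X'\<bar> \<le> \<bar>Y'\<bar>")
      case True
      note m' = m[unfolded max.commute[of "\<bar>X\<bar>"] max.commute[of "\<bar>X'\<bar>"] min.commute[of "\<bar>X\<bar>"] min.commute[of "\<bar>X'\<bar>"]]
      from adjacent_arith[OF abs_ge_zero abs_ge_zero abs_ge_zero abs_ge_zero m' True]
      show ?thesis unfolding sep_sign[OF 3(1), symmetric] same_sign[OF 3(2)] by (simp only: add.commute) blast
    next
      case False
      then have "\<bar>Y\<bar> < \<bar>X\<bar>" "\<bar>Y'\<bar> < \<bar>X'\<bar>" by (simp_all only: de_Morgan_disj not_le)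
      then have "\<bar>Y\<bar> < X \<and> \<bar>Y'\<bar> < X' \<or> \<bar>Y\<bar> < - X \<and> \<bar>Y'\<bar> < - X'"
        using same_sign_abs[OF 3(2)] by metis
      then show ?thesis using 3(1) by blast
    qed
  qed
qed

section \<open>The rotated tree and the stretch of the pair\<close>

definition rot :: "complex \<Rightarrow> complex" where
  "rot z = Complex ((Re z - Im z) / sqrt 2) ((Re z + Im z) / sqrt 2)"

lemma rot_diff: "rot x - rot y = rot (x - y)"
  by (simp add: rot_def complex_eq_iff diff_divide_distrib add_divide_distrib)

lemma cmod_rot: "cmod (rot z) = cmod z"
proof -
  have "((Re z - Im z) / sqrt 2)\<^sup>2 + ((Re z + Im z) / sqrt 2)\<^sup>2 = (Re z)\<^sup>2 + (Im z)\<^sup>2"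
    by (simp add: power_divide power2_eq_square field_simps)
  then show ?thesis by (simp add: rot_def cmod_def)
qed

lemma dist_rot: "dist (rot x) (rot y) = dist x y"
  by (simp add: dist_norm rot_diff cmod_rot)

lemma cauchy_schwarz_13:
  fixes p q :: real
  shows "3 * \<bar>p\<bar> + 2 * \<bar>q\<bar> \<le> sqrt (13 * (p\<^sup>2 + q\<^sup>2))"
proof (rule real_le_rsqrt)
  have "0 \<le> (2 * \<bar>p\<bar> - 3 * \<bar>q\<bar>)\<^sup>2" by simp
  then show "(3 * \<bar>p\<bar> + 2 * \<bar>q\<bar>)\<^sup>2 \<le> 13 * (p\<^sup>2 + q\<^sup>2)"
    by (simp add: power2_sum power2_diff power_mult_distrib)
qed

lemma diagonal_le:
  fixes z :: complex
  shows "3 * \<bar>Re z - Im z\<bar> + 2 * \<bar>Re z + Im z\<bar> \<le> sqrt 26 * cmod z"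
    "2 * \<bar>Re z - Im z\<bar> + 3 * \<bar>Re z + Im z\<bar> \<le> sqrt 26 * cmod z"
proof -
  have e: "13 * ((Re z - Im z)\<^sup>2 + (Re z + Im z)\<^sup>2) = 26 * (cmod z)\<^sup>2"
    by (simp add: cmod_power2 power2_sum power2_diff)
  have s: "sqrt (26 * (cmod z)\<^sup>2) = sqrt 26 * cmod z" by (simp add: real_sqrt_mult)
  show "3 * \<bar>Re z - Im z\<bar> + 2 * \<bar>Re z + Im z\<bar> \<le> sqrt 26 * cmod z"
    using cauchy_schwarz_13[of "Re z - Im z" "Re z + Im z"] unfolding e s .
  show "2 * \<bar>Re z - Im z\<bar> + 3 * \<bar>Re z + Im z\<bar> \<le> sqrt 26 * cmod z"
    using cauchy_schwarz_13[of "Re z + Im z" "Re z - Im z"] unfolding add.commute[of "(Re z + Im z)\<^sup>2"] e s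
    by simp
qed

lemma axis_le:
  fixes z :: complex
  shows "5 * \<bar>Re z\<bar> + \<bar>Im z\<bar> \<le> sqrt 26 * cmod z" "\<bar>Re z\<bar> + 5 * \<bar>Im z\<bar> \<le> sqrt 26 * cmod z"
proof -
  have s: "sqrt (26 * (cmod z)\<^sup>2) = sqrt 26 * cmod z" by (simp add: real_sqrt_mult)
  have "0 \<le> (\<bar>Re z\<bar> - 5 * \<bar>Im z\<bar>)\<^sup>2" "0 \<le> (5 * \<bar>Re z\<bar> - \<bar>Im z\<bar>)\<^sup>2" by simp_all
  then have "(5 * \<bar>Re z\<bar> + \<bar>Im z\<bar>)\<^sup>2 \<le> 26 * (cmod z)\<^sup>2" "(\<bar>Re z\<bar> + 5 * \<bar>Im z\<bar>)\<^sup>2 \<le> 26 * (cmod z)\<^sup>2"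
    by (simp_all add: cmod_power2 power2_sum power2_diff power_mult_distrib)
  then show "5 * \<bar>Re z\<bar> + \<bar>Im z\<bar> \<le> sqrt 26 * cmod z" "\<bar>Re z\<bar> + 5 * \<bar>Im z\<bar> \<le> sqrt 26 * cmod z"
    using real_le_rsqrt s by metis+
qed

lemma dir_ints:
  obtains e f :: int where "dir z = Complex (real_of_int e) (real_of_int f)" "odd (e + f)"
proof -
  have "dir z = 1 \<or> dir z = - 1 \<or> dir z = \<i> \<or> dir z = - \<i>" using dir_cases[of z] by blast
  then show thesis
    using that[of 1 0] that[of "- 1" 0] that[of 0 1] that[of 0 "- 1"] by (auto simp: complex_eq_iff)
qed

text \<open>Where the first tree separates \<open>x\<close> and \<open>y\<close> badly, both lie in a triangle spanned by the centre and a
  side of the square, hence in a diamond of the second tree, one of whose axes separates them.\<close>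

lemma tree_dist_cover:
  assumes "x \<in> cell c R" "y \<in> cell c R" "0 < R" "c = Complex (R * real_of_int a) (R * real_of_int b)"
    and "rot x \<in> cell 0 R'" "rot y \<in> cell 0 R'" "R' = 2 ^ j * (R / sqrt 2)" "j \<noteq> 0"
  shows "tree_dist n c R x y \<le> sqrt 26 * dist x y \<or> tree_dist m 0 R' (rot x) (rot y) \<le> sqrt 26 * dist x y"
  using assms
proof (induction n arbitrary: c R a b j)
  case (Suc n)
  show ?case
  proof (cases "dir (x - c) = dir (y - c)")
    case True
    let ?c = "sub_centre c R x"
    have c: "?c = sub_centre c R y" using True by (simp add: sub_centre_def)
    have sub: "x \<in> cell ?c (R/2)" "y \<in> cell ?c (R/2)"
      using sub_cell[OF Suc.prems(1)] sub_cell[OF Suc.prems(2)] by (simp_all add: c[symmetric])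
    obtain e f :: int where v: "dir (x - c) = Complex (real_of_int e) (real_of_int f)" by (rule dir_ints)
    have e: "?c = Complex (R/2 * real_of_int (2 * a + e)) (R/2 * real_of_int (2 * b + f))"
      using Suc.prems(4) by (simp add: sub_centre_def v complex_eq_iff distrib_left)
    have R': "R' = 2 ^ Suc j * (R/2 / sqrt 2)" using Suc.prems(7) by simp
    have R2: "0 < R/2" using Suc.prems(3) by simp
    have "tree_dist n ?c (R/2) x y \<le> sqrt 26 * dist x y \<or> tree_dist m 0 R' (rot x) (rot y) \<le> sqrt 26 * dist x y"
      by (rule Suc.IH[OF sub R2 e Suc.prems(5,6) R']) simp
    then show ?thesis using True by simp
  next
    case dd: False
    define s where "s = R / sqrt 2"
    have s: "0 < s" using Suc.prems(3) by (simp add: s_def)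
    define X Y X' Y' where X: "X = Re (x - c) - Im (x - c)" "Y = Re (x - c) + Im (x - c)"
      and X': "X' = Re (y - c) - Im (y - c)" "Y' = Re (y - c) + Im (y - c)"
    have rx: "rot x - rot c = Complex (X / sqrt 2) (Y / sqrt 2)" "rot y - rot c = Complex (X' / sqrt 2) (Y' / sqrt 2)"
      unfolding rot_diff by (simp_all only: rot_def X X')
    have le: "\<bar>X\<bar> \<le> R" "\<bar>Y\<bar> \<le> R" "\<bar>X'\<bar> \<le> R" "\<bar>Y'\<bar> \<le> R"
      using Suc.prems(1,2) abs_add_le[of "Re (x - c)" "Im (x - c)" R] abs_add_le[of "Re (y - c)" "Im (y - c)" R]
      unfolding X X' cell_def mem_Collect_eq by blast+
    \<comment> \<open>In units of \<open>s\<close> the rotated centre has the even coordinate sum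
      \<open>2 * a\<close>; the midpoints of the sides of the square differ from it by one unit and
      so have odd sum, as the diamonds of the second tree require.\<close>
    have rc: "rot c = Complex (s * real_of_int (a - b)) (s * real_of_int (a + b))"
      using Suc.prems(4) by (simp add: rot_def s_def right_diff_distrib distrib_left diff_divide_distrib add_divide_distrib)
    have lattice: "tree_dist m 0 R' (rot x) (rot y) \<le> B"
      if q: "q = rot c + Complex (s * real_of_int e) (s * real_of_int f)" "odd (e + f)"
        and in_q: "\<bar>Re (rot x - q)\<bar> + \<bar>Im (rot x - q)\<bar> < s" "\<bar>Re (rot y - q)\<bar> + \<bar>Im (rot y - q)\<bar> < s"
        and B: "Re (rot x - q) * Re (rot y - q) \<le> 0 \<and> B = 5 * \<bar>Re (rot x - rot y)\<bar> + \<bar>Im (rot x - rot y)\<bar> \<or>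
          Im (rot x - q) * Im (rot y - q) \<le> 0 \<and> B = \<bar>Re (rot x - rot y)\<bar> + 5 * \<bar>Im (rot x - rot y)\<bar>" for q e f B
    proof (rule tree_dist_lattice_cell[OF Suc.prems(5,6) _ in_q _ _ B])
      show "R' = 2 ^ j * s" using Suc.prems(7) by (simp add: s_def)
      show "q - 0 = Complex (s * real_of_int (a - b + e)) (s * real_of_int (a + b + f))"
        unfolding q(1) rc by (simp add: complex_eq_iff distrib_left)
      show "even ((a - b + e) + (a + b + f)) \<longleftrightarrow> j = 0" using q(2) Suc.prems(8) by auto
    qed
    have ax: "5 * \<bar>Re (rot x - rot y)\<bar> + \<bar>Im (rot x - rot y)\<bar> \<le> sqrt 26 * dist x y"
      "\<bar>Re (rot x - rot y)\<bar> + 5 * \<bar>Im (rot x - rot y)\<bar> \<le> sqrt 26 * dist x y"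
      using axis_le[of "rot x - rot y"] by (simp_all only: dist_norm[symmetric] dist_rot)
    define k where "k = sqrt 2"
    have k: "0 < k" by (simp add: k_def)
    \<comment> \<open>The triangle at the side \<open>v = R\<close> lies in the open diamond of
      radius \<open>s\<close> around the midpoint of that side.\<close>
    have sc: "\<bar>u / k\<bar> + \<bar>v / k - s\<bar> < s" if "\<bar>u\<bar> < v" "\<bar>v\<bar> \<le> R" for u v
    proof -
      have "\<bar>u\<bar> / k < v / k" "v / k \<le> s" using that k by (auto simp: s_def k_def[symmetric] divide_right_mono divide_strict_right_mono)
      then show ?thesis using k by (simp add: abs_divide)
    qed
    have sc': "\<bar>u / k\<bar> + \<bar>v / k + s\<bar> < s" if "\<bar>u\<bar> < - v" "\<bar>v\<bar> \<le> R" for u v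
      using sc[of u "- v"] that by (simp add: abs_minus_commute)
    have pr: "u / k * (v / k) \<le> 0" if "u * v \<le> 0" for u v
      using that k by (simp add: divide_le_0_iff)
    have rr: "Re (rot x - (rot c + z)) = X / k - Re z" "Im (rot x - (rot c + z)) = Y / k - Im z"
      "Re (rot y - (rot c + z)) = X' / k - Re z" "Im (rot y - (rot c + z)) = Y' / k - Im z" for z
      using arg_cong[OF rx(1), of Re] arg_cong[OF rx(1), of Im] arg_cong[OF rx(2), of Re] arg_cong[OF rx(2), of Im]
      by (simp_all add: k_def)
    note T = tree_dist_sep_diagonal[OF Suc.prems(1,2) dd X X', of n]
    have diff: "X - X' = Re (x - y) - Im (x - y)" "Y - Y' = Re (x - y) + Im (x - y)"
      by (simp_all add: X X')
    have tree_dist: "tree_dist (Suc n) c R x y = centre_dist n c R x + centre_dist n c R y" using dd by simp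
    have vert: ?thesis if "X * X' \<le> 0" "\<bar>Re (rot x - q)\<bar> + \<bar>Im (rot x - q)\<bar> < s" "\<bar>Re (rot y - q)\<bar> + \<bar>Im (rot y - q)\<bar> < s"
        "q = rot c + Complex (s * real_of_int 0) (s * real_of_int f)" "odd f" for q f
    proof -
      have "Re (rot x - q) * Re (rot y - q) \<le> 0" unfolding that(4) rr using pr[OF that(1)] by simp
      then have "tree_dist m 0 R' (rot x) (rot y) \<le> 5 * \<bar>Re (rot x - rot y)\<bar> + \<bar>Im (rot x - rot y)\<bar>"
        using that(5) by (intro lattice[OF that(4) _ that(2,3)]) simp_all
      then show ?thesis using ax(1) by linarith
    qed
    have hor: ?thesis if "Y * Y' \<le> 0" "\<bar>Re (rot x - q)\<bar> + \<bar>Im (rot x - q)\<bar> < s" "\<bar>Re (rot y - q)\<bar> + \<bar>Im (rot y - q)\<bar> < s"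
        "q = rot c + Complex (s * real_of_int e) (s * real_of_int 0)" "odd e" for q e
    proof -
      have "Im (rot x - q) * Im (rot y - q) \<le> 0" unfolding that(4) rr using pr[OF that(1)] by simp
      then have "tree_dist m 0 R' (rot x) (rot y) \<le> \<bar>Re (rot x - rot y)\<bar> + 5 * \<bar>Im (rot x - rot y)\<bar>"
        using that(5) by (intro lattice[OF that(4) _ that(2,3)]) simp_all
      then show ?thesis using ax(2) by linarith
    qed
    from T show ?thesis
    proof (elim disjE conjE)
      assume "centre_dist n c R x + centre_dist n c R y \<le> 3 * \<bar>X - X'\<bar> + 2 * \<bar>Y - Y'\<bar>"
      then have "tree_dist (Suc n) c R x y \<le> sqrt 26 * dist x y"
        using diagonal_le(1)[of "x - y"] unfolding tree_dist diff dist_norm by (rule order_trans)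
      then show ?thesis ..
    next
      assume "centre_dist n c R x + centre_dist n c R y \<le> 2 * \<bar>X - X'\<bar> + 3 * \<bar>Y - Y'\<bar>"
      then have "tree_dist (Suc n) c R x y \<le> sqrt 26 * dist x y"
        using diagonal_le(2)[of "x - y"] unfolding tree_dist diff dist_norm by (rule order_trans)
      then show ?thesis ..
    next
      assume a: "X * X' \<le> 0" "\<bar>X\<bar> < Y" "\<bar>X'\<bar> < Y'"
      show ?thesis
        by (rule vert[OF a(1) _ _ HOL.refl, of 1])
          (unfold rr, use sc[OF a(2) le(2)] sc[OF a(3) le(4)] in \<open>simp_all\<close>)
    next
      assume a: "X * X' \<le> 0" "\<bar>X\<bar> < - Y" "\<bar>X'\<bar> < - Y'"
      show ?thesis
        by (rule vert[OF a(1) _ _ HOL.refl, of "- 1"])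
          (unfold rr, use sc'[OF a(2) le(2)] sc'[OF a(3) le(4)] in \<open>simp_all\<close>)
    next
      assume a: "Y * Y' \<le> 0" "\<bar>Y\<bar> < X" "\<bar>Y'\<bar> < X'"
      show ?thesis
        by (rule hor[OF a(1) _ _ HOL.refl, of 1])
          (unfold rr, use sc[OF a(2) le(1)] sc[OF a(3) le(3)] in \<open>simp_all add: add.commute\<close>)
    next
      assume a: "Y * Y' \<le> 0" "\<bar>Y\<bar> < - X" "\<bar>Y'\<bar> < - X'"
      show ?thesis
        by (rule hor[OF a(1) _ _ HOL.refl, of "- 1"])
          (unfold rr, use sc'[OF a(2) le(1)] sc'[OF a(3) le(3)] in \<open>simp_all add: add.commute\<close>)
    qed
  qed
qed simp

section \<open>Assembly of the two trees\<close>

lemma finite_cell: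
  assumes "finite (S :: complex set)"
  shows "\<exists>R>0. S \<subseteq> cell 0 R"
proof (intro exI conjI subsetI)
  let ?R = "1 + (\<Sum>z\<in>S. \<bar>Re z\<bar> + \<bar>Im z\<bar>)"
  show "0 < ?R" by (intro add_pos_nonneg sum_nonneg) auto
  fix z assume "z \<in> S"
  then have "\<bar>Re z\<bar> + \<bar>Im z\<bar> \<le> (\<Sum>z\<in>S. \<bar>Re z\<bar> + \<bar>Im z\<bar>)"
    using assms by (intro member_le_sum) auto
  then show "z \<in> cell 0 ?R" by (simp add: cell_def)
qed

lemma finite_separation:
  assumes "finite (S :: complex set)"
  shows "\<exists>n. \<forall>x\<in>S. \<forall>y\<in>S. x \<noteq> y \<longrightarrow> R / 2 ^ n < dist x y"
proof -
  have "\<exists>d>0. \<forall>x\<in>S. \<forall>y\<in>S. x \<noteq> y \<longrightarrow> d \<le> dist x y"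
  proof (cases "{dist x y | x y. x \<in> S \<and> y \<in> S \<and> x \<noteq> y} = {}")
    case True
    then show ?thesis by (intro exI[of _ 1]) auto
  next
    case False
    let ?corner_dist = "{dist x y | x y. x \<in> S \<and> y \<in> S \<and> x \<noteq> y}"
    have "?corner_dist \<subseteq> (\<lambda>(x, y). dist x y) ` (S \<times> S)" by auto
    then have fin: "finite ?corner_dist" using assms by (meson finite_SigmaI finite_imageI finite_subset)
    have "Min ?corner_dist \<in> ?corner_dist" using Min_in[OF fin False] .
    then have "0 < Min ?corner_dist" by auto
    moreover have "Min ?corner_dist \<le> dist x y" if "x \<in> S" "y \<in> S" "x \<noteq> y" for x y
      using that by (intro Min_le[OF fin]) blast
    ultimately show ?thesis by blast
  qed
  then obtain d where d: "0 < d" "\<forall>x\<in>S. \<forall>y\<in>S. x \<noteq> y \<longrightarrow> d \<le> dist x y" by blast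
  obtain n where n: "R / d < 2 ^ n" using real_arch_pow[of 2 "R / d"] by auto
  have "R / 2 ^ n < d" using n d(1) by (simp add: field_simps)
  then show ?thesis using d(2) by (meson order_less_le_trans)
qed

context scheme begin

lemma tree_exists:
  assumes "finite S" "S \<noteq> {}" "S \<subseteq> cell 0 R" "0 < R"
  shows "\<exists>n0. \<forall>n\<ge>n0. \<exists>E. is_tree S E \<and> (\<forall>x\<in>S. deg E x \<le> 2 * K + 5) \<and>
    (\<forall>x\<in>S. \<forall>y\<in>S. x \<noteq> y \<longrightarrow> walk_le E x y (\<kappa> * tree_dist n 0 R x y))"
proof -
  obtain n0 where n0: "\<forall>x\<in>S. \<forall>y\<in>S. x \<noteq> y \<longrightarrow> 2 * R / 2 ^ n0 < dist x y"
    using finite_separation[OF assms(1)] by blast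
  have "\<exists>E. is_tree S E \<and> (\<forall>x\<in>S. deg E x \<le> 2 * K + 5) \<and> (\<forall>x\<in>S. \<forall>y\<in>S. x \<noteq> y \<longrightarrow> walk_le E x y (\<kappa> * tree_dist n 0 R x y))"
    if n: "n0 \<le> n" for n
  proof -
    have one: "1 \<in> units" by (simp add: units_def)
    have sep: "2 * R / 2 ^ n < dist x y" if "x \<in> S" "y \<in> S" "x \<noteq> y" for x y
    proof -
      have "(2::real) ^ n0 \<le> 2 ^ n" using n by (intro power_increasing) auto
      then have "2 * R / 2 ^ n \<le> 2 * R / 2 ^ n0" using assms(4) by (intro divide_left_mono) auto
      then show ?thesis using n0 that by fastforce
    qed
    have "\<exists>E r Q T. fresh S (S \<union> {}) E (\<lambda>x. if x \<in> S then corner_dist n 0 R 1 x else (0::real) + 2 * R)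
        (0 + complex_of_real R * 1) R ({} \<noteq> ({}::complex set)) r Q T \<and> {} \<subseteq> E \<and>
        (\<forall>x\<in>S. \<forall>y\<in>S. x \<noteq> y \<longrightarrow> walk_le E x y (\<kappa> * tree_dist n 0 R x y)) \<and>
        (\<forall>x\<in>S. \<forall>y\<in>{}. walk_le E x y (\<kappa> * (corner_dist n 0 R (- 1) x + 0)))"
      by (rule scheme_exists[OF assms one sep]) auto
    then obtain E r Q T where E: "fresh S (S \<union> {}) E (\<lambda>x. if x \<in> S then corner_dist n 0 R 1 x else (0::real) + 2 * R)
        (0 + complex_of_real R * 1) R ({} \<noteq> ({}::complex set)) r Q T"
      "\<forall>x\<in>S. \<forall>y\<in>S. x \<noteq> y \<longrightarrow> walk_le E x y (\<kappa> * tree_dist n 0 R x y)" by (elim exE conjE)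
    show ?thesis using freshD(1)[OF E(1)] fresh_deg[OF E(1)] E(2) by auto
  qed
  then show ?thesis by blast
qed

lemma kappa_pos: "4 \<le> \<kappa>"
  using theta_pos by (simp add: kappa)

lemma two_trees:
  assumes "finite S" "S \<noteq> {}"
  shows "\<exists>E E'. is_tree S E \<and> is_tree (rot ` S) E' \<and> (\<forall>x\<in>S. deg E x \<le> 2 * K + 5) \<and> (\<forall>x\<in>rot ` S. deg E' x \<le> 2 * K + 5) \<and>
    (\<forall>x\<in>S. \<forall>y\<in>S. walk_le E x y (\<kappa> * sqrt 26 * dist x y) \<or> walk_le E' (rot x) (rot y) (\<kappa> * sqrt 26 * dist x y))"
proof -
  obtain R where R: "0 < R" "S \<subseteq> cell 0 R" using finite_cell[OF assms(1)] by blast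
  \<comment> \<open>\<open>tree_dist_cover\<close> needs a nonzero exponent; with 1 the root cell is
    also large enough for the rotated points.\<close>
  define R' where "R' = 2 ^ 1 * (R / sqrt 2)"
  have R': "0 < R'" using R by (simp add: R'_def)
  have sub: "rot ` S \<subseteq> cell 0 R'"
  proof (rule image_subsetI)
    fix x assume "x \<in> S"
    then have "\<bar>Re x\<bar> + \<bar>Im x\<bar> \<le> R" using R(2) by (auto simp: cell_def)
    then have "\<bar>Re x - Im x\<bar> + \<bar>Re x + Im x\<bar> \<le> 2 * R" by (auto simp: abs_if split: if_splits)
    then have "(\<bar>Re x - Im x\<bar> + \<bar>Re x + Im x\<bar>) / sqrt 2 \<le> 2 * R / sqrt 2" by (intro divide_right_mono) auto
    moreover have "\<bar>Re (rot x - 0)\<bar> + \<bar>Im (rot x - 0)\<bar> = (\<bar>Re x - Im x\<bar> + \<bar>Re x + Im x\<bar>) / sqrt 2"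
      by (simp add: rot_def abs_divide flip: add_divide_distrib)
    moreover have "R' = 2 * R / sqrt 2" by (simp add: R'_def)
    ultimately show "rot x \<in> cell 0 R'" unfolding cell_def mem_Collect_eq by linarith
  qed
  obtain n1 where n1: "\<forall>n\<ge>n1. \<exists>E. is_tree S E \<and> (\<forall>x\<in>S. deg E x \<le> 2 * K + 5) \<and>
      (\<forall>x\<in>S. \<forall>y\<in>S. x \<noteq> y \<longrightarrow> walk_le E x y (\<kappa> * tree_dist n 0 R x y))"
    using tree_exists[OF assms R(2,1)] by blast
  obtain n2 where n2: "\<forall>n\<ge>n2. \<exists>E. is_tree (rot ` S) E \<and> (\<forall>x\<in>rot ` S. deg E x \<le> 2 * K + 5) \<and>
      (\<forall>x\<in>rot ` S. \<forall>y\<in>rot ` S. x \<noteq> y \<longrightarrow> walk_le E x y (\<kappa> * tree_dist n 0 R' x y))"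
    using tree_exists[OF finite_imageI[OF assms(1)] _ sub R'] assms(2) by blast
  obtain E where E: "is_tree S E" "\<forall>x\<in>S. deg E x \<le> 2 * K + 5"
      "\<forall>x\<in>S. \<forall>y\<in>S. x \<noteq> y \<longrightarrow> walk_le E x y (\<kappa> * tree_dist n1 0 R x y)"
    using n1[THEN spec, THEN mp, OF order_refl] by (elim exE conjE)
  obtain E' where E': "is_tree (rot ` S) E'" "\<forall>x\<in>rot ` S. deg E' x \<le> 2 * K + 5"
      "\<forall>x\<in>rot ` S. \<forall>y\<in>rot ` S. x \<noteq> y \<longrightarrow> walk_le E' x y (\<kappa> * tree_dist n2 0 R' x y)"
    using n2[THEN spec, THEN mp, OF order_refl] by (elim exE conjE)
  have "walk_le E x y (\<kappa> * sqrt 26 * dist x y) \<or> walk_le E' (rot x) (rot y) (\<kappa> * sqrt 26 * dist x y)"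
    if xy: "x \<in> S" "y \<in> S" for x y
  proof (cases "x = y")
    case True
    then show ?thesis by (simp add: walk_le.refl)
  next
    case False
    have r: "rot x \<in> rot ` S" "rot y \<in> rot ` S" "rot x \<noteq> rot y" using xy False dist_rot[of x y] by auto
    have "tree_dist n1 0 R x y \<le> sqrt 26 * dist x y \<or> tree_dist n2 0 R' (rot x) (rot y) \<le> sqrt 26 * dist x y"
    proof (rule tree_dist_cover[OF _ _ R(1) _ _ _ R'_def])
      show "x \<in> cell 0 R" "y \<in> cell 0 R" using R(2) xy by blast+
      show "rot x \<in> cell 0 R'" "rot y \<in> cell 0 R'" using sub r by blast+
      show "0 = Complex (R * real_of_int 0) (R * real_of_int 0)" by (simp add: complex_eq_iff)
    qed simp
    then show ?thesis
    proof
      assume "tree_dist n1 0 R x y \<le> sqrt 26 * dist x y"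
      then have "\<kappa> * tree_dist n1 0 R x y \<le> \<kappa> * (sqrt 26 * dist x y)" using kappa_pos by (intro mult_left_mono) auto
      then show ?thesis using walk_le_le[OF E(3)[rule_format, OF xy False]] by (simp add: mult.assoc)
    next
      assume "tree_dist n2 0 R' (rot x) (rot y) \<le> sqrt 26 * dist x y"
      then have "\<kappa> * tree_dist n2 0 R' (rot x) (rot y) \<le> \<kappa> * (sqrt 26 * dist x y)"
        using kappa_pos by (intro mult_left_mono) auto
      then show ?thesis using walk_le_le[OF E'(3)[rule_format, OF r]] by (simp add: mult.assoc)
    qed
  qed
  then show ?thesis using E(1,2) E'(1,2) by blast
qed

end

definition plane :: "complex \<Rightarrow> real ^ 2" where "plane z = vector [Re z, Im z]"

lemma dist_plane: "dist (plane z) (plane u) = dist z u"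
  by (simp add: plane_def dist_norm norm_vec_def L2_set_def sum_2 cmod_def)

lemma plane_Complex: "plane (Complex (v $ 1) (v $ 2)) = v"
  by (simp add: plane_def vec_eq_iff forall_2)

lemma rot_surj: "\<exists>u. rot u = z"
proof
  have s: "sqrt 2 * sqrt 2 = (2::real)" by simp
  show "rot (Complex ((Re z + Im z) / sqrt 2) ((Im z - Re z) / sqrt 2)) = z"
    by (simp add: rot_def complex_eq_iff field_simps)
qed

text \<open>The two trees live in coordinates rotated against each other; each is carried to
  \<open>P\<close> by its own isometry, which preserves degrees and walk lengths.\<close>

lemma metric_graph_pull:
  assumes t: "is_tree S E" and iso: "\<And>u v. u \<in> S \<Longrightarrow> v \<in> S \<Longrightarrow> dist (g u) (g v) = dist u v"
  shows "\<exists>G. spanning_tree_of (g ` S) G \<and>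
    (\<forall>k. (\<forall>x\<in>S. deg E x \<le> k) \<longrightarrow> max_degree_le G k) \<and>
    (\<forall>x\<in>g ` S. \<forall>y\<in>g ` S. dist x y \<le> wgraph_dist G x y) \<and>
    (\<forall>x\<in>S. \<forall>y\<in>S. \<forall>L. walk_le E x y L \<longrightarrow> wgraph_dist G (g x) (g y) \<le> L)"
proof -
  have inj: "inj_on g S"
  proof (rule inj_onI)
    fix x y assume "x \<in> S" "y \<in> S" "g x = g y"
    then show "x = y" using iso[of x y] by simp
  qed
  note m = is_tree_metric_graph[OF is_tree_image[OF t inj]]
  show ?thesis
  proof (intro exI conjI allI impI ballI)
    show "spanning_tree_of (g ` S) (metric_graph (g ` S) ((`) g ` E))" by (rule m(1))
    show "max_degree_le (metric_graph (g ` S) ((`) g ` E)) k" if "\<forall>x\<in>S. deg E x \<le> k" for k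
      using that deg_image[OF t inj] by (intro m(4)) auto
    show "dist x y \<le> wgraph_dist (metric_graph (g ` S) ((`) g ` E)) x y" if "x \<in> g ` S" "y \<in> g ` S" for x y
      by (rule m(3)[OF that])
    show "wgraph_dist (metric_graph (g ` S) ((`) g ` E)) (g x) (g y) \<le> L" if "x \<in> S" "y \<in> S" "walk_le E x y L" for x y L
      using m(2)[OF imageI[OF that(1)] walk_le_image[OF t that(3,1) iso]] by blast
  qed
qed

lemma empty_tree: "spanning_tree_of {} (metric_graph {} {})" "max_degree_le (metric_graph {} {}) k"
  by (auto simp: spanning_tree_of_def wtree_def wf_wgraph_def metric_graph_def max_degree_le_def wgraph_cycle_def)

lemma spanning_cover:
  fixes P :: "(real ^ 2) set"
  assumes P: "finite P" and l: "1 \<le> (l::nat)"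
  shows "\<exists>T1 T2. spanning_tree_cover (4 * sqrt 26 / (1 - 1 / 2 ^ l)) P {T1, T2} \<and>
    max_degree_le T1 (2 * l + 5) \<and> max_degree_le T2 (2 * l + 5)"
proof -
  define \<theta> \<kappa> :: real where th: "\<theta> = 4 / (2 ^ l - 1)" and ka: "\<kappa> = 4 + \<theta>"
  have p: "(1::real) < 2 ^ l" using l by (intro one_less_power) auto
  interpret scheme l \<theta> \<kappa>
  proof
    have nz: "(2::real) ^ l - 1 \<noteq> 0" using p by linarith
    show "\<theta> * (2 ^ l - 1) = 4"
      by (simp only: th times_divide_eq_left nonzero_mult_div_cancel_right[OF nz])
  qed (rule l ka)+
  have t: "4 * sqrt 26 / (1 - 1 / 2 ^ l) = \<kappa> * sqrt 26"
    using p by (simp add: ka th field_simps)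
  have "1 * 1 \<le> \<kappa> * sqrt 26" using kappa_pos by (intro mult_mono) auto
  then have t1: "1 \<le> \<kappa> * sqrt 26" by simp
  show ?thesis unfolding t
  proof (cases "P = {}")
    case True
    have "spanning_tree_cover (\<kappa> * sqrt 26) P {metric_graph {} {}, metric_graph {} {}}"
      unfolding spanning_tree_cover_def tree_cover_def True
      using t1 empty_tree(1) by (auto simp: spanning_tree_of_def)
    then show "\<exists>T1 T2. spanning_tree_cover (\<kappa> * sqrt 26) P {T1, T2} \<and>
        max_degree_le T1 (2 * l + 5) \<and> max_degree_le T2 (2 * l + 5)" using empty_tree(2) by blast
  next
    case False
    have "\<exists>u. plane (rot u) = v" for v using rot_surj plane_Complex by metis
    then have "P \<subseteq> range (\<lambda>u. plane (rot u))" by (metis rangeI subsetI)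
    \<comment> \<open>Writing points as \<open>plane (rot u)\<close> lets the first tree be built on
      the \<open>u\<close> and the second on the \<open>rot u\<close>.\<close>
    then obtain S where S: "finite S" "P = (\<lambda>u. plane (rot u)) ` S" using finite_subset_image[OF P] by blast
    then have Sne: "S \<noteq> {}" using False by blast
    obtain E E' where E: "is_tree S E" "is_tree (rot ` S) E'" "\<forall>x\<in>S. deg E x \<le> 2 * l + 5" "\<forall>x\<in>rot ` S. deg E' x \<le> 2 * l + 5"
      "\<forall>x\<in>S. \<forall>y\<in>S. walk_le E x y (\<kappa> * sqrt 26 * dist x y) \<or> walk_le E' (rot x) (rot y) (\<kappa> * sqrt 26 * dist x y)"
      using two_trees[OF S(1) Sne] by (elim exE conjE)
    have P': "P = plane ` (rot ` S)" using S(2) by (simp add: image_image)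
    obtain T1 where T1: "spanning_tree_of P T1" "max_degree_le T1 (2 * l + 5)"
      "\<And>x y. x \<in> P \<Longrightarrow> y \<in> P \<Longrightarrow> dist x y \<le> wgraph_dist T1 x y"
      "\<And>x y L. x \<in> S \<Longrightarrow> y \<in> S \<Longrightarrow> walk_le E x y L \<Longrightarrow> wgraph_dist T1 (plane (rot x)) (plane (rot y)) \<le> L"
      using metric_graph_pull[OF E(1), of "\<lambda>u. plane (rot u)"] E(3) unfolding S(2)[symmetric] dist_plane dist_rot by blast
    obtain T2 where T2: "spanning_tree_of P T2" "max_degree_le T2 (2 * l + 5)"
      "\<And>x y. x \<in> P \<Longrightarrow> y \<in> P \<Longrightarrow> dist x y \<le> wgraph_dist T2 x y"
      "\<And>x y L. x \<in> rot ` S \<Longrightarrow> y \<in> rot ` S \<Longrightarrow> walk_le E' x y L \<Longrightarrow> wgraph_dist T2 (plane x) (plane y) \<le> L"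
      using metric_graph_pull[OF E(2), of plane] E(4) unfolding P'[symmetric] dist_plane by blast
    have "spanning_tree_cover (\<kappa> * sqrt 26) P {T1, T2}"
      unfolding spanning_tree_cover_def tree_cover_def
    proof (intro conjI ballI)
      show "1 \<le> \<kappa> * sqrt 26" by (rule t1)
      show "wtree T" "P \<subseteq> verts T" "spanning_tree_of P T" if "T \<in> {T1, T2}" for T
        using that T1(1) T2(1) by (auto simp: spanning_tree_of_def)
      fix x y assume xy: "x \<in> P" "y \<in> P"
      then obtain u v where u: "u \<in> S" "x = plane (rot u)" and v: "v \<in> S" "y = plane (rot v)"
        unfolding S(2) by blast
      from E(5)[rule_format, OF u(1) v(1)]
      show "\<exists>T\<in>{T1, T2}. dist x y \<le> wgraph_dist T x y \<and> wgraph_dist T x y \<le> \<kappa> * sqrt 26 * dist x y"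
      proof
        assume "walk_le E u v (\<kappa> * sqrt 26 * dist u v)"
        from T1(4)[OF u(1) v(1) this] have "wgraph_dist T1 x y \<le> \<kappa> * sqrt 26 * dist x y"
          by (simp only: u(2) v(2) dist_plane dist_rot)
        then show ?thesis using T1(3)[OF xy] by simp
      next
        assume "walk_le E' (rot u) (rot v) (\<kappa> * sqrt 26 * dist u v)"
        from T2(4)[OF imageI[OF u(1)] imageI[OF v(1)] this]
        have "wgraph_dist T2 x y \<le> \<kappa> * sqrt 26 * dist x y" by (simp only: u(2) v(2) dist_plane dist_rot)
        then show ?thesis using T2(3)[OF xy] by simp
      qed
    qed
    then show "\<exists>T1 T2. spanning_tree_cover (\<kappa> * sqrt 26) P {T1, T2} \<and>
        max_degree_le T1 (2 * l + 5) \<and> max_degree_le T2 (2 * l + 5)" using T1(2) T2(2) by blast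
  qed
qed

lemma max_degree_mono: "max_degree_le G k \<Longrightarrow> k \<le> m \<Longrightarrow> max_degree_le G m"
  unfolding max_degree_le_def using order_trans by blast

theorem mainTheorem4:
  fixes P :: "(real ^ 2) set"
  assumes "finite P"
  shows "(\<forall>l::nat. 1 \<le> l \<longrightarrow>
            (\<exists>T1 T2. spanning_tree_cover (4 * sqrt 26 / (1 - 1 / 2 ^ l)) P {T1, T2} \<and>
                     max_degree_le T1 (1 + 3 * (l + 1)) \<and>
                     max_degree_le T2 (1 + 3 * (l + 1)))) \<and>
         (\<exists>T1 T2. spanning_tree_cover (8 * sqrt 26) P {T1, T2} \<and>
                  max_degree_le T1 7 \<and> max_degree_le T2 7)"
proof (intro conjI allI impI)
  fix l :: nat assume l: "1 \<le> l"
  obtain T1 T2 where T: "spanning_tree_cover (4 * sqrt 26 / (1 - 1 / 2 ^ l)) P {T1, T2}"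
    "max_degree_le T1 (2 * l + 5)" "max_degree_le T2 (2 * l + 5)" using spanning_cover[OF assms l] by blast
  \<comment> \<open>The construction gives degree \<open>2 * l + 5\<close>, equal to the claimed
    bound for \<open>l = 1\<close> and smaller for larger \<open>l\<close>.\<close>
  have "2 * l + 5 \<le> 1 + 3 * (l + 1)" using l by simp
  then show "\<exists>T1 T2. spanning_tree_cover (4 * sqrt 26 / (1 - 1 / 2 ^ l)) P {T1, T2} \<and>
      max_degree_le T1 (1 + 3 * (l + 1)) \<and> max_degree_le T2 (1 + 3 * (l + 1))"
    using T max_degree_mono by blast
next
  have e: "4 * sqrt 26 / (1 - 1 / 2 ^ 1) = 8 * sqrt 26" "2 * 1 + 5 = (7::nat)" by simp_all
  show "\<exists>T1 T2. spanning_tree_cover (8 * sqrt 26) P {T1, T2} \<and> max_degree_le T1 7 \<and> max_degree_le T2 7"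
    using spanning_cover[OF assms order_refl] unfolding e .
qed

end
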